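(* Let $d\ge1$ and let $p$ be an odd integer such that $1<p<1+\frac{4}{(d-2)_+}$. Let $N\ge 1$ and for all $j\in\{1,\dots,N\}$ let $\omega_j>0$, $\gamma_j\in\mathbb{R}$, $x_j^0\in\mathbb{R}^d$, $v_j\in\mathbb{R}^d$ with $v_j\ne v_{j'}$ for all $j\neq j'$. Let $u$ be a multi-soliton of the nonlinear Schrödinger equation $i\partial_tu+\Delta u+|u|^{p-1}u=0$ associated with these parameters, defined on $[T_0,+\infty)$ with $T_0\ge 0$ (see context). Let $\beta>\max\{|v_j|,\ j=1,\dots,N\}$. Then there exists $T_1>0$ with $T_1\ge T_0$ such that for all $s\in\mathbb{N}^d$ and all $n\in\mathbb{N}$, there exists $C_{s,n}>0$ such that for all $t\ge T_1$ and all $x\in\mathbb{R}^d$ with $|x|>\beta t$, $$\left|\partial^s u(t,x)\right|\le\frac{C_{s,n}}{(|x|-\beta t)^n}.$$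
   Context: $\mathbb{N}=\{0,1,2,\dots\}$; $(d-2)_+=\max(d-2,0)$, and $1+\frac{4}{(d-2)_+}=+\infty$ if $d\le 2$. The unknown $u$ is complex valued on (a subset of) $\mathbb{R}\times\mathbb{R}^d$; $|x|$ is the Euclidean norm; $\partial^s$ with $s\in\mathbb{N}^d$ denotes the corresponding spatial partial derivative. For $\omega>0$, $Q_\omega\in H^1(\mathbb{R}^d)$ is the unique positive radial solution of $\Delta Q_\omega+Q_\omega^p=\omega Q_\omega$; for every multi-index $\sigma$ there is $C_\sigma>0$ with $|\partial^\sigma Q_\omega(x)|\le C_\sigma e^{-\sqrt\omega|x|}$ on $\mathbb{R}^d$. Solitons are the solutions $$R_{\omega,v,\gamma,x^0}(t,x)=Q_\omega(x-x^0-vt)\,e^{i\left(\frac12 v\cdot x+\left(\omega-\frac{|v|^2}{4}\right)t+\gamma\right)}.$$ Multi-soliton: here a multi-soliton associated with the parameters $(\omega_j,v_j,\gamma_j,x_j^0)_{1\le j\le N}$ is a solution $u$ of the equation, as given by a known existence theorem (Merle; Martel–Merle; Côte–Martel–Merle; Côte–Friederich), for which there are $T_0\ge0$, $\theta>0$ and constants $\lambda_s>0$ such that for all $s\ge0$, $u\in\mathscr{C}([T_0,+\infty),H^s(\mathbb{R}^d))$ and $\|u(t)-\sum_{j=1}^N R_{\omega_j,v_j,\gamma_j,x_j^0}(t)\|_{H^s}\le\lambda_se^{-\theta t}$ for all $t\ge T_0$. *)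

theory Defs
  imports "HOL-Analysis.Analysis"
begin

text \<open>The space \<open>\<real>\<^sup>d\<close> is rendered as \<open>real ^ 'n\<close>, with \<open>d = CARD('n) \<ge> 1\<close>, and multi-indices
  in \<open>\<nat>\<^sup>d\<close> as \<open>nat ^ 'n\<close>.\<close>

section \<open>Partial derivatives\<close>

definition partial :: "'n::finite \<Rightarrow> (real ^ 'n \<Rightarrow> 'b::real_normed_vector) \<Rightarrow> real ^ 'n \<Rightarrow> 'b" where
  "partial i f x = vector_derivative (\<lambda>h. f (x + h *\<^sub>R axis i 1)) (at 0)"

text \<open>Being differentiable at every order forces every iterated partial derivative to be
  continuous, so the following is the class \<open>C\<^sup>\<infinity>\<close>.\<close>

definition smooth :: "(real ^ 'n::finite \<Rightarrow> 'b::real_normed_vector) \<Rightarrow> bool" where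
  "smooth f \<longleftrightarrow> (\<forall>xs. foldr partial xs f differentiable_on UNIV)"

definition order_of :: "nat ^ 'n::finite \<Rightarrow> nat" where
  "order_of s = (\<Sum>i\<in>UNIV. s $ i)"

text \<open>The coordinates are differentiated in some fixed order. It is immaterial for
  smooth functions, the only ones to which this is applied below.\<close>

definition multi_partial ::
    "nat ^ 'n::finite \<Rightarrow> (real ^ 'n \<Rightarrow> 'b::real_normed_vector) \<Rightarrow> real ^ 'n \<Rightarrow> 'b" where
  "multi_partial s f =
     foldr (\<lambda>i. partial i ^^ (s $ i)) (SOME xs. distinct xs \<and> set xs = UNIV) f"

definition laplacian :: "(real ^ 'n::finite \<Rightarrow> 'b::real_normed_vector) \<Rightarrow> real ^ 'n \<Rightarrow> 'b" where
  "laplacian f x = (\<Sum>i\<in>UNIV. partial i (partial i f) x)"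


section \<open>The Sobolev spaces \<open>H\<^sup>k\<close>\<close>

definition test_function :: "(real ^ 'n::finite \<Rightarrow> real) \<Rightarrow> bool" where
  "test_function \<phi> \<longleftrightarrow> smooth \<phi> \<and> compact (closure {x. \<phi> x \<noteq> 0})"

definition L2 :: "(real ^ 'n::finite \<Rightarrow> complex) set" where
  "L2 = {f \<in> borel_measurable lborel. integrable lborel (\<lambda>x. (cmod (f x))\<^sup>2)}"

definition has_weak_deriv ::
    "nat ^ 'n::finite \<Rightarrow> (real ^ 'n \<Rightarrow> complex) \<Rightarrow> (real ^ 'n \<Rightarrow> complex) \<Rightarrow> bool" where
  "has_weak_deriv s f g \<longleftrightarrow>
     (\<forall>\<phi>. test_function \<phi> \<longrightarrow>
        (LINT x|lborel. multi_partial s \<phi> x *\<^sub>R f x) =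
        (-1) ^ order_of s * (LINT x|lborel. \<phi> x *\<^sub>R g x))"

definition sobolev :: "nat \<Rightarrow> (real ^ 'n::finite \<Rightarrow> complex) set" where
  "sobolev k = {f \<in> L2. \<forall>s. order_of s \<le> k \<longrightarrow> (\<exists>g\<in>L2. has_weak_deriv s f g)}"

text \<open>Weak derivatives in \<open>L\<^sup>2\<close> are unique up to null sets, so the norm below does not depend on
  the choice made here.\<close>

definition weak_deriv :: "nat ^ 'n::finite \<Rightarrow> (real ^ 'n \<Rightarrow> complex) \<Rightarrow> real ^ 'n \<Rightarrow> complex" where
  "weak_deriv s f = (SOME g. g \<in> L2 \<and> has_weak_deriv s f g)"

lemma finite_order_le: "finite {s :: nat ^ 'n::finite. order_of s \<le> k}"
proof -
  have "{s :: nat ^ 'n. order_of s \<le> k} \<subseteq> vec_lambda ` (UNIV \<rightarrow>\<^sub>E {..k})"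
  proof
    fix s :: "nat ^ 'n" assume s: "s \<in> {s. order_of s \<le> k}"
    have "s $ i \<le> k" for i
      using s member_le_sum[of i UNIV "\<lambda>i. s $ i"] by (simp add: order_of_def)
    then have "s = vec_lambda (vec_nth s)" "vec_nth s \<in> UNIV \<rightarrow>\<^sub>E {..k}"
      by auto
    then show "s \<in> vec_lambda ` (UNIV \<rightarrow>\<^sub>E {..k})" by (rule image_eqI)
  qed
  then show ?thesis
    by (rule finite_subset) (simp add: finite_PiE)
qed

definition sobolev_norm :: "nat \<Rightarrow> (real ^ 'n::finite \<Rightarrow> complex) \<Rightarrow> real" where
  "sobolev_norm k f =
     sqrt (\<Sum>s | order_of s \<le> k. LINT x|lborel. (cmod (weak_deriv s f x))\<^sup>2)"

definition continuous_in_sobolev ::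
    "nat \<Rightarrow> real set \<Rightarrow> (real \<Rightarrow> real ^ 'n::finite \<Rightarrow> complex) \<Rightarrow> bool" where
  "continuous_in_sobolev k I u \<longleftrightarrow>
     (\<forall>t\<in>I. u t \<in> sobolev k) \<and>
     (\<forall>t\<in>I. ((\<lambda>\<tau>. sobolev_norm k (\<lambda>x. u \<tau> x - u t x)) \<longlongrightarrow> 0) (at t within I))"


section \<open>Solitons and multi-solitons\<close>

text \<open>The \<open>H\<^sup>1\<close> solutions of the elliptic equation are \<open>C\<^sup>\<infinity>\<close> by elliptic regularity, so the
  equation is stated for the smooth representative.\<close>

definition ground_state :: "nat \<Rightarrow> real \<Rightarrow> (real ^ 'n::finite \<Rightarrow> real) \<Rightarrow> bool" where
  "ground_state p \<omega> Q \<longleftrightarrow>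
     smooth Q \<and> (\<lambda>x. complex_of_real (Q x)) \<in> sobolev 1 \<and>
     (\<forall>x. Q x > 0) \<and> (\<forall>x y. norm x = norm y \<longrightarrow> Q x = Q y) \<and>
     (\<forall>x. laplacian Q x + Q x ^ p = \<omega> * Q x)"

definition soliton ::
    "(real ^ 'n::finite \<Rightarrow> real) \<Rightarrow> real \<Rightarrow> real ^ 'n \<Rightarrow> real \<Rightarrow> real ^ 'n \<Rightarrow>
     real \<Rightarrow> real ^ 'n \<Rightarrow> complex" where
  "soliton Q \<omega> v \<gamma> x0 t x =
     complex_of_real (Q (x - x0 - t *\<^sub>R v)) *
     exp (\<i> * complex_of_real (1/2 * (v \<bullet> x) + (\<omega> - (norm v)\<^sup>2 / 4) * t + \<gamma>))"

text \<open>A function that is continuous in time with values in every \<open>H\<^sup>k\<close> has a representative that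
  is \<open>C\<^sup>\<infinity>\<close> in space, and for it solving the equation in the sense of distributions is the same as
  solving it pointwise. The pointwise statements below concern this representative; at the initial
  time \<open>T\<^sub>0\<close> the time derivative is one-sided.\<close>

definition nls_solution :: "nat \<Rightarrow> real \<Rightarrow> (real \<Rightarrow> real ^ 'n::finite \<Rightarrow> complex) \<Rightarrow> bool" where
  "nls_solution p T\<^sub>0 u \<longleftrightarrow>
     (\<forall>k. continuous_in_sobolev k {T\<^sub>0..} u) \<and>
     (\<forall>t\<ge>T\<^sub>0. smooth (u t)) \<and>
     (\<forall>t\<ge>T\<^sub>0. \<forall>x. \<exists>u\<^sub>t. ((\<lambda>\<tau>. u \<tau> x) has_vector_derivative u\<^sub>t) (at t within {T\<^sub>0..}) \<and>
        \<i> * u\<^sub>t + laplacian (u t) x + complex_of_real (cmod (u t x) ^ (p - 1)) * u t x = 0)"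

definition multi_soliton ::
    "nat \<Rightarrow> (real \<Rightarrow> real ^ 'n::finite \<Rightarrow> real) \<Rightarrow> nat \<Rightarrow> (nat \<Rightarrow> real) \<Rightarrow> (nat \<Rightarrow> real ^ 'n) \<Rightarrow>
     (nat \<Rightarrow> real) \<Rightarrow> (nat \<Rightarrow> real ^ 'n) \<Rightarrow> real \<Rightarrow> (real \<Rightarrow> real ^ 'n \<Rightarrow> complex) \<Rightarrow> bool" where
  "multi_soliton p Q N \<omega> v \<gamma> x0 T\<^sub>0 u \<longleftrightarrow>
     nls_solution p T\<^sub>0 u \<and>
     (\<exists>\<theta>>0. \<exists>\<Lambda>. (\<forall>k. \<Lambda> k > 0) \<and>
        (\<forall>k. \<forall>t\<ge>T\<^sub>0.
           let w = (\<lambda>x. u t x - (\<Sum>j = 1..N. soliton (Q (\<omega> j)) (\<omega> j) (v j) (\<gamma> j) (x0 j) t x))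
           in w \<in> sobolev k \<and> sobolev_norm k w \<le> \<Lambda> k * exp (- \<theta> * t)))"

end

theory Submission
  imports Defs
begin

text \<open>Write \<open>r = \<surd>(1 + |x|\<^sup>2) - \<beta> t\<close> for the position relative to a front that moves at speed
  \<open>\<beta>\<close>. Every soliton is exponentially localised and slower than the front, and the difference
  between \<open>u\<close> and the sum of the solitons is exponentially small in time in every Sobolev space.
  Hence every spatial derivative of \<open>u\<close> is bounded, and its \<open>L\<^sup>2\<close> norm ahead of the front is
  \<open>O(e\<^sup>-\<^sup>c\<^sup>t)\<close> (\<open>multi_soliton_in_front\<close>). What remains to be found is decay in \<open>r\<close> at a fixed time.

  It comes from the local conservation of mass. In the derivative of \<open>\<integral> |u|\<^sup>2 W(r)\<close> with respect to
  \<open>t\<close> the nonlinear term disappears, because \<open>|u|\<^sup>p\<^sup>-\<^sup>1 u\<close> is a real multiple of \<open>u\<close>, and what is left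
  is bounded by \<open>\<integral> (|u|\<^sup>2 + |u||\<nabla>u|) |W'(r)|\<close>. If \<open>W\<close> grows like \<open>r\<^sup>b\<^sup>+\<^sup>1\<close>, then \<open>W'\<close> grows like \<open>r\<^sup>b\<close>
  only. So a bound \<open>O(e\<^sup>-\<^sup>c\<^sup>t)\<close> for \<open>\<integral> (|u|\<^sup>2 + |u||\<nabla>u|) r\<^sup>b\<close> can be integrated in time from infinity,
  where the weighted mass vanishes, and gives \<open>\<integral> |u|\<^sup>2 r\<^sup>b\<^sup>+\<^sup>1 = O(e\<^sup>-\<^sup>c\<^sup>t)\<close>.

  The flux contains a derivative of \<open>u\<close>, which is recovered by interpolation
  (\<open>decays_at_order_partial\<close>): all derivatives are \<open>O(e\<^sup>-\<^sup>c\<^sup>t)\<close> in \<open>L\<^sup>2\<close> ahead of the front, so if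
  \<open>\<integral> |u|\<^sup>2 r\<^sup>a\<close> is \<open>O(e\<^sup>-\<^sup>c\<^sup>t)\<close>, then so is \<open>\<integral> |\<nabla>u|\<^sup>2 r\<^sup>a\<^sup>-\<^sup>1\<close>. By the Cauchy-Schwarz inequality
  the exponent \<open>b = a - 1/2\<close> is admissible, and each step gains half a power of \<open>r\<close>
  (\<open>mass_gains_half_order\<close>). Repeating it reaches every power for \<open>u\<close>, and interpolating again
  reaches every power for every derivative (\<open>decays_at_every_order\<close>); derivatives of the
  nonlinear term never have to be estimated. A Sobolev embedding on balls of fixed radius turns
  the weighted \<open>L\<^sup>2\<close> bounds into pointwise ones (\<open>pointwise_decay\<close>).

  The Sobolev norms in the hypothesis are built from weak derivatives. They bound the classical
  derivatives of a smooth function by \<open>weak_derivative_bounds_classical\<close>.\<close>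

section \<open>Calculus of smooth functions\<close>

lemma has_vector_derivative_partial:
  fixes f :: "real ^ 'n::finite \<Rightarrow> 'b::real_normed_vector"
  assumes "f differentiable_on UNIV"
  shows "((\<lambda>h. f (x + h *\<^sub>R axis i 1)) has_vector_derivative partial i f (x + t *\<^sub>R axis i 1)) (at t)"
proof -
  have *: "\<exists>D. ((\<lambda>h. f (y + h *\<^sub>R axis i 1)) has_vector_derivative D) (at s)" for y :: "real ^ 'n" and s
  proof -
    obtain f' where f': "(f has_derivative f') (at (y + s *\<^sub>R axis i 1))"
      using assms by (auto simp: differentiable_on_def differentiable_def)
    have "((\<lambda>h. y + h *\<^sub>R axis i 1) has_derivative (\<lambda>h. h *\<^sub>R axis i 1)) (at s)"
      by (auto intro!: derivative_eq_intros)
    from has_derivative_compose[OF this f']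
    have "((\<lambda>h. f (y + h *\<^sub>R axis i 1)) has_derivative (\<lambda>h. f' (h *\<^sub>R axis i 1))) (at s)" .
    then show ?thesis
      using linear_cmul[OF has_derivative_linear[OF f']]
      by (auto simp: has_vector_derivative_def)
  qed
  obtain D where D: "((\<lambda>h. f (x + h *\<^sub>R axis i 1)) has_vector_derivative D) (at t)" using * by blast
  have "((\<lambda>h. f (x + (t + h) *\<^sub>R axis i 1)) has_vector_derivative D) (at 0)"
  proof -
    have "((\<lambda>h. t + h) has_vector_derivative 1) (at 0)" by (auto intro!: derivative_eq_intros)
    from vector_diff_chain_at[OF this, of "\<lambda>h. f (x + h *\<^sub>R axis i 1)" D] D show ?thesis
      by (simp add: o_def)
  qed
  then have "partial i f (x + t *\<^sub>R axis i 1) = D"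
    unfolding partial_def by (intro vector_derivative_at) (simp add: algebra_simps)
  with D show ?thesis by simp
qed

lemma has_vector_derivative_partial_0:
  fixes f :: "real ^ 'n::finite \<Rightarrow> 'b::real_normed_vector"
  assumes "f differentiable_on UNIV"
  shows "((\<lambda>h. f (x + h *\<^sub>R axis i 1)) has_vector_derivative partial i f x) (at 0)"
  using has_vector_derivative_partial[OF assms, of x i 0] by simp

lemma partial_eqI:
  "((\<lambda>h. f (x + h *\<^sub>R axis i 1)) has_vector_derivative D) (at 0) \<Longrightarrow> partial i f x = D"
  unfolding partial_def by (rule vector_derivative_at)

lemma smooth_partials: "smooth f \<Longrightarrow> smooth (foldr partial xs f)"
  unfolding smooth_def by (metis foldr_append)

lemma smooth_partial: "smooth f \<Longrightarrow> smooth (partial i f)"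
  using smooth_partials[of f "[i]"] by simp

lemma smooth_differentiable: "smooth f \<Longrightarrow> f differentiable_on UNIV"
  unfolding smooth_def by (metis foldr_Nil id_apply)

lemma smooth_continuous: "smooth f \<Longrightarrow> continuous_on A f"
  using smooth_differentiable differentiable_imp_continuous_on continuous_on_subset by blast

lemma smooth_measurable [measurable_dest]:
  fixes f :: "real ^ 'n::finite \<Rightarrow> 'b::real_normed_vector"
  shows "smooth f \<Longrightarrow> f \<in> borel_measurable borel"
  by (intro borel_measurable_continuous_onI smooth_continuous)

text \<open>Recursion on the order suits the proofs that a class of functions is smooth: at each step the
  function is replaced by one of its partial derivatives.\<close>

fun differentiable_upto :: "nat \<Rightarrow> (real ^ 'n::finite \<Rightarrow> 'b::real_normed_vector) \<Rightarrow> bool" where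
  "differentiable_upto 0 f \<longleftrightarrow> f differentiable_on UNIV"
| "differentiable_upto (Suc k) f \<longleftrightarrow> f differentiable_on UNIV \<and> (\<forall>i. differentiable_upto k (partial i f))"

lemma differentiable_upto_imp: "differentiable_upto k f \<Longrightarrow> f differentiable_on UNIV"
  by (cases k) auto

lemma differentiable_upto_foldr:
  "(\<And>k. differentiable_upto k f) \<Longrightarrow> differentiable_upto j (foldr partial xs f)"
proof (induction xs arbitrary: j)
  case Nil then show ?case by simp
next
  case (Cons a xs)
  have "differentiable_upto (Suc j) (foldr partial xs f)" by (rule Cons) (rule Cons.prems)
  then show ?case by auto
qed

lemma smooth_iff: "smooth f \<longleftrightarrow> (\<forall>k. differentiable_upto k f)"
proof
  assume "smooth f"
  then have "differentiable_upto k f" for k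
  proof (induction k arbitrary: f)
    case 0 then show ?case by (simp add: smooth_differentiable)
  next
    case (Suc k) then show ?case by (simp add: smooth_differentiable smooth_partial)
  qed
  then show "\<forall>k. differentiable_upto k f" ..
next
  assume "\<forall>k. differentiable_upto k f"
  then show "smooth f"
    unfolding smooth_def by (metis differentiable_upto_foldr differentiable_upto_imp)
qed

lemma differentiable_upto_Suc: "differentiable_upto (Suc k) f \<Longrightarrow> differentiable_upto k f"
proof (induction k arbitrary: f)
  case 0 then show ?case by simp
next
  case (Suc k)
  then show ?case by (metis differentiable_upto.simps(2))
qed

lemma partial_add:
  fixes f g :: "real ^ 'n::finite \<Rightarrow> 'b::real_normed_vector"
  assumes "f differentiable_on UNIV" "g differentiable_on UNIV"
  shows "partial i (\<lambda>x. f x + g x) = (\<lambda>x. partial i f x + partial i g x)"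
  by (rule ext, rule partial_eqI, intro has_vector_derivative_add has_vector_derivative_partial_0 assms)

lemma differentiable_upto_add:
  "differentiable_upto k f \<Longrightarrow> differentiable_upto k g \<Longrightarrow> differentiable_upto k (\<lambda>x. f x + g x)"
  by (induction k arbitrary: f g) (auto simp: partial_add)

lemma smooth_add: "smooth f \<Longrightarrow> smooth g \<Longrightarrow> smooth (\<lambda>x. f x + g x)"
  by (simp add: smooth_iff differentiable_upto_add)

lemma partials_add:
  assumes "smooth f" "smooth g"
  shows "foldr partial xs (\<lambda>x. f x + g x) = (\<lambda>x. foldr partial xs f x + foldr partial xs g x)"
  by (induction xs) (simp_all add: partial_add smooth_differentiable smooth_partials assms)

lemma (in bounded_bilinear) partial_prod:
  assumes "f differentiable_on UNIV" "g differentiable_on UNIV"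
  shows "partial i (\<lambda>x. prod (f x) (g x)) = (\<lambda>x. prod (f x) (partial i g x) + prod (partial i f x) (g x))"
proof (rule ext, rule partial_eqI)
  fix x
  show "((\<lambda>h. f (x + h *\<^sub>R axis i 1) ** g (x + h *\<^sub>R axis i 1)) has_vector_derivative
     f x ** partial i g x + partial i f x ** g x) (at 0)"
    using has_vector_derivative[OF has_vector_derivative_partial_0[OF assms(1)] has_vector_derivative_partial_0[OF assms(2)]]
    by simp
qed

lemma (in bounded_bilinear) differentiable_on_prod:
  assumes "f differentiable_on A" "g differentiable_on A"
  shows "(\<lambda>x. prod (f x) (g x)) differentiable_on A"
  using assms unfolding differentiable_on_def differentiable_def by (blast intro: FDERIV)

lemma (in bounded_bilinear) differentiable_upto_prod:
  "differentiable_upto k f \<Longrightarrow> differentiable_upto k g \<Longrightarrow> differentiable_upto k (\<lambda>x. prod (f x) (g x))"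
proof (induction k arbitrary: f g)
  case 0 then show ?case by (simp add: differentiable_on_prod)
next
  case (Suc k)
  then have "differentiable_upto k f" "differentiable_upto k g"
    by (blast dest: differentiable_upto_Suc)+
  with Suc show ?case
    by (auto simp: differentiable_on_prod partial_prod intro!: differentiable_upto_add)
qed

lemma (in bounded_bilinear) smooth_prod:
  "smooth f \<Longrightarrow> smooth g \<Longrightarrow> smooth (\<lambda>x. prod (f x) (g x))"
  by (simp add: smooth_iff differentiable_upto_prod)

lemmas smooth_mult = bounded_bilinear.smooth_prod[OF bounded_bilinear_mult]

lemma (in bounded_linear) partial_linear:
  assumes "g differentiable_on UNIV"
  shows "partial i (\<lambda>x. f (g x)) = (\<lambda>x. f (partial i g x))"
  by (rule ext, rule partial_eqI, rule has_vector_derivative, rule has_vector_derivative_partial_0, rule assms)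

lemma (in bounded_linear) differentiable_on_linear:
  "g differentiable_on A \<Longrightarrow> (\<lambda>x. f (g x)) differentiable_on A"
  unfolding differentiable_on_def differentiable_def by (blast intro: has_derivative)

lemma (in bounded_linear) smooth_linear: "smooth g \<Longrightarrow> smooth (\<lambda>x. f (g x))"
proof -
  have "differentiable_upto k g \<Longrightarrow> differentiable_upto k (\<lambda>x. f (g x))" for k
    by (induction k arbitrary: g) (auto simp: differentiable_on_linear partial_linear)
  then show "smooth g \<Longrightarrow> smooth (\<lambda>x. f (g x))" by (simp add: smooth_iff)
qed

lemma (in bounded_linear) partials_linear:
  "smooth g \<Longrightarrow> foldr partial xs (\<lambda>x. f (g x)) = (\<lambda>x. f (foldr partial xs g x))"
  by (induction xs) (simp_all add: partial_linear smooth_differentiable smooth_partials)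

lemma partial_const: "partial i (\<lambda>x :: real ^ 'n::finite. c) = (\<lambda>x. 0)"
  by (rule ext, rule partial_eqI) simp

lemma smooth_const: "smooth (\<lambda>x :: real ^ 'n::finite. c)"
proof -
  have "differentiable_upto k (\<lambda>x :: real ^ 'n. c)" for k
    by (induction k arbitrary: c) (simp_all add: partial_const)
  then show ?thesis by (simp add: smooth_iff)
qed

lemma smooth_sum:
  "finite A \<Longrightarrow> (\<And>j. j \<in> A \<Longrightarrow> smooth (f j)) \<Longrightarrow> smooth (\<lambda>x. \<Sum>j\<in>A. f j x)"
  by (induction A rule: finite_induct) (auto simp: smooth_const intro: smooth_add)

lemma partial_coord: "partial i (\<lambda>x :: real ^ 'n::finite. x $ j) = (\<lambda>x. if i = j then 1 else 0)"
proof (rule ext, rule partial_eqI)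
  fix x :: "real ^ 'n"
  have "((\<lambda>h. x $ j + h * axis i 1 $ j) has_vector_derivative axis i 1 $ j) (at 0)"
    by (auto intro!: derivative_eq_intros)
  then show "((\<lambda>h. (x + h *\<^sub>R axis i 1) $ j) has_vector_derivative (if i = j then 1 else 0)) (at 0)"
    by (auto simp: axis_def)
qed

lemma smooth_coord: "smooth (\<lambda>x :: real ^ 'n::finite. x $ j)"
proof -
  have "(\<lambda>x :: real ^ 'n. x $ j) differentiable_on UNIV"
    by (rule bounded_linear.differentiable_on_linear[OF bounded_linear_vec_nth]) simp
  moreover have "differentiable_upto k (\<lambda>x :: real ^ 'n. c :: real)" for k c
    by (rule smooth_const[unfolded smooth_iff, rule_format])
  ultimately have "differentiable_upto k (\<lambda>x :: real ^ 'n. x $ j)" for k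
    by (cases k) (simp_all add: partial_coord)
  then show ?thesis by (simp add: smooth_iff)
qed

lemma partial_shift: "partial i (\<lambda>x. f (x - y)) = (\<lambda>x. partial i f (x - y))"
  unfolding partial_def by (simp add: algebra_simps)

lemma differentiable_on_shift: 
  fixes f :: "real ^ 'n::finite \<Rightarrow> 'b::real_normed_vector"
  assumes "f differentiable_on UNIV" shows "(\<lambda>x. f (x - y)) differentiable_on UNIV"
  unfolding differentiable_on_def
proof
  fix x
  have "f differentiable at (x - y)" using assms by (simp add: differentiable_on_def)
  then obtain D where D: "(f has_derivative D) (at (x - y))" by (auto simp: differentiable_def)
  have "((\<lambda>x. x - y) has_derivative (\<lambda>h. h)) (at x)" by (auto intro!: derivative_eq_intros)
  from has_derivative_compose[OF this D] have "((\<lambda>x. f (x - y)) has_derivative D) (at x)" .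
  then show "(\<lambda>x. f (x - y)) differentiable at x within UNIV" by (auto simp: differentiable_def)
qed

lemma smooth_shift: 
  fixes f :: "real ^ 'n::finite \<Rightarrow> 'b::real_normed_vector"
  assumes "smooth f" shows "smooth (\<lambda>x. f (x - y))"
proof -
  have "differentiable_upto k f \<Longrightarrow> differentiable_upto k (\<lambda>x. f (x - y))" for k
    by (induction k arbitrary: f) (auto simp: differentiable_on_shift partial_shift)
  with assms show ?thesis by (simp add: smooth_iff)
qed

text \<open>\<open>\<partial>\<^sub>i f(x + k e\<^sub>j) - \<partial>\<^sub>i f(x)\<close> is the derivative in \<open>h\<close> at \<open>0\<close> of
  \<open>\<integral>\<^sub>0\<^sup>k \<partial>\<^sub>j f(x + h e\<^sub>i + \<tau> e\<^sub>j) d\<tau>\<close>. Differentiating under the integral sign and then in \<open>k\<close>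
  interchanges the two derivatives.\<close>

lemma partial_commute:
  fixes f :: "real ^ 'n::finite \<Rightarrow> 'b::banach"
  assumes f: "smooth f"
  shows "partial i (partial j f) = partial j (partial i f)"
proof (rule ext)
  fix x :: "real ^ 'n"
  note d = smooth_differentiable[OF f] smooth_differentiable[OF smooth_partial[OF f]]
  have c: "continuous_on A (partial i (partial j f))" for A by (intro smooth_continuous smooth_partial f)
  have c1: "continuous_on A (partial j f)" for A by (intro smooth_continuous smooth_partial f)
  let ?G = "\<lambda>\<tau>. partial i (partial j f) (x + \<tau> *\<^sub>R axis j 1)"
  let ?F = "\<lambda>h \<tau>. partial j f (x + h *\<^sub>R axis i 1 + \<tau> *\<^sub>R axis j 1)"
  have eq: "integral (cbox 0 k) (?F h) =
      f (x + h *\<^sub>R axis i 1 + k *\<^sub>R axis j 1) - f (x + h *\<^sub>R axis i 1)" if "k \<ge> 0" for h k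
  proof -
    have "(?F h has_integral f (x + h *\<^sub>R axis i 1 + k *\<^sub>R axis j 1) - f (x + h *\<^sub>R axis i 1 + 0 *\<^sub>R axis j 1)) {0..k}"
      by (rule fundamental_theorem_of_calculus[OF that])
         (auto intro: has_vector_derivative_at_within has_vector_derivative_partial d)
    then show ?thesis by (simp add: integral_unique)
  qed
  have inner: "integral {0..k} ?G = partial i f (x + k *\<^sub>R axis j 1) - partial i f x" if "k \<ge> 0" for k
  proof -
    have "((\<lambda>h. integral (cbox 0 k) (?F h)) has_vector_derivative
        integral (cbox 0 k) (\<lambda>\<tau>. partial i (partial j f) (x + 0 *\<^sub>R axis i 1 + \<tau> *\<^sub>R axis j 1))) (at 0 within UNIV)"
    proof (rule leibniz_rule_vector_derivative)
      fix h t
      show "((\<lambda>h. ?F h t) has_vector_derivative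
          partial i (partial j f) (x + h *\<^sub>R axis i 1 + t *\<^sub>R axis j 1)) (at h within UNIV)"
        using has_vector_derivative_partial[OF d(2)[of j], of "x + t *\<^sub>R axis j 1" i h]
        by (simp add: algebra_simps)
      show "?F h integrable_on cbox 0 k"
        by (intro integrable_continuous continuous_on_compose2[OF c1[of UNIV]] continuous_intros) auto
      show "continuous_on (UNIV \<times> cbox 0 k)
          (\<lambda>(h, t). partial i (partial j f) (x + h *\<^sub>R axis i 1 + t *\<^sub>R axis j 1))"
        unfolding split_def by (intro continuous_on_compose2[OF c[of UNIV]] continuous_intros) auto
    qed auto
    then have 1: "((\<lambda>h. f (x + h *\<^sub>R axis i 1 + k *\<^sub>R axis j 1) - f (x + h *\<^sub>R axis i 1))
        has_vector_derivative integral {0..k} ?G) (at 0)"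
      by (simp add: eq[OF that, unfolded cbox_interval])
    have 2: "((\<lambda>h. f (x + h *\<^sub>R axis i 1 + k *\<^sub>R axis j 1) - f (x + h *\<^sub>R axis i 1))
        has_vector_derivative partial i f (x + k *\<^sub>R axis j 1) - partial i f x) (at 0)"
      using has_vector_derivative_diff[OF has_vector_derivative_partial_0[OF d(1), of "x + k *\<^sub>R axis j 1" i]
        has_vector_derivative_partial_0[OF d(1), of x i]]
      by (simp add: algebra_simps)
    show ?thesis using vector_derivative_unique_at[OF 1 2] .
  qed
  have "continuous_on {0..1} ?G"
    by (intro continuous_on_compose2[OF c[of UNIV]] continuous_intros) auto
  then have "((\<lambda>k. integral {0..k} ?G) has_vector_derivative ?G 0) (at 0 within {0..1})"
    by (rule integral_has_vector_derivative) simp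
  then have "((\<lambda>k. partial i f (x + k *\<^sub>R axis j 1) - partial i f x) has_vector_derivative ?G 0) (at 0 within {0..1})"
    by (rule has_vector_derivative_transform[rotated 2]) (auto simp: inner)
  moreover have "((\<lambda>k. partial i f (x + k *\<^sub>R axis j 1) - partial i f x) has_vector_derivative
      partial j (partial i f) x) (at 0 within {0..1})"
    using has_vector_derivative_diff[OF has_vector_derivative_at_within[OF
        has_vector_derivative_partial_0[OF d(2)[of i], of x j]] has_vector_derivative_const]
    by simp
  ultimately have "?G 0 = partial j (partial i f) x"
    by (rule vector_derivative_unique_within[rotated]) (simp add: trivial_limit_within islimpt_Icc)
  then show "partial i (partial j f) x = partial j (partial i f) x" by simp
qed

lemma partials_partial_commute:
  fixes f :: "real ^ 'n::finite \<Rightarrow> 'b::banach"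
  assumes "smooth f"
  shows "foldr partial xs (partial i f) = partial i (foldr partial xs f)"
  by (induction xs) (simp_all add: partial_commute[OF smooth_partials[OF assms], symmetric])

lemma partials_perm:
  fixes f :: "real ^ 'n::finite \<Rightarrow> 'b::banach"
  assumes "smooth f" "mset xs = mset ys"
  shows "foldr partial xs f = foldr partial ys f"
  using assms(2)
proof (induction xs arbitrary: ys)
  case (Cons a xs)
  then obtain us vs where ys: "ys = us @ a # vs"
    by (metis list.set_intros(1) mset_eq_setD split_list)
  have "foldr partial xs f = foldr partial (us @ vs) f"
    using Cons.prems by (intro Cons.IH) (simp add: ys)
  moreover have "foldr partial us (partial a (foldr partial vs f)) = partial a (foldr partial us (foldr partial vs f))"
    by (intro partials_partial_commute smooth_partials assms)
  ultimately show ?case by (simp add: ys)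
qed simp

text \<open>A weak derivative pairs a real test function with a complex function, so the same list of
  directions has to serve two target types. The order of the list comes from the choice made in
  \<open>multi_partial\<close>; only the multiplicities are known.\<close>

lemma multi_partial_list:
  fixes s :: "nat ^ 'n::finite"
  obtains xs :: "'n list" where
    "\<And>f :: real ^ 'n \<Rightarrow> 'b::real_normed_vector. multi_partial s f = foldr partial xs f"
    "\<And>f :: real ^ 'n \<Rightarrow> 'c::real_normed_vector. multi_partial s f = foldr partial xs f"
    "\<And>i. count (mset xs) i = s $ i" "length xs = order_of s"
proof -
  define is0 :: "'n list" where "is0 = (SOME xs. distinct xs \<and> set xs = UNIV)"
  have "distinct is0 \<and> set is0 = UNIV"
    unfolding is0_def by (rule someI_ex) (metis finite_distinct_list finite_code)
  then have is0: "distinct is0" "set is0 = UNIV" by auto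
  have *: "foldr (\<lambda>i. partial i ^^ (s $ i)) js f = foldr partial (concat (map (\<lambda>i. replicate (s $ i) i) js)) f"
    for js :: "'n list" and f :: "real ^ 'n \<Rightarrow> 'd::real_normed_vector"
  proof (induction js)
    case (Cons a js)
    have "foldr partial (replicate n a) g = (partial a ^^ n) g" for n and g :: "real ^ 'n \<Rightarrow> 'd"
      by (induction n) auto
    with Cons show ?case by simp
  qed simp
  have cnt: "count (mset (concat (map (\<lambda>i. replicate (s $ i) i) js))) i = (if i \<in> set js then s $ i else 0)"
    if "distinct js" for js i
    using that by (induction js) auto
  have len: "length (concat (map (\<lambda>i. replicate (s $ i) i) js)) = (\<Sum>i\<in>set js. s $ i)"
    if "distinct js" for js
    using that by (induction js) auto
  show thesis
    by (rule that[of "concat (map (\<lambda>i. replicate (s $ i) i) is0)"])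
       (auto simp: multi_partial_def is0_def[symmetric] * cnt len is0 order_of_def)
qed

lemma partials_eq_multi_partial:
  fixes f :: "real ^ 'n::finite \<Rightarrow> 'b::banach"
  assumes "smooth f"
  shows "foldr partial xs f = multi_partial (\<chi> i. count (mset xs) i) f"
    and "order_of (\<chi> i. count (mset xs) i) = length xs"
proof -
  obtain ys :: "'n list" where ys: "\<And>f :: real ^ 'n \<Rightarrow> 'b. multi_partial (\<chi> i. count (mset xs) i) f = foldr partial ys f"
    "\<And>i. count (mset ys) i = (\<chi> i. count (mset xs) i) $ i"
    "length ys = order_of (\<chi> i. count (mset xs) i)"
    by (rule multi_partial_list[where 'b = 'b and 'c = 'b, of "\<chi> i. count (mset xs) i"]) blast
  have "mset ys = mset xs" using ys(2) by (intro multiset_eqI) simp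
  then show "foldr partial xs f = multi_partial (\<chi> i. count (mset xs) i) f"
    and "order_of (\<chi> i. count (mset xs) i) = length xs"
    using partials_perm[OF assms, of xs ys] ys(1,3) by (auto dest: mset_eq_length)
qed

section \<open>Smooth cutoffs\<close>

text \<open>The derivatives of \<open>exp (-1/s)\<close>, extended by \<open>0\<close> to \<open>s \<le> 0\<close>, are linear combinations of these
  functions.\<close>

definition hump :: "nat \<Rightarrow> real \<Rightarrow> real" where
  "hump k s = (if s > 0 then exp (- 1 / s) / s ^ k else 0)"

lemma hump_tendsto_0: "(hump k \<longlongrightarrow> 0) (at 0)"
proof -
  have "((\<lambda>s. inverse s ^ k / exp (inverse s)) \<longlongrightarrow> (0::real)) (at_right 0)"
    by (rule filterlim_compose[OF tendsto_power_div_exp_0 filterlim_inverse_at_top_right])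
  moreover have "\<forall>\<^sub>F s in at_right 0. inverse s ^ k / exp (inverse s) = hump k s"
    unfolding eventually_at_right_field
    by (rule exI[of _ 1]) (auto simp: hump_def exp_minus field_simps)
  ultimately have "(hump k \<longlongrightarrow> 0) (at_right 0)" by (rule Lim_transform_eventually)
  moreover have "(hump k \<longlongrightarrow> 0) (at_left 0)"
    by (rule Lim_transform_eventually[OF tendsto_const])
       (auto simp: eventually_at_left_field hump_def intro!: exI[of _ "-1"])
  ultimately show ?thesis by (simp add: filterlim_split_at)
qed

lemma DERIV_hump: "(hump k has_real_derivative hump (k + 2) s - real k * hump (k + 1) s) (at s)"
proof -
  consider "s < 0" | "s > 0" | "s = 0" by linarith
  then show ?thesis
  proof cases
    case 1
    have "(hump k has_real_derivative 0) (at s)"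
      by (rule has_field_derivative_transform_within_open[of "\<lambda>_. 0" _ _ "{..<0}"])
         (use 1 in \<open>auto simp: hump_def\<close>)
    with 1 show ?thesis by (simp add: hump_def)
  next
    case 2
    have "((\<lambda>s. exp (- 1 / s) / s ^ k) has_real_derivative
        (exp (- 1 / s) * (1 / s\<^sup>2) * s ^ k - exp (- 1 / s) * (real k * s ^ (k - 1))) / (s ^ k * s ^ k)) (at s)"
      using 2 by (auto intro!: derivative_eq_intros simp: power2_eq_square)
    moreover have "(exp (- 1 / s) * (1 / s\<^sup>2) * s ^ k - exp (- 1 / s) * (real k * s ^ (k - 1))) / (s ^ k * s ^ k)
        = hump (k + 2) s - real k * hump (k + 1) s"
      using 2 by (cases k) (auto simp: hump_def field_simps power2_eq_square)
    ultimately have "((\<lambda>s. exp (- 1 / s) / s ^ k) has_real_derivative hump (k + 2) s - real k * hump (k + 1) s) (at s)"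
      by simp
    then show ?thesis
      by (rule has_field_derivative_transform_within_open[of _ _ _ "{0<..}"])
         (use 2 in \<open>auto simp: hump_def\<close>)
  next
    case 3
    \<comment> \<open>the difference quotient at the origin is again a hump\<close>
    have "(\<lambda>h. (hump k (0 + h) - hump k 0) / h) = hump (k + 1)"
      by (auto simp: hump_def fun_eq_iff field_simps)
    then have "(hump k has_real_derivative 0) (at 0)"
      unfolding DERIV_def using hump_tendsto_0[of "k + 1"] by simp
    with 3 show ?thesis by (simp add: hump_def)
  qed
qed

text \<open>A bump supported in the ball of radius \<open>1 / \<surd>c\<close> and normalised to \<open>1\<close> at the origin. It tends to
  \<open>1\<close> everywhere as \<open>c \<rightarrow> 0\<close>, which is what a plateau would be used for.\<close>

definition cutoff :: "real \<Rightarrow> real ^ 'n::finite \<Rightarrow> real" where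
  "cutoff c x = exp 1 * hump 0 (1 - c * (x \<bullet> x))"

lemma smooth_hump_comp: "smooth (\<lambda>x :: real ^ 'n::finite. hump k (1 - c * (x \<bullet> x)))"
proof -
  let ?b = "\<lambda>k (x :: real ^ 'n). hump k (1 - c * (x \<bullet> x))"
  have diff: "?b k differentiable_on UNIV" for k
    unfolding differentiable_on_def
  proof
    fix x :: "real ^ 'n"
    have "((\<lambda>x :: real ^ 'n. 1 - c * (x \<bullet> x)) has_derivative (\<lambda>h. - c * (2 * (x \<bullet> h)))) (at x)"
      by (auto intro!: derivative_eq_intros simp: inner_commute)
    from has_derivative_compose[OF this DERIV_hump[unfolded has_field_derivative_def]]
    show "?b k differentiable at x within UNIV"
      unfolding differentiable_def by blast
  qed
  have part: "partial i (?b k) = (\<lambda>x. (- 2 * c) * (x $ i * (?b (k + 2) x + (- real k) * ?b (k + 1) x)))" for i k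
  proof (rule ext, rule partial_eqI)
    fix x :: "real ^ 'n"
    have "((\<lambda>h. 1 - c * ((x + h *\<^sub>R axis i 1) \<bullet> (x + h *\<^sub>R axis i 1))) has_real_derivative (- 2 * c * x $ i)) (at 0)"
      by (auto intro!: derivative_eq_intros simp: inner_axis inner_commute[of "axis i 1"] algebra_simps
          simp flip: has_real_derivative_iff_has_vector_derivative)
    from DERIV_chain2[OF DERIV_hump this]
    have "((\<lambda>h. ?b k (x + h *\<^sub>R axis i 1)) has_real_derivative
       (hump (k + 2) (1 - c * ((x + 0 *\<^sub>R axis i 1) \<bullet> (x + 0 *\<^sub>R axis i 1))) -
        real k * hump (k + 1) (1 - c * ((x + 0 *\<^sub>R axis i 1) \<bullet> (x + 0 *\<^sub>R axis i 1)))) * (- 2 * c * x $ i)) (at 0)" .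
    then show "((\<lambda>h. ?b k (x + h *\<^sub>R axis i 1)) has_vector_derivative
        (- 2 * c) * (x $ i * (?b (k + 2) x + (- real k) * ?b (k + 1) x))) (at 0)"
      by (simp add: has_real_derivative_iff_has_vector_derivative[symmetric] algebra_simps)
  qed
  have const: "differentiable_upto m (\<lambda>x :: real ^ 'n. a :: real)" for m a
    by (rule smooth_const[unfolded smooth_iff, rule_format])
  have coord: "differentiable_upto m (\<lambda>x :: real ^ 'n. x $ i)" for m i
    by (rule smooth_coord[unfolded smooth_iff, rule_format])
  note mult = bounded_bilinear.differentiable_upto_prod[OF bounded_bilinear_mult]
  have "differentiable_upto m (?b k)" for m
  proof (induction m arbitrary: k)
    case 0 show ?case by (simp add: diff)
  next
    case (Suc m)
    then show ?case
      unfolding differentiable_upto.simps part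
      by (intro conjI diff allI mult const coord differentiable_upto_add)
  qed
  then show ?thesis by (simp add: smooth_iff)
qed

lemma smooth_cutoff: "smooth (cutoff c)"
  unfolding cutoff_def[abs_def] by (intro smooth_mult smooth_const smooth_hump_comp)

lemma cutoff_nonneg: "0 \<le> cutoff c x"
  by (simp add: cutoff_def hump_def)

lemma cutoff_le_1:
  assumes "c \<ge> 0" shows "cutoff c x \<le> 1"
proof (cases "1 - c * (x \<bullet> x) > 0")
  case True
  with assms have "1 / (1 - c * (x \<bullet> x)) \<ge> 1" by simp
  then have "exp (- (1 / (1 - c * (x \<bullet> x)))) \<le> exp (-1)" by (simp only: exp_le_cancel_iff neg_le_iff_le)
  then have "exp 1 * exp (- (1 / (1 - c * (x \<bullet> x)))) \<le> exp 1 * exp (-1 :: real)" by simp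
  also have "\<dots> = 1" by (simp flip: exp_add)
  finally show ?thesis using True by (simp add: cutoff_def hump_def)
qed (simp add: cutoff_def hump_def)

lemma bounded_cutoff_support:
  assumes "c > 0" shows "bounded {x :: real ^ 'n::finite. cutoff c x \<noteq> 0}"
proof (rule boundedI)
  fix x :: "real ^ 'n" assume "x \<in> {x. cutoff c x \<noteq> 0}"
  then have "c * (norm x)\<^sup>2 < 1"
    by (auto simp: cutoff_def hump_def power2_norm_eq_inner split: if_splits)
  then have "(norm x)\<^sup>2 \<le> (sqrt (1 / c))\<^sup>2" using assms by (simp add: field_simps)
  then show "norm x \<le> sqrt (1 / c)" by (rule power2_le_imp_le) (use assms in simp)
qed

lemma cutoff_tendsto_1: "(\<lambda>n. cutoff (1 / real (Suc n)) x) \<longlonglongrightarrow> 1"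
proof -
  have "isCont (hump 0) 1" using DERIV_hump[of 0 1] by (rule DERIV_isCont)
  moreover have "(\<lambda>n. 1 - 1 / real (Suc n) * (x \<bullet> x)) \<longlonglongrightarrow> 1 - 0 * (x \<bullet> x)"
    by (intro tendsto_intros LIMSEQ_Suc[OF lim_1_over_n])
  ultimately have "(\<lambda>n. hump 0 (1 - 1 / real (Suc n) * (x \<bullet> x))) \<longlonglongrightarrow> hump 0 1"
    using isCont_tendsto_compose by fastforce
  then have "(\<lambda>n. exp 1 * hump 0 (1 - 1 / real (Suc n) * (x \<bullet> x))) \<longlonglongrightarrow> exp 1 * hump 0 1"
    by (intro tendsto_intros)
  then show ?thesis by (simp add: cutoff_def hump_def flip: exp_add)
qed

section \<open>Integration by parts\<close>

lemma
  fixes f :: "'a::euclidean_space \<Rightarrow> 'b::{banach, second_countable_topology}"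
  assumes "f \<in> borel_measurable borel"
  shows integral_lborel_shift: "(LINT x|lborel. f (x + c)) = (LINT x|lborel. f x)"
    and integrable_lborel_shift: "integrable lborel (\<lambda>x. f (x + c)) \<longleftrightarrow> integrable lborel f"
proof -
  have "(LINT x|distr lborel borel ((+) c). f x) = (LINT x|lborel. f (c + x))"
    by (rule integral_distr) (use assms in auto)
  then show "(LINT x|lborel. f (x + c)) = (LINT x|lborel. f x)"
    by (simp add: lborel_distr_plus add.commute)
  have "integrable (distr lborel borel ((+) c)) f \<longleftrightarrow> integrable lborel (\<lambda>x. f (c + x))"
    by (rule integrable_distr_eq) (use assms in auto)
  then show "integrable lborel (\<lambda>x. f (x + c)) \<longleftrightarrow> integrable lborel f"
    by (simp add: lborel_distr_plus add.commute)
qed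

text \<open>Translation invariance gives \<open>0 = \<integral> F(x + e) - F(x) dx = \<integral> \<integral>\<^sub>0\<^sup>1 G(x + \<tau>e) d\<tau> dx = \<integral> G\<close>.\<close>

lemma integral_directional_derivative_eq_0:
  fixes F G :: "'a::euclidean_space \<Rightarrow> 'b::euclidean_space"
  assumes der: "\<And>x. ((\<lambda>h. F (x + h *\<^sub>R e)) has_vector_derivative G x) (at 0)"
    and cont: "continuous_on UNIV G"
    and F: "integrable lborel F" and G: "integrable lborel G"
  shows "(LINT x|lborel. G x) = 0"
proof -
  have [measurable]: "F \<in> borel_measurable borel" "G \<in> borel_measurable borel"
    using F G by (auto dest: borel_measurable_integrable)
  have der': "((\<lambda>h. F (x + h *\<^sub>R e)) has_vector_derivative G (x + t *\<^sub>R e)) (at t)" for x t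
  proof -
    have "((\<lambda>h. h - t) has_vector_derivative 1) (at t)" by (auto intro!: derivative_eq_intros)
    from vector_diff_chain_at[OF this, of "\<lambda>h. F (x + t *\<^sub>R e + h *\<^sub>R e)"] der[of "x + t *\<^sub>R e"]
    show ?thesis by (simp add: o_def algebra_simps)
  qed
  have ftc: "(LINT \<tau>|lborel. indicator {0..1} \<tau> *\<^sub>R G (x + \<tau> *\<^sub>R e)) = F (x + e) - F x" for x
  proof -
    have "(LINT \<tau>|lborel. indicator {0..1} \<tau> *\<^sub>R G (x + \<tau> *\<^sub>R e)) = F (x + 1 *\<^sub>R e) - F (x + 0 *\<^sub>R e)"
      by (rule integral_FTC_Icc)
         (auto intro!: has_vector_derivative_at_within der' continuous_on_compose2[OF cont] continuous_intros)
    then show ?thesis by simp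
  qed
  define H where "H = (\<lambda>(\<tau> :: real, x). indicator {0..1} \<tau> *\<^sub>R G (x + \<tau> *\<^sub>R e))"
  have "H \<in> borel_measurable (borel \<Otimes>\<^sub>M borel)"
    unfolding H_def by measurable
  then have meas: "H \<in> borel_measurable (lborel \<Otimes>\<^sub>M lborel)" by (simp cong: measurable_cong_sets)
  have int: "integrable (lborel \<Otimes>\<^sub>M lborel) H"
  proof (rule lborel_pair.Fubini_integrable[OF meas])
    have "(LINT x|lborel. norm (H (\<tau>, x))) = indicator {0..1} \<tau> *\<^sub>R (LINT x|lborel. norm (G x))" for \<tau>
      using integral_lborel_shift[of "\<lambda>x. norm (G x)" "\<tau> *\<^sub>R e"] by (simp add: H_def)
    then show "integrable lborel (\<lambda>\<tau>. LINT x|lborel. norm (H (\<tau>, x)))"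
      by (simp add: borel_integrable_compact)
    show "AE \<tau> in lborel. integrable lborel (\<lambda>x. H (\<tau>, x))"
      using G by (auto simp: H_def integrable_lborel_shift)
  qed
  have "(LINT \<tau>|lborel. LINT x|lborel. H (\<tau>, x)) = (LINT \<tau>|lborel. indicator {0..1 :: real} \<tau> *\<^sub>R (LINT x|lborel. G x))"
    by (simp add: H_def integral_lborel_shift)
  also have "\<dots> = (LINT \<tau>|lborel. indicat_real {0..1 :: real} \<tau>) *\<^sub>R (LINT x|lborel. G x)"
    by (rule Bochner_Integration.integral_scaleR_left) simp
  also have "\<dots> = (LINT x|lborel. G x)" by simp
  finally have "(LINT x|lborel. G x) = (LINT \<tau>|lborel. LINT x|lborel. H (\<tau>, x))" ..
  also have "\<dots> = (LINT x|lborel. LINT \<tau>|lborel. H (\<tau>, x))"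
    using lborel_pair.Fubini_integral[of "\<lambda>\<tau> x. H (\<tau>, x)"] int by simp
  also have "\<dots> = (LINT x|lborel. F (x + e) - F x)" by (simp add: H_def ftc)
  also have "\<dots> = 0"
    using F by (simp add: integral_lborel_shift integrable_lborel_shift)
  finally show ?thesis .
qed

lemma integrable_compact_support:
  fixes f :: "'a::euclidean_space \<Rightarrow> 'b::{banach, second_countable_topology}"
  assumes "continuous_on UNIV f" "compact K" "\<And>x. x \<notin> K \<Longrightarrow> f x = 0"
  shows "integrable lborel f"
proof -
  have "integrable lborel (\<lambda>x. indicator K x *\<^sub>R f x)"
    using assms by (intro borel_integrable_compact) (auto intro: continuous_on_subset)
  moreover have "(\<lambda>x. indicator K x *\<^sub>R f x) = f"
    using assms(3) by (auto simp: indicator_def fun_eq_iff)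
  ultimately show ?thesis by simp
qed

lemma test_function_partial:
  assumes "test_function \<phi>" shows "test_function (partial i \<phi>)"
proof -
  let ?K = "closure {x. \<phi> x \<noteq> 0}"
  have "partial i \<phi> x = 0" if "x \<notin> ?K" for x
  proof (rule partial_eqI)
    have "open ((\<lambda>h :: real. x + h *\<^sub>R axis i 1) -` (- ?K))"
      by (intro open_vimage continuous_intros) auto
    then show "((\<lambda>h. \<phi> (x + h *\<^sub>R axis i 1)) has_vector_derivative 0) (at 0)"
      by (rule has_vector_derivative_transform_within_open[of "\<lambda>_. 0", rotated])
         (use that closure_subset in \<open>force+\<close>)
  qed
  then have "{x. partial i \<phi> x \<noteq> 0} \<subseteq> ?K" by blast
  with assms show ?thesis
    using bounded_subset[OF bounded_closure] by (auto simp: test_function_def smooth_partial)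
qed

lemma test_function_partials: "test_function \<phi> \<Longrightarrow> test_function (foldr partial xs \<phi>)"
  by (induction xs) (auto intro: test_function_partial)

lemma test_function_mult:
  assumes "test_function \<phi>" "smooth f" shows "test_function (\<lambda>x. \<phi> x * f x)"
proof -
  have "{x. \<phi> x * f x \<noteq> 0} \<subseteq> {x. \<phi> x \<noteq> 0}" by auto
  with assms show ?thesis
    using bounded_subset by (auto simp: test_function_def smooth_mult)
qed

lemma test_function_cutoff: "c > 0 \<Longrightarrow> test_function (cutoff c)"
  by (simp add: test_function_def smooth_cutoff compact_closure bounded_cutoff_support)

lemma integrable_test_function:
  fixes f :: "real ^ 'n::finite \<Rightarrow> 'b::{banach, second_countable_topology}"
  assumes "test_function \<phi>" "continuous_on UNIV f"
  shows "integrable lborel (\<lambda>x. \<phi> x *\<^sub>R f x)"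
proof (rule integrable_compact_support)
  show "continuous_on UNIV (\<lambda>x. \<phi> x *\<^sub>R f x)"
    using assms by (intro continuous_on_scaleR) (auto simp: test_function_def intro: smooth_continuous)
  show "compact (closure {x. \<phi> x \<noteq> 0})" using assms by (simp add: test_function_def)
  show "\<phi> x *\<^sub>R f x = 0" if "x \<notin> closure {x. \<phi> x \<noteq> 0}" for x
    using that closure_subset[of "{x. \<phi> x \<noteq> 0}"] by auto
qed

lemma test_function_by_parts:
  fixes f :: "real ^ 'n::finite \<Rightarrow> 'b::euclidean_space"
  assumes \<phi>: "test_function \<phi>" and f: "smooth f"
  shows "(LINT x|lborel. partial i \<phi> x *\<^sub>R f x) = - (LINT x|lborel. \<phi> x *\<^sub>R partial i f x)"
proof -
  have s: "smooth \<phi>" using \<phi> by (simp add: test_function_def)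
  have int: "integrable lborel (\<lambda>x. \<phi> x *\<^sub>R f x)" "integrable lborel (\<lambda>x. \<phi> x *\<^sub>R partial i f x)"
    "integrable lborel (\<lambda>x. partial i \<phi> x *\<^sub>R f x)"
    by (intro integrable_test_function test_function_partial \<phi> smooth_continuous smooth_partial f)+
  have "(LINT x|lborel. \<phi> x *\<^sub>R partial i f x + partial i \<phi> x *\<^sub>R f x) = 0"
  proof (rule integral_directional_derivative_eq_0)
    show "((\<lambda>h. \<phi> (x + h *\<^sub>R axis i 1) *\<^sub>R f (x + h *\<^sub>R axis i 1)) has_vector_derivative
        \<phi> x *\<^sub>R partial i f x + partial i \<phi> x *\<^sub>R f x) (at 0)" for x
      using bounded_bilinear.has_vector_derivative[OF bounded_bilinear_scaleR
          has_vector_derivative_partial_0[OF smooth_differentiable[OF s]]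
          has_vector_derivative_partial_0[OF smooth_differentiable[OF f]]]
      by simp
    show "continuous_on UNIV (\<lambda>x. \<phi> x *\<^sub>R partial i f x + partial i \<phi> x *\<^sub>R f x)"
      by (intro continuous_intros smooth_continuous smooth_partial s f)
  qed (auto intro: int)
  then show ?thesis
    using int by (simp add: eq_neg_iff_add_eq_0 add.commute)
qed

lemma test_function_by_parts_iterated:
  fixes f :: "real ^ 'n::finite \<Rightarrow> 'b::euclidean_space"
  assumes \<phi>: "test_function \<phi>" and f: "smooth f"
  shows "(LINT x|lborel. foldr partial xs \<phi> x *\<^sub>R f x) =
    (-1) ^ length xs *\<^sub>R (LINT x|lborel. \<phi> x *\<^sub>R foldr partial xs f x)"
  using f
proof (induction xs arbitrary: f)
  case (Cons i xs)
  have "(LINT x|lborel. foldr partial (i # xs) \<phi> x *\<^sub>R f x) =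
      - (LINT x|lborel. foldr partial xs \<phi> x *\<^sub>R partial i f x)"
    using test_function_by_parts[OF test_function_partials[OF \<phi>] Cons.prems] by simp
  also have "\<dots> = (-1) ^ length (i # xs) *\<^sub>R (LINT x|lborel. \<phi> x *\<^sub>R foldr partial xs (partial i f) x)"
    using Cons by (simp add: smooth_partial)
  finally show ?case by (simp add: partials_partial_commute[OF Cons.prems])
qed simp

abbreviation energy :: "('a::euclidean_space \<Rightarrow> complex) \<Rightarrow> ennreal" where
  "energy f \<equiv> \<integral>\<^sup>+x. ennreal ((cmod (f x))\<^sup>2) \<partial>lborel"

text \<open>Testing against \<open>\<phi> = \<chi> Re (\<partial>\<^sup>s f)\<close> and \<open>\<phi> = \<chi> Im (\<partial>\<^sup>s f)\<close> shows
  \<open>\<integral> \<chi>|\<partial>\<^sup>s f|\<^sup>2 = \<integral> \<chi> \<partial>\<^sup>s f \<bullet> g\<close> for every cutoff \<open>\<chi>\<close>. This bounds \<open>\<integral> \<chi>|\<partial>\<^sup>s f|\<^sup>2\<close> by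
  \<open>\<integral> |g|\<^sup>2\<close> without identifying \<open>g\<close> with \<open>\<partial>\<^sup>s f\<close>.\<close>

lemma weak_derivative_bounds_classical:
  fixes f :: "real ^ 'n::finite \<Rightarrow> complex"
  assumes f: "smooth f" and g: "g \<in> L2" and weak: "has_weak_deriv s f g"
  shows "energy (multi_partial s f) \<le>
    ennreal (LINT x|lborel. (cmod (g x))\<^sup>2)"
proof -
  define F where "F = multi_partial s f"
  obtain xs :: "'n list" where xs: "\<And>h :: real ^ 'n \<Rightarrow> real. multi_partial s h = foldr partial xs h"
      "\<And>h :: real ^ 'n \<Rightarrow> complex. multi_partial s h = foldr partial xs h" "length xs = order_of s"
    by (rule multi_partial_list[where 'b = real and 'c = complex, of s]) blast
  have F: "smooth F" unfolding F_def xs by (rule smooth_partials[OF f])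
  note [measurable] = smooth_measurable[OF F] smooth_measurable[OF smooth_cutoff]
  have [measurable]: "g \<in> borel_measurable borel" and g2: "integrable lborel (\<lambda>x. (cmod (g x))\<^sup>2)"
    using g by (auto simp: L2_def)
  have test: "(LINT x|lborel. \<phi> x *\<^sub>R F x) = (LINT x|lborel. \<phi> x *\<^sub>R g x)"
    and int: "integrable lborel (\<lambda>x. \<phi> x *\<^sub>R g x)" "integrable lborel (\<lambda>x. \<phi> x *\<^sub>R F x)"
    if \<phi>: "test_function \<phi>" for \<phi>
  proof -
    have "(LINT x|lborel. multi_partial s \<phi> x *\<^sub>R f x) = (-1) ^ order_of s * (LINT x|lborel. \<phi> x *\<^sub>R g x)"
      using weak \<phi> unfolding has_weak_deriv_def by blast
    then show "(LINT x|lborel. \<phi> x *\<^sub>R F x) = (LINT x|lborel. \<phi> x *\<^sub>R g x)"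
      using test_function_by_parts_iterated[OF \<phi> f, of xs]
      by (simp add: F_def xs scaleR_conv_of_real)
    show "integrable lborel (\<lambda>x. \<phi> x *\<^sub>R F x)"
      by (rule integrable_test_function[OF \<phi> smooth_continuous[OF F]])
    have c: "continuous_on UNIV \<phi>" using \<phi> by (simp add: test_function_def smooth_continuous)
    note [measurable] = borel_measurable_continuous_onI[OF c]
    have "integrable lborel (\<lambda>x. \<phi> x * \<phi> x)"
      using integrable_test_function[OF \<phi> c] by simp
    then have "integrable lborel (\<lambda>x. \<phi> x * \<phi> x + (cmod (g x))\<^sup>2)" using g2 by auto
    then show "integrable lborel (\<lambda>x. \<phi> x *\<^sub>R g x)"
    proof (rule Bochner_Integration.integrable_bound)
      have "2 * (\<bar>\<phi> x\<bar> * cmod (g x)) \<le> \<phi> x * \<phi> x + (cmod (g x))\<^sup>2" for x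
        using sum_squares_bound[of "\<bar>\<phi> x\<bar>" "cmod (g x)"] by (simp add: power2_eq_square)
      moreover have "0 \<le> \<bar>\<phi> x\<bar> * cmod (g x)" for x by simp
      ultimately show "AE x in lborel. norm (\<phi> x *\<^sub>R g x) \<le> norm (\<phi> x * \<phi> x + (cmod (g x))\<^sup>2)"
        by (intro AE_I2) (smt (verit) norm_scaleR real_norm_def)
    qed measurable
  qed
  have bound: "(\<integral>\<^sup>+x. ennreal (cutoff c x * (cmod (F x))\<^sup>2) \<partial>lborel) \<le> ennreal (LINT x|lborel. (cmod (g x))\<^sup>2)"
    if c: "c > 0" for c
  proof -
    note tf = test_function_mult[OF test_function_cutoff[OF c] bounded_linear.smooth_linear[OF bounded_linear_Re F]]
      test_function_mult[OF test_function_cutoff[OF c] bounded_linear.smooth_linear[OF bounded_linear_Im F]]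
    have F2: "integrable lborel (\<lambda>x. cutoff c x * (cmod (F x))\<^sup>2)"
      using integrable_test_function[OF test_function_cutoff[OF c], of "\<lambda>x. (cmod (F x))\<^sup>2"]
      by (simp add: continuous_intros smooth_continuous[OF F])
    have 1: "(LINT x|lborel. cutoff c x * Re (F x) * Re (F x)) = (LINT x|lborel. cutoff c x * Re (F x) * Re (g x))"
      using arg_cong[OF test[OF tf(1)], of Re] int[OF tf(1)] by (simp flip: integral_Re)
    have 2: "(LINT x|lborel. cutoff c x * Im (F x) * Im (F x)) = (LINT x|lborel. cutoff c x * Im (F x) * Im (g x))"
      using arg_cong[OF test[OF tf(2)], of Im] int[OF tf(2)] by (simp flip: integral_Im)
    have i: "integrable lborel (\<lambda>x. cutoff c x * Re (F x) * Re (F x))"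
      "integrable lborel (\<lambda>x. cutoff c x * Re (F x) * Re (g x))"
      "integrable lborel (\<lambda>x. cutoff c x * Im (F x) * Im (F x))"
      "integrable lborel (\<lambda>x. cutoff c x * Im (F x) * Im (g x))"
      using integrable_Re[OF int(2)[OF tf(1)]] integrable_Re[OF int(1)[OF tf(1)]]
        integrable_Im[OF int(2)[OF tf(2)]] integrable_Im[OF int(1)[OF tf(2)]] by simp_all
    have "(LINT x|lborel. cutoff c x * (cmod (F x))\<^sup>2) =
        (LINT x|lborel. cutoff c x * Re (F x) * Re (F x) + cutoff c x * Im (F x) * Im (F x))"
      by (rule Bochner_Integration.integral_cong[OF refl], subst cmod_power2)
        (simp add: power2_eq_square algebra_simps)
    also have "\<dots> = (LINT x|lborel. cutoff c x * Re (F x) * Re (g x) + cutoff c x * Im (F x) * Im (g x))"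
      using i by (simp add: 1 2)
    also have "\<dots> \<le> (LINT x|lborel. (cutoff c x * (cmod (F x))\<^sup>2 + (cmod (g x))\<^sup>2) / 2)"
    proof (rule integral_mono)
      fix x
      have "2 * (Re (F x) * Re (g x) + Im (F x) * Im (g x)) \<le> (cmod (F x))\<^sup>2 + (cmod (g x))\<^sup>2"
        using sum_squares_bound[of "Re (F x)" "Re (g x)"] sum_squares_bound[of "Im (F x)" "Im (g x)"]
        by (simp add: cmod_power2)
      then have "cutoff c x * (2 * (Re (F x) * Re (g x) + Im (F x) * Im (g x))) \<le>
          cutoff c x * ((cmod (F x))\<^sup>2 + (cmod (g x))\<^sup>2)"
        by (rule mult_left_mono) (rule cutoff_nonneg)
      moreover have "cutoff c x * (cmod (g x))\<^sup>2 \<le> (cmod (g x))\<^sup>2"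
        using mult_right_mono[OF cutoff_le_1[of c x]] c by simp
      ultimately show "cutoff c x * Re (F x) * Re (g x) + cutoff c x * Im (F x) * Im (g x) \<le>
          (cutoff c x * (cmod (F x))\<^sup>2 + (cmod (g x))\<^sup>2) / 2"
        by (simp add: algebra_simps)
    qed (use i F2 g2 in auto)
    also have "\<dots> = ((LINT x|lborel. cutoff c x * (cmod (F x))\<^sup>2) + (LINT x|lborel. (cmod (g x))\<^sup>2)) / 2"
      using F2 g2 by simp
    finally have "(LINT x|lborel. cutoff c x * (cmod (F x))\<^sup>2) \<le> (LINT x|lborel. (cmod (g x))\<^sup>2)" by simp
    moreover have "(\<integral>\<^sup>+x. ennreal (cutoff c x * (cmod (F x))\<^sup>2) \<partial>lborel) =
        ennreal (LINT x|lborel. cutoff c x * (cmod (F x))\<^sup>2)"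
      by (rule nn_integral_eq_integral[OF F2]) (auto simp: cutoff_nonneg)
    ultimately show ?thesis by (simp add: ennreal_leI)
  qed
  have "energy (F) =
      (\<integral>\<^sup>+x. liminf (\<lambda>n. ennreal (cutoff (1 / real (Suc n)) x * (cmod (F x))\<^sup>2)) \<partial>lborel)"
  proof (rule nn_integral_cong)
    fix x
    have "(\<lambda>n. ennreal (cutoff (1 / real (Suc n)) x * (cmod (F x))\<^sup>2)) \<longlonglongrightarrow> ennreal (1 * (cmod (F x))\<^sup>2)"
      by (intro tendsto_intros tendsto_ennrealI cutoff_tendsto_1)
    from lim_imp_Liminf[OF _ this]
    show "ennreal ((cmod (F x))\<^sup>2) = liminf (\<lambda>n. ennreal (cutoff (1 / real (Suc n)) x * (cmod (F x))\<^sup>2))" by simp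
  qed
  also have "\<dots> \<le> liminf (\<lambda>n. \<integral>\<^sup>+x. ennreal (cutoff (1 / real (Suc n)) x * (cmod (F x))\<^sup>2) \<partial>lborel)"
    by (intro nn_integral_liminf) measurable
  also have "\<dots> \<le> liminf (\<lambda>n :: nat. ennreal (LINT x|lborel. (cmod (g x))\<^sup>2))"
    by (intro Liminf_mono always_eventually allI bound) simp
  also have "\<dots> = ennreal (LINT x|lborel. (cmod (g x))\<^sup>2)" by (simp add: Liminf_const)
  finally show ?thesis by (simp add: F_def)
qed

section \<open>A Sobolev embedding\<close>

text \<open>Apply the fundamental theorem of calculus to \<open>(1 - h)|F(x + h e\<^sub>i)|\<^sup>2\<close>, which vanishes at \<open>h = 1\<close>.\<close>

lemma line_embedding:
  fixes F :: "real ^ 'n::finite \<Rightarrow> complex"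
  assumes F: "smooth F"
  shows "ennreal ((cmod (F x))\<^sup>2) \<le> 2 * (\<integral>\<^sup>+h. indicator {0..1} h *
    (ennreal ((cmod (F (x + h *\<^sub>R axis i 1)))\<^sup>2) + ennreal ((cmod (partial i F (x + h *\<^sub>R axis i 1)))\<^sup>2)) \<partial>lborel)"
proof -
  define \<phi> where "\<phi> h = F (x + h *\<^sub>R axis i 1)" for h
  define \<psi> where "\<psi> h = partial i F (x + h *\<^sub>R axis i 1)" for h
  have d: "(\<phi> has_vector_derivative \<psi> h) (at h)" for h
    unfolding \<phi>_def \<psi>_def by (rule has_vector_derivative_partial[OF smooth_differentiable[OF F]])
  have c: "continuous_on A \<phi>" "continuous_on A \<psi>" for A
    unfolding \<phi>_def \<psi>_def
    by (auto intro!: continuous_on_compose2[OF smooth_continuous[where A = UNIV]] continuous_intros F smooth_partial)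
  have [measurable]: "\<phi> \<in> borel_measurable borel" "\<psi> \<in> borel_measurable borel"
    by (intro borel_measurable_continuous_onI c)+
  let ?d = "\<lambda>h. (1 - h) * (2 * (\<phi> h \<bullet> \<psi> h)) - \<phi> h \<bullet> \<phi> h"
  let ?b = "\<lambda>h. 2 * ((cmod (\<phi> h))\<^sup>2 + (cmod (\<psi> h))\<^sup>2)"
  have int: "integrable lborel (\<lambda>h. indicator {0..1} h *\<^sub>R ?d h)" "integrable lborel (\<lambda>h. indicator {0..1} h *\<^sub>R ?b h)"
    by (intro borel_integrable_compact continuous_intros c; simp)+
  have "(LINT h|lborel. indicator {0..1} h *\<^sub>R ?d h) = (1 - 1) * (\<phi> 1 \<bullet> \<phi> 1) - (1 - 0) * (\<phi> 0 \<bullet> \<phi> 0)"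
  proof (rule integral_FTC_Icc)
    fix h :: real
    have 1: "((\<lambda>h. \<phi> h \<bullet> \<phi> h) has_vector_derivative 2 * (\<phi> h \<bullet> \<psi> h)) (at h)"
      using bounded_bilinear.has_vector_derivative[OF bounded_bilinear_inner d d, of h]
      by (simp add: inner_commute)
    have 2: "((\<lambda>h. 1 - h) has_vector_derivative -1) (at h)" by (auto intro!: derivative_eq_intros)
    show "((\<lambda>h. (1 - h) * (\<phi> h \<bullet> \<phi> h)) has_vector_derivative ?d h) (at h within {0..1})"
      using has_vector_derivative_at_within[OF
          bounded_bilinear.has_vector_derivative[OF bounded_bilinear_mult 2 1], of "{0..1}"] by simp
  qed (auto intro!: continuous_intros c)
  then have "(cmod (F x))\<^sup>2 = (LINT h|lborel. - (indicator {0..1} h *\<^sub>R ?d h))"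
    using int by (simp add: \<phi>_def power2_norm_eq_inner)
  also have "\<dots> \<le> (LINT h|lborel. indicator {0..1} h *\<^sub>R ?b h)"
  proof (rule integral_mono)
    fix h :: real
    have "- ?d h \<le> ?b h" if "h \<in> {0..1}"
    proof -
      have "\<bar>(1 - h) * (2 * (\<phi> h \<bullet> \<psi> h))\<bar> \<le> 1 * (2 * (cmod (\<phi> h) * cmod (\<psi> h)))"
        unfolding abs_mult using that by (intro mult_mono) (auto simp: Cauchy_Schwarz_ineq2)
      from abs_le_D2[OF this]
      have "- ((1 - h) * (2 * (\<phi> h \<bullet> \<psi> h))) \<le> 2 * (cmod (\<phi> h) * cmod (\<psi> h))" by (simp only: mult_1)
      moreover have "2 * (cmod (\<phi> h) * cmod (\<psi> h)) \<le> (cmod (\<phi> h))\<^sup>2 + (cmod (\<psi> h))\<^sup>2"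
        using sum_squares_bound[of "cmod (\<phi> h)" "cmod (\<psi> h)"] by simp
      moreover have "\<phi> h \<bullet> \<phi> h = (cmod (\<phi> h))\<^sup>2" "0 \<le> (cmod (\<psi> h))\<^sup>2" "0 \<le> (cmod (\<phi> h))\<^sup>2"
        by (simp_all add: power2_norm_eq_inner)
      ultimately show ?thesis by argo
    qed
    then show "- (indicator {0..1} h *\<^sub>R ?d h) \<le> indicator {0..1} h *\<^sub>R ?b h"
      by (auto simp: indicator_def)
  qed (use int in auto)
  finally have "ennreal ((cmod (F x))\<^sup>2) \<le> ennreal (LINT h|lborel. indicator {0..1} h *\<^sub>R ?b h)" by (rule ennreal_leI)
  also have "\<dots> = (\<integral>\<^sup>+h. ennreal (indicator {0..1} h *\<^sub>R ?b h) \<partial>lborel)"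
    by (rule nn_integral_eq_integral[symmetric]) (use int in auto)
  also have "\<dots> = (\<integral>\<^sup>+h. 2 * (indicator {0..1} h * (ennreal ((cmod (\<phi> h))\<^sup>2) + ennreal ((cmod (\<psi> h))\<^sup>2))) \<partial>lborel)"
    by (rule nn_integral_cong) (auto simp: indicator_def ennreal_mult)
  also have "\<dots> = 2 * (\<integral>\<^sup>+h. indicator {0..1} h * (ennreal ((cmod (\<phi> h))\<^sup>2) + ennreal ((cmod (\<psi> h))\<^sup>2)) \<partial>lborel)"
    by (rule nn_integral_cmult) measurable
  finally show ?thesis by (simp add: \<phi>_def \<psi>_def)
qed

text \<open>The subsequences of \<open>js\<close> are the derivatives of order at most one in each of the directions
  \<open>js\<close>, which are those produced by the fundamental theorem of calculus in each direction.\<close>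

definition energy_density :: "'n list \<Rightarrow> (real ^ 'n::finite \<Rightarrow> complex) \<Rightarrow> real ^ 'n \<Rightarrow> ennreal" where
  "energy_density js F y = (\<Sum>ys\<leftarrow>subseqs js. ennreal ((cmod (foldr partial ys F y))\<^sup>2))"

lemma energy_density_Cons:
  "energy_density (i # js) F y =
    (\<Sum>ys\<leftarrow>subseqs js. ennreal ((cmod (foldr partial ys F y))\<^sup>2) + ennreal ((cmod (partial i (foldr partial ys F) y))\<^sup>2))"
  by (simp add: energy_density_def Let_def o_def sum_list_addf add.commute)

lemma energy_density_measurable [measurable]:
  assumes F: "smooth F"
  shows "energy_density js F \<in> borel_measurable borel"
proof -
  have [measurable]: "foldr partial ys F \<in> borel_measurable borel" for ys
    by (rule smooth_measurable[OF smooth_partials[OF F]])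
  have "(\<lambda>y. \<Sum>ys\<leftarrow>L. ennreal ((cmod (foldr partial ys F y))\<^sup>2)) \<in> borel_measurable borel" for L
    by (induction L) auto
  then show ?thesis unfolding energy_density_def[abs_def] .
qed

lemma energy_density_line:
  assumes F: "smooth F"
  shows "energy_density js F y \<le> 2 * (\<integral>\<^sup>+h. indicator {0..1} h * energy_density (i # js) F (y + h *\<^sub>R axis i 1) \<partial>lborel)"
proof -
  have [measurable]: "foldr partial ys F \<in> borel_measurable borel"
    "partial i (foldr partial ys F) \<in> borel_measurable borel" for ys
    by (rule smooth_measurable smooth_partial smooth_partials F)+
  let ?e = "\<lambda>ys h. ennreal ((cmod (foldr partial ys F (y + h *\<^sub>R axis i 1)))\<^sup>2) +
    ennreal ((cmod (partial i (foldr partial ys F) (y + h *\<^sub>R axis i 1)))\<^sup>2)"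
  have m: "(\<lambda>h. \<Sum>ys\<leftarrow>L. ?e ys h) \<in> borel_measurable borel" for L
    by (induction L) auto
  have "(\<Sum>ys\<leftarrow>L. ennreal ((cmod (foldr partial ys F y))\<^sup>2)) \<le> 2 * (\<integral>\<^sup>+h. indicator {0..1} h * (\<Sum>ys\<leftarrow>L. ?e ys h) \<partial>lborel)" for L
  proof (induction L)
    case (Cons ys L)
    have "(\<Sum>ys\<leftarrow>ys # L. ennreal ((cmod (foldr partial ys F y))\<^sup>2)) \<le>
        2 * (\<integral>\<^sup>+h. indicator {0..1} h * ?e ys h \<partial>lborel) + 2 * (\<integral>\<^sup>+h. indicator {0..1} h * (\<Sum>ys\<leftarrow>L. ?e ys h) \<partial>lborel)"
      using add_mono[OF line_embedding[OF smooth_partials[OF F, of ys], of y i] Cons] by simp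
    also have "\<dots> = 2 * (\<integral>\<^sup>+h. indicator {0..1} h * ?e ys h + indicator {0..1} h * (\<Sum>ys\<leftarrow>L. ?e ys h) \<partial>lborel)"
      using m[of L] by (subst nn_integral_add) (auto simp: distrib_left)
    finally show ?case by (simp add: distrib_left)
  qed simp
  then show ?thesis unfolding energy_density_Cons by (simp add: energy_density_def)
qed

text \<open>Applying the one-dimensional bound in one coordinate after the other replaces the value at a
  point by an integral over the unit box.\<close>

lemma box_embedding:
  fixes F :: "real ^ 'n::finite \<Rightarrow> complex"
  assumes F: "smooth F" and js: "distinct js"
  defines "B \<equiv> (\<lambda>j. axis j 1 :: real ^ 'n) ` set js"
  shows "ennreal ((cmod (F x))\<^sup>2) \<le> 2 ^ length js * (\<integral>\<^sup>+f. (\<Prod>b\<in>B. indicator {0..1} (f b)) *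
    energy_density js F (x + (\<Sum>b\<in>B. f b *\<^sub>R b)) \<partial>(\<Pi>\<^sub>M b\<in>B. lborel))"
  unfolding B_def using js
proof (induction js)
  case Nil
  interpret product_sigma_finite "\<lambda>b :: real ^ 'n. lborel :: real measure"
    by (simp add: product_sigma_finite_def sigma_finite_lborel)
  show ?case
    unfolding list.set image_empty
    by (subst nn_integral_empty) (simp_all add: energy_density_def)
next
  case (Cons i js)
  let ?B = "(\<lambda>j. axis j 1 :: real ^ 'n) ` set js"
  let ?e = "axis i 1 :: real ^ 'n"
  interpret product_sigma_finite "\<lambda>b :: real ^ 'n. lborel :: real measure"
    by (simp add: product_sigma_finite_def sigma_finite_lborel)
  have i: "?e \<notin> ?B" using Cons.prems by (auto simp: axis_eq_axis)
  note [measurable] = energy_density_measurable[OF F]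
  let ?H = "\<lambda>f. (\<Prod>b\<in>?B. indicator {0..1} (f b)) *
    energy_density js F (x + (\<Sum>b\<in>?B. f b *\<^sub>R b))"
  let ?K = "\<lambda>f. (\<Prod>b\<in>insert ?e ?B. indicator {0..1} (f b)) *
    energy_density (i # js) F (x + (\<Sum>b\<in>insert ?e ?B. f b *\<^sub>R b))"
  have K: "?K (f(?e := h)) = (\<Prod>b\<in>?B. indicator {0..1} (f b)) *
      (indicator {0..1} h * energy_density (i # js) F ((x + (\<Sum>b\<in>?B. f b *\<^sub>R b)) + h *\<^sub>R ?e))" for f h
  proof -
    have "(\<Prod>b\<in>?B. indicator {0..1} ((f(?e := h)) b)) = (\<Prod>b\<in>?B. indicator {0..1} (f b) :: ennreal)"
      "(\<Sum>b\<in>?B. (f(?e := h)) b *\<^sub>R b) = (\<Sum>b\<in>?B. f b *\<^sub>R b)"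
      using i by (intro prod.cong sum.cong refl, metis fun_upd_other)+
    then show ?thesis using i by (simp add: mult_ac add_ac)
  qed
  have Km: "?K \<in> borel_measurable (Pi\<^sub>M (insert ?e ?B) (\<lambda>_. lborel))"
    by measurable
  have "ennreal ((cmod (F x))\<^sup>2) \<le> 2 ^ length js * (\<integral>\<^sup>+f. ?H f \<partial>(\<Pi>\<^sub>M b\<in>?B. lborel))"
    using Cons by simp
  also have "\<dots> \<le> 2 ^ length js * (\<integral>\<^sup>+f. 2 * (\<integral>\<^sup>+h. ?K (f(?e := h)) \<partial>lborel) \<partial>(\<Pi>\<^sub>M b\<in>?B. lborel))"
  proof (intro mult_left_mono nn_integral_mono)
    fix f :: "real ^ 'n \<Rightarrow> real"
    have "?H f \<le> (\<Prod>b\<in>?B. indicator {0..1} (f b)) * (2 * (\<integral>\<^sup>+h. indicator {0..1} h *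
        energy_density (i # js) F ((x + (\<Sum>b\<in>?B. f b *\<^sub>R b)) + h *\<^sub>R ?e) \<partial>lborel))"
      by (intro mult_left_mono energy_density_line F) simp
    also have "\<dots> = 2 * (\<integral>\<^sup>+h. ?K (f(?e := h)) \<partial>lborel)"
      unfolding K by (subst nn_integral_cmult) (auto simp: mult_ac)
    finally show "?H f \<le> 2 * (\<integral>\<^sup>+h. ?K (f(?e := h)) \<partial>lborel)" .
  qed simp
  also have "\<dots> = 2 ^ length js * (2 * (\<integral>\<^sup>+f. \<integral>\<^sup>+h. ?K (f(?e := h)) \<partial>lborel \<partial>(\<Pi>\<^sub>M b\<in>?B. lborel)))"
    by (subst nn_integral_cmult) (use Km in measurable)
  also have "\<dots> = 2 ^ length js * (2 * (\<integral>\<^sup>+f. ?K f \<partial>(\<Pi>\<^sub>M b\<in>insert ?e ?B. lborel)))"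
    by (subst product_nn_integral_insert[OF _ i Km]) auto
  also have "\<dots> = 2 ^ length (i # js) * (\<integral>\<^sup>+f. ?K f \<partial>(\<Pi>\<^sub>M b\<in>insert ?e ?B. lborel))"
    by (simp add: mult_ac)
  finally show ?case by simp
qed

abbreviation local_energy :: "'n::finite list list \<Rightarrow> (real ^ 'n \<Rightarrow> complex) \<Rightarrow> real ^ 'n \<Rightarrow> ennreal" where
  "local_energy L F x \<equiv> \<integral>\<^sup>+y. indicator (cball x CARD('n)) y *
    (\<Sum>ys\<leftarrow>L. ennreal ((cmod (foldr partial ys F y))\<^sup>2)) \<partial>lborel"

text \<open>The box lies in a ball whose radius depends on the dimension only. The list \<open>L\<close> is the same for
  all \<open>F\<close> and \<open>x\<close>, so the bound is uniform over families of functions.\<close>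

theorem sobolev_embedding:
  obtains L :: "'n::finite list list" where
    "\<And>(F :: real ^ 'n \<Rightarrow> complex) x. smooth F \<Longrightarrow> ennreal ((cmod (F x))\<^sup>2) \<le>
      2 ^ CARD('n) * local_energy L F x"
proof -
  obtain js :: "'n list" where js: "distinct js" "set js = UNIV"
    by (metis finite_distinct_list finite_code)
  have len: "length js = CARD('n)" using js by (metis distinct_card)
  have B: "(\<lambda>j. axis j 1 :: real ^ 'n) ` set js = Basis"
    by (auto simp: Basis_vec_def js)
  have "ennreal ((cmod (F x))\<^sup>2) \<le> 2 ^ CARD('n) * (\<integral>\<^sup>+y. indicator (cball x CARD('n)) y *
        (\<Sum>ys\<leftarrow>subseqs js. ennreal ((cmod (foldr partial ys F y))\<^sup>2)) \<partial>lborel)" if F: "smooth F" for F and x :: "real ^ 'n"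
  proof -
    note [measurable] = energy_density_measurable[OF F]
    have m: "(\<lambda>y. indicator (cball x CARD('n)) y * energy_density js F y) \<in> borel_measurable borel"
      by (intro borel_measurable_times_ennreal borel_measurable_indicator energy_density_measurable F) auto
    have "ennreal ((cmod (F x))\<^sup>2) \<le> 2 ^ CARD('n) * (\<integral>\<^sup>+f. (\<Prod>b\<in>Basis. indicator {0..1} (f b)) *
      energy_density js F (x + (\<Sum>b\<in>Basis. f b *\<^sub>R b)) \<partial>(\<Pi>\<^sub>M b\<in>(Basis :: (real ^ 'n) set). lborel))"
      using box_embedding[OF F js(1), of x] by (simp only: B len)
    also have "\<dots> \<le> 2 ^ CARD('n) * (\<integral>\<^sup>+f. indicator (cball x CARD('n)) (x + (\<Sum>b\<in>Basis. f b *\<^sub>R b)) *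
      energy_density js F (x + (\<Sum>b\<in>Basis. f b *\<^sub>R b)) \<partial>(\<Pi>\<^sub>M b\<in>(Basis :: (real ^ 'n) set). lborel))"
    proof (intro mult_left_mono nn_integral_mono mult_right_mono)
      fix f :: "real ^ 'n \<Rightarrow> real"
      have inside: "norm (\<Sum>b\<in>Basis. f b *\<^sub>R b :: real ^ 'n) \<le> CARD('n)" if "\<forall>b\<in>Basis. f b \<in> {0..1}"
      proof -
        have "norm (\<Sum>b\<in>Basis. f b *\<^sub>R b :: real ^ 'n) \<le> (\<Sum>b\<in>(Basis :: (real ^ 'n) set). 1)"
          using that by (intro sum_norm_le) auto
        then show ?thesis by simp
      qed
      have outside: "(\<Prod>b\<in>Basis. indicator {0..1} (f b)) = (0 :: ennreal)"
        if "\<not> (\<forall>b\<in>(Basis :: (real ^ 'n) set). f b \<in> {0..1})"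
        using that by (intro prod_zero) (auto simp: indicator_def)
      show "(\<Prod>b\<in>Basis. indicator {0..1} (f b)) \<le> (indicator (cball x CARD('n)) (x + (\<Sum>b\<in>Basis. f b *\<^sub>R b)) :: ennreal)"
      proof (cases "\<forall>b\<in>(Basis :: (real ^ 'n) set). f b \<in> {0..1}")
        case True
        then show ?thesis using inside by (auto simp: dist_norm)
      next
        case False
        show ?thesis unfolding outside[OF False] by simp
      qed
    qed simp_all
    also have "\<dots> = 2 ^ CARD('n) * (\<integral>\<^sup>+y. indicator (cball x CARD('n)) (x + y) * energy_density js F (x + y) \<partial>lborel)"
      by (subst (2) lborel_def, subst nn_integral_distr)
         (auto simp: lborel_eq_real intro: measurable_compose[OF _ m])
    also have "\<dots> = 2 ^ CARD('n) * (\<integral>\<^sup>+y. indicator (cball x CARD('n)) y * energy_density js F y \<partial>distr lborel borel ((+) x))"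
      by (subst nn_integral_distr) (use m in auto)
    finally show ?thesis by (simp add: energy_density_def lborel_distr_plus)
  qed
  then show thesis by (rule that)
qed

corollary sobolev_bounded:
  fixes A :: "(real ^ 'n::finite \<Rightarrow> complex) set"
  assumes smooth: "\<And>F. F \<in> A \<Longrightarrow> smooth F"
    and bound: "\<And>xs. \<exists>C. \<forall>F\<in>A. energy (foldr partial xs F) \<le> ennreal C"
  shows "\<exists>M. \<forall>F\<in>A. \<forall>x. cmod (foldr partial xs F x) \<le> M"
proof -
  obtain L :: "'n list list" where L: "\<And>(F :: real ^ 'n \<Rightarrow> complex) x. smooth F \<Longrightarrow> ennreal ((cmod (F x))\<^sup>2) \<le>
      2 ^ CARD('n) * local_energy L F x"
    by (rule sobolev_embedding[where 'n = 'n]) blast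
  obtain C where C: "\<And>xs F. F \<in> A \<Longrightarrow> energy (foldr partial xs F) \<le> ennreal (C xs)"
    using bound by metis
  define B where "B = 2 ^ CARD('n) * (\<Sum>ys\<leftarrow>L. \<bar>C (ys @ xs)\<bar>)"
  have "cmod (foldr partial xs F x) \<le> sqrt B" if F: "F \<in> A" for F x
  proof -
    have "(\<integral>\<^sup>+y. (\<Sum>ys\<leftarrow>K. ennreal ((cmod (foldr partial (ys @ xs) F y))\<^sup>2)) \<partial>lborel) \<le> ennreal (\<Sum>ys\<leftarrow>K. \<bar>C (ys @ xs)\<bar>)" for K
    proof (induction K)
      case (Cons ys K)
      have m: "(\<lambda>y. ennreal ((cmod (foldr partial zs F y))\<^sup>2)) \<in> borel_measurable lborel" for zs
        using smooth_measurable[OF smooth_partials[OF smooth[OF F]]] by measurable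
      have "(\<lambda>y. \<Sum>ys\<leftarrow>K. ennreal ((cmod (foldr partial (ys @ xs) F y))\<^sup>2)) \<in> borel_measurable lborel"
        by (induction K) (simp, simp only: list.map sum_list.Cons, rule borel_measurable_add[OF m])
      then have "(\<integral>\<^sup>+y. (\<Sum>ys\<leftarrow>ys # K. ennreal ((cmod (foldr partial (ys @ xs) F y))\<^sup>2)) \<partial>lborel) =
        (\<integral>\<^sup>+y. ennreal ((cmod (foldr partial (ys @ xs) F y))\<^sup>2) \<partial>lborel) +
        (\<integral>\<^sup>+y. (\<Sum>ys\<leftarrow>K. ennreal ((cmod (foldr partial (ys @ xs) F y))\<^sup>2)) \<partial>lborel)"
        using m[of "ys @ xs"] by (simp add: nn_integral_add del: foldr_append)
      also have "\<dots> \<le> ennreal \<bar>C (ys @ xs)\<bar> + ennreal (\<Sum>ys\<leftarrow>K. \<bar>C (ys @ xs)\<bar>)"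
        by (intro add_mono Cons order_trans[OF C[OF F]] ennreal_leI) simp
      also have "\<dots> = ennreal (\<Sum>ys\<leftarrow>ys # K. \<bar>C (ys @ xs)\<bar>)"
        by (subst ennreal_plus[symmetric]) (auto intro!: sum_list_nonneg)
      finally show ?case .
    qed simp
    note sumK = this
    have "ennreal ((cmod (foldr partial xs F x))\<^sup>2) \<le>
      2 ^ CARD('n) * (\<integral>\<^sup>+y. indicator (cball x CARD('n)) y *
        (\<Sum>ys\<leftarrow>L. ennreal ((cmod (foldr partial ys (foldr partial xs F) y))\<^sup>2)) \<partial>lborel)"
      by (rule L[OF smooth_partials[OF smooth[OF F]]])
    also have "\<dots> \<le> 2 ^ CARD('n) * (\<integral>\<^sup>+y. (\<Sum>ys\<leftarrow>L. ennreal ((cmod (foldr partial (ys @ xs) F y))\<^sup>2)) \<partial>lborel)"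
      by (intro mult_left_mono nn_integral_mono) (auto simp: indicator_def)
    also have "\<dots> \<le> 2 ^ CARD('n) * ennreal (\<Sum>ys\<leftarrow>L. \<bar>C (ys @ xs)\<bar>)"
      by (intro mult_left_mono sumK) simp
    also have "\<dots> = ennreal (2 ^ CARD('n)) * ennreal (\<Sum>ys\<leftarrow>L. \<bar>C (ys @ xs)\<bar>)"
      by (simp flip: ennreal_power)
    also have "\<dots> = ennreal B"
      unfolding B_def by (rule ennreal_mult[symmetric]) (auto intro!: sum_list_nonneg)
    finally have "(cmod (foldr partial xs F x))\<^sup>2 \<le> B" 
      by (subst (asm) ennreal_le_iff) (auto simp: B_def intro!: sum_list_nonneg mult_nonneg_nonneg)
    then show ?thesis by (rule real_le_rsqrt)
  qed
  then show ?thesis by blast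
qed

section \<open>The weights\<close>

text \<open>A smooth substitute for the positive part of \<open>r\<close>; its derivative is \<open>logistic\<close>.\<close>

definition softplus :: "real \<Rightarrow> real" where
  "softplus r = ln (1 + exp r)"

definition logistic :: "real \<Rightarrow> real" where
  "logistic r = exp r / (1 + exp r)"

text \<open>The first factor grows like \<open>r\<^sup>a\<close> ahead of the front. The second decays exponentially behind the
  front, where the solitons are. The third makes the weight integrable on \<open>\<real>\<^sup>d\<close> when \<open>m\<close> is large;
  the decay estimates are uniform in \<open>\<epsilon>\<close>, which is fixed only in the pointwise estimate.\<close>

definition weight :: "real \<Rightarrow> nat \<Rightarrow> real \<Rightarrow> real \<Rightarrow> real" where
  "weight a m \<epsilon> r = (1 + softplus r) powr a * logistic r / (1 + \<epsilon> * softplus r) ^ m"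

definition weight_deriv :: "real \<Rightarrow> nat \<Rightarrow> real \<Rightarrow> real \<Rightarrow> real" where
  "weight_deriv a m \<epsilon> r = weight a m \<epsilon> r *
     (a * logistic r / (1 + softplus r) + 1 / (1 + exp r) - real m * \<epsilon> * logistic r / (1 + \<epsilon> * softplus r))"

lemma exp_plus_1_pos: "0 < 1 + exp (r :: real)"
  by (simp add: add_pos_pos)

lemma softplus_nonneg: "0 \<le> softplus r"
  by (simp add: softplus_def)

lemma softplus_ge: "r \<le> softplus r"
proof -
  have "exp r \<le> 1 + exp r" by simp
  then show ?thesis unfolding softplus_def by (simp add: ln_ge_iff exp_plus_1_pos)
qed

lemma softplus_le_exp: "softplus r \<le> exp r"
  unfolding softplus_def by (rule ln_add_one_self_le_self) simp

lemma softplus_Lipschitz: "softplus r \<le> softplus s + \<bar>r - s\<bar>"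
proof -
  have "exp r \<le> exp (s + \<bar>r - s\<bar>)" by simp
  then have "1 + exp r \<le> exp \<bar>r - s\<bar> + exp s * exp \<bar>r - s\<bar>"
    unfolding exp_add by (intro add_mono) auto
  then have "ln (1 + exp r) \<le> ln ((1 + exp s) * exp \<bar>r - s\<bar>)"
    by (subst ln_le_cancel_iff) (auto simp: algebra_simps exp_plus_1_pos intro!: add_pos_pos)
  also have "\<dots> = ln (1 + exp s) + \<bar>r - s\<bar>"
    using exp_plus_1_pos[of s] by (subst ln_mult) auto
  finally show ?thesis by (simp add: softplus_def)
qed

lemma logistic_pos: "0 < logistic r"
  by (simp add: logistic_def exp_plus_1_pos)

lemma logistic_le_1: "logistic r \<le> 1"
  by (simp add: logistic_def exp_plus_1_pos)

lemma logistic_le_exp: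
  assumes "0 \<le> q" "q \<le> 1" shows "logistic r \<le> exp (q * r)"
proof (cases "r \<ge> 0")
  case True
  then have "1 \<le> exp (q * r)" using assms by simp
  with logistic_le_1[of r] show ?thesis by linarith
next
  case False
  have "logistic r \<le> exp r" by (simp add: logistic_def field_simps exp_plus_1_pos)
  also have "\<dots> \<le> exp (q * r)" using assms False mult_right_mono_neg[of q 1 r] by simp
  finally show ?thesis .
qed

lemma logistic_ge:
  assumes "- k \<le> r" shows "1 / (1 + exp k) \<le> logistic r"
proof -
  have "exp (- r) \<le> exp k" using assms by simp
  moreover have "logistic r = 1 / (1 + exp (- r))"
    by (simp add: logistic_def exp_minus field_simps exp_plus_1_pos)
  ultimately show ?thesis by (simp add: frac_le exp_plus_1_pos)
qed

lemma DERIV_softplus: "(softplus has_real_derivative logistic r) (at r)"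
  unfolding softplus_def[abs_def] logistic_def
  by (auto intro!: derivative_eq_intros simp: exp_plus_1_pos)

lemma DERIV_logistic: "(logistic has_real_derivative logistic r * (1 / (1 + exp r))) (at r)"
  unfolding logistic_def[abs_def]
  using exp_plus_1_pos[of r]
  by (auto intro!: derivative_eq_intros simp: field_simps)

lemma weight_nonneg: "0 \<le> \<epsilon> \<Longrightarrow> 0 \<le> weight a m \<epsilon> r"
  unfolding weight_def using softplus_nonneg[of r] logistic_pos[of r] by simp

lemma weight_mono:
  assumes "a \<le> b" "0 \<le> \<epsilon>" shows "weight a m \<epsilon> r \<le> weight b m \<epsilon> r"
  unfolding weight_def using softplus_nonneg[of r] logistic_pos[of r] assms
  by (intro divide_right_mono mult_right_mono powr_mono) auto

lemma weight_add: "weight (a + b) m \<epsilon> r = (1 + softplus r) powr b * weight a m \<epsilon> r"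
  unfolding weight_def using softplus_nonneg[of r] by (simp add: powr_add)

lemma weight_shift:
  "weight (a + 1) m \<epsilon> r = (1 + softplus r) * weight a m \<epsilon> r"
  using weight_add[of a 1 m \<epsilon> r] softplus_nonneg[of r] by simp

lemma DERIV_weight:
  assumes "0 \<le> \<epsilon>"
  shows "(weight a m \<epsilon> has_real_derivative weight_deriv a m \<epsilon> r) (at r)"
proof -
  let ?s = "softplus r" and ?l = "logistic r"
  let ?D = "1 + \<epsilon> * ?s"
  have p: "0 < 1 + ?s" "0 < ?D"
    using softplus_nonneg[of r] assms by (auto intro!: add_pos_nonneg)
  have 1: "((\<lambda>r. (1 + softplus r) powr a) has_real_derivative a * (1 + ?s) powr (a - 1) * ?l) (at r)"
    by (rule DERIV_fun_powr[THEN DERIV_cong]) (auto intro!: derivative_eq_intros DERIV_softplus p)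
  have 2: "((\<lambda>r. (1 + \<epsilon> * softplus r) ^ m) has_real_derivative real m * ?D ^ (m - 1) * (\<epsilon> * ?l)) (at r)"
    by (auto intro!: derivative_eq_intros DERIV_softplus)
  have D: "?D ^ m \<noteq> 0" using p by simp
  have "(weight a m \<epsilon> has_real_derivative
    ((a * (1 + ?s) powr (a - 1) * ?l * ?l + ?l * (1 / (1 + exp r)) * (1 + ?s) powr a) * ?D ^ m -
      (1 + ?s) powr a * ?l * (real m * ?D ^ (m - 1) * (\<epsilon> * ?l))) / (?D ^ m * ?D ^ m)) (at r)"
    unfolding weight_def[abs_def]
    by (rule DERIV_divide[OF DERIV_mult[OF 1 DERIV_logistic] 2 D])
  moreover have "(1 + ?s) powr (a - 1) = (1 + ?s) powr a / (1 + ?s)"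
    using p by (simp add: powr_diff)
  moreover have "real m * ?D ^ (m - 1) = real m * ?D ^ m / ?D"
    using p by (cases m) auto
  moreover have "((a * (P / S) * l * l + l * e * P) * B - P * l * (M * (\<epsilon> * l))) / (B * B)
      = P * l / B * (a * l / S + e - \<epsilon> * l * (M / B))" if "B \<noteq> 0" "S \<noteq> 0" for P S l e B M :: real
    using that by (simp add: field_simps)
  ultimately have "(weight a m \<epsilon> has_real_derivative (1 + ?s) powr a * ?l / ?D ^ m *
      (a * ?l / (1 + ?s) + 1 / (1 + exp r) - \<epsilon> * ?l * (real m * ?D ^ m / ?D / ?D ^ m))) (at r)"
    using p D by (metis less_numeral_extra(3))
  moreover have "\<epsilon> * ?l * (real m * ?D ^ m / ?D / ?D ^ m) = real m * \<epsilon> * ?l / ?D"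
    using D by simp
  ultimately show ?thesis by (simp only: weight_deriv_def weight_def)
qed

text \<open>Each of the three factors loses at least one power of \<open>1 + softplus r\<close> when it is
  differentiated, also where \<open>r \<rightarrow> -\<infinity>\<close> and uniformly in the regularisation \<open>\<epsilon>\<close>.\<close>

lemma weight_deriv_bound:
  assumes "0 \<le> \<epsilon>" "\<epsilon> \<le> 1"
  shows "\<bar>weight_deriv a m \<epsilon> r\<bar> \<le> (\<bar>a\<bar> + real m + 1) * weight (a - 1) m \<epsilon> r"
proof -
  let ?s = "softplus r" and ?l = "logistic r"
  have p: "0 < 1 + ?s" "0 < 1 + \<epsilon> * ?s"
    using softplus_nonneg[of r] assms by (auto intro!: add_pos_nonneg)
  have l: "0 \<le> ?l" "?l \<le> 1" using logistic_pos[of r] logistic_le_1[of r] by auto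
  have "\<bar>a * ?l / (1 + ?s)\<bar> \<le> \<bar>a\<bar> / (1 + ?s)"
    using p l by (simp add: abs_mult divide_right_mono mult_left_le)
  moreover have "\<bar>1 / (1 + exp r)\<bar> \<le> 1 / (1 + ?s)"
    using p softplus_le_exp[of r] by (simp add: frac_le)
  moreover have "\<bar>real m * \<epsilon> * ?l / (1 + \<epsilon> * ?s)\<bar> \<le> real m / (1 + ?s)"
  proof -
    have "\<epsilon> * ?l / (1 + \<epsilon> * ?s) \<le> \<epsilon> / (1 + \<epsilon> * ?s)"
      using p l assms by (intro divide_right_mono) (auto simp: mult_left_le)
    also have "\<dots> \<le> 1 / (1 + ?s)"
      using p assms by (simp add: field_simps)
    finally have "real m * (\<epsilon> * ?l / (1 + \<epsilon> * ?s)) \<le> real m * (1 / (1 + ?s))"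
      by (rule mult_left_mono) simp
    moreover have "0 \<le> real m * (\<epsilon> * ?l / (1 + \<epsilon> * ?s))" using p l assms by simp
    moreover have "real m * \<epsilon> * ?l / (1 + \<epsilon> * ?s) = real m * (\<epsilon> * ?l / (1 + \<epsilon> * ?s))"
      "real m * (1 / (1 + ?s)) = real m / (1 + ?s)" by simp_all
    ultimately show ?thesis by (simp only: abs_of_nonneg)
  qed
  ultimately have "\<bar>a * ?l / (1 + ?s) + 1 / (1 + exp r) - real m * \<epsilon> * ?l / (1 + \<epsilon> * ?s)\<bar>
      \<le> \<bar>a\<bar> / (1 + ?s) + 1 / (1 + ?s) + real m / (1 + ?s)"
    by linarith
  also have "\<dots> = (\<bar>a\<bar> + real m + 1) / (1 + ?s)" by (simp add: add_divide_distrib)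
  finally have "weight a m \<epsilon> r * \<bar>a * ?l / (1 + ?s) + 1 / (1 + exp r) - real m * \<epsilon> * ?l / (1 + \<epsilon> * ?s)\<bar>
      \<le> weight a m \<epsilon> r * ((\<bar>a\<bar> + real m + 1) / (1 + ?s))"
    by (rule mult_left_mono) (rule weight_nonneg[OF assms(1)])
  then have "\<bar>weight_deriv a m \<epsilon> r\<bar> \<le> weight a m \<epsilon> r * ((\<bar>a\<bar> + real m + 1) / (1 + ?s))"
    unfolding weight_deriv_def abs_mult by (simp only: abs_of_nonneg[OF weight_nonneg[OF assms(1)]])
  also have "\<dots> = (\<bar>a\<bar> + real m + 1) * weight (a - 1) m \<epsilon> r"
    using weight_shift[of "a - 1" m \<epsilon> r] p by simp
  finally show ?thesis .
qed

text \<open>\<open>weight a\<close> is the geometric mean of \<open>weight (a - 1)\<close> and \<open>weight (a + 1)\<close>.\<close>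

lemma weight_young:
  assumes "0 < \<delta>" "0 \<le> \<epsilon>"
  shows "weight a m \<epsilon> r * (x * y) \<le> \<delta> * (y\<^sup>2 * weight (a - 1) m \<epsilon> r) + (1 / (4 * \<delta>)) * (x\<^sup>2 * weight (a + 1) m \<epsilon> r)"
proof -
  define P where "P = 1 + softplus r"
  have w: "weight a m \<epsilon> r = P * weight (a - 1) m \<epsilon> r" "weight (a + 1) m \<epsilon> r = P * (P * weight (a - 1) m \<epsilon> r)"
    using weight_shift[of "a - 1" m \<epsilon> r] weight_shift[of a m \<epsilon> r] by (simp_all add: P_def)
  have "0 \<le> (2 * \<delta> * y - P * x)\<^sup>2 / (4 * \<delta>)" using assms by simp
  also have "\<dots> = \<delta> * y\<^sup>2 + (1 / (4 * \<delta>)) * (P * P * x\<^sup>2) - P * (x * y)"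
    using assms by (simp add: power2_eq_square field_simps)
  finally have "P * (x * y) \<le> \<delta> * y\<^sup>2 + (1 / (4 * \<delta>)) * (P * P * x\<^sup>2)" by simp
  from mult_right_mono[OF this weight_nonneg[OF assms(2), of "a - 1" m r]]
  show ?thesis unfolding w by (simp add: algebra_simps)
qed

text \<open>\<open>weight (a - 1 / 2)\<close> is the geometric mean of \<open>weight (a - 1)\<close> and \<open>weight a\<close>. This is where the
  mass flux costs half a power.\<close>

lemma weight_young_half:
  assumes "0 \<le> \<epsilon>"
  shows "weight (a - 1 / 2) m \<epsilon> r * (x * y) \<le> x\<^sup>2 * weight a m \<epsilon> r + y\<^sup>2 * weight (a - 1) m \<epsilon> r"
proof -
  define q where "q = sqrt (1 + softplus r)"
  have q: "q * q = 1 + softplus r" using softplus_nonneg[of r] by (simp add: q_def)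
  have w: "weight (a - 1 / 2) m \<epsilon> r = q * weight (a - 1) m \<epsilon> r"
    using weight_add[of "a - 1" "1 / 2" m \<epsilon> r] softplus_nonneg[of r] by (simp add: q_def powr_half_sqrt)
  have w1: "weight a m \<epsilon> r = q * q * weight (a - 1) m \<epsilon> r"
    using weight_shift[of "a - 1" m \<epsilon> r] by (simp add: q)
  have "2 * (q * x) * y \<le> (q * x)\<^sup>2 + y\<^sup>2" by (rule sum_squares_bound)
  moreover have "0 \<le> (q * x)\<^sup>2 + y\<^sup>2" by simp
  ultimately have "q * (x * y) \<le> q * q * x\<^sup>2 + y\<^sup>2" by (simp add: power2_eq_square algebra_simps)
  from mult_right_mono[OF this weight_nonneg[OF assms, of "a - 1" m r]]
  show ?thesis unfolding w w1 by (simp add: algebra_simps)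
qed

lemma weight_le_logistic:
  assumes "0 < \<epsilon>" "\<epsilon> \<le> 1" "a \<le> real m"
  shows "weight a m \<epsilon> r \<le> (1 / \<epsilon>) ^ m * logistic r"
proof -
  let ?s = "softplus r"
  have s: "0 \<le> ?s" by (rule softplus_nonneg)
  have D: "0 < 1 + \<epsilon> * ?s" using s assms by (intro add_pos_nonneg) auto
  have "(1 + ?s) powr a \<le> (1 + ?s) powr real m" using s assms by (intro powr_mono) auto
  also have "\<dots> = (1 + ?s) ^ m" using s by (intro powr_realpow) auto
  also have "\<dots> \<le> ((1 / \<epsilon>) * (1 + \<epsilon> * ?s)) ^ m"
    using assms s by (intro power_mono) (auto simp: field_simps)
  finally have "(1 + ?s) powr a * logistic r / (1 + \<epsilon> * ?s) ^ m \<le>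
      ((1 / \<epsilon>) ^ m * (1 + \<epsilon> * ?s) ^ m) * logistic r / (1 + \<epsilon> * ?s) ^ m"
    unfolding power_mult_distrib using D logistic_pos[of r]
    by (intro divide_right_mono mult_right_mono) auto
  also have "\<dots> = (1 / \<epsilon>) ^ m * logistic r" using D by simp
  finally show ?thesis by (simp add: weight_def)
qed

lemma weight_nonpos_le_logistic:
  assumes "0 \<le> \<epsilon>" "a \<le> 0"
  shows "weight a m \<epsilon> r \<le> logistic r"
proof -
  have "weight a m \<epsilon> r \<le> weight 0 m \<epsilon> r" by (rule weight_mono) (use assms in auto)
  also have "\<dots> \<le> logistic r / 1"
    unfolding weight_def using softplus_nonneg[of r] logistic_pos[of r] assms
    by (simp add: divide_le_eq)
  finally show ?thesis by simp
qed

text \<open>The square root replaces \<open>|x|\<close>, which is not differentiable at the origin.\<close>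

definition front :: "real \<Rightarrow> real \<Rightarrow> real ^ 'n::finite \<Rightarrow> real" where
  "front \<beta> t x = sqrt (1 + x \<bullet> x) - \<beta> * t"

lemma norm_le_sqrt: "norm x \<le> sqrt (1 + x \<bullet> x)" "1 \<le> sqrt (1 + x \<bullet> x)" "sqrt (1 + x \<bullet> x) \<le> 1 + norm x"
proof -
  show "norm x \<le> sqrt (1 + x \<bullet> x)" unfolding norm_eq_sqrt_inner by (rule real_sqrt_le_mono) simp
  show "1 \<le> sqrt (1 + x \<bullet> x)" by simp
  have "1 + x \<bullet> x \<le> (1 + norm x)\<^sup>2" by (simp add: power2_eq_square algebra_simps power2_norm_eq_inner[symmetric])
  then show "sqrt (1 + x \<bullet> x) \<le> 1 + norm x" by (simp add: real_le_lsqrt)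
qed

lemma front_line_derivative:
  "((\<lambda>h. front \<beta> t (x + h *\<^sub>R axis i 1)) has_real_derivative (x $ i / sqrt (1 + x \<bullet> x))) (at 0)"
proof -
  have "((\<lambda>h. 1 + (x + h *\<^sub>R axis i 1) \<bullet> (x + h *\<^sub>R axis i 1)) has_real_derivative 2 * x $ i) (at 0)"
  proof -
    have "(x + h *\<^sub>R axis i 1) \<bullet> (x + h *\<^sub>R axis i 1) = x \<bullet> x + 2 * h * x $ i + h * h" for h
      by (simp add: inner_axis inner_axis' inner_commute[of "axis i 1"] algebra_simps)
    then show ?thesis by (auto intro!: derivative_eq_intros)
  qed
  from DERIV_chain2[OF DERIV_real_sqrt[of "1 + (x + 0 *\<^sub>R axis i 1) \<bullet> (x + 0 *\<^sub>R axis i 1)"] this]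
  have "((\<lambda>h. sqrt (1 + (x + h *\<^sub>R axis i 1) \<bullet> (x + h *\<^sub>R axis i 1))) has_real_derivative
      x $ i / sqrt (1 + x \<bullet> x)) (at 0)"
    by (simp add: add_pos_nonneg field_simps)
  from DERIV_diff[OF this DERIV_const[of "\<beta> * t"]] show ?thesis by (simp add: front_def)
qed

lemma front_slope_le_1: "\<bar>x $ i / sqrt (1 + x \<bullet> x)\<bar> \<le> 1"
  for x :: "real ^ 'n::finite"
proof -
  have "\<bar>x $ i\<bar> \<le> sqrt (1 + x \<bullet> x)"
    using component_le_norm_cart[of x i] norm_le_sqrt(1)[of x] by linarith
  moreover have "0 < sqrt (1 + x \<bullet> x)" using norm_le_sqrt(2)[of x] by linarith
  ultimately show ?thesis by (simp add: abs_div_pos[symmetric])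
qed

lemma front_Lipschitz: "\<bar>front \<beta> t x - front \<beta> t y\<bar> \<le> norm (x - y)"
proof -
  have n: "sqrt (1 + z \<bullet> z) = norm (1 :: real, z)" for z :: "real ^ 'n"
    by (simp add: norm_Pair power2_norm_eq_inner)
  have "\<bar>norm (1 :: real, x) - norm (1 :: real, y)\<bar> \<le> norm ((1 :: real, x) - (1, y))"
    by (rule norm_triangle_ineq3)
  then show ?thesis by (simp add: front_def n norm_Pair)
qed

lemma continuous_on_front [continuous_intros]:
  "continuous_on A f \<Longrightarrow> continuous_on A (\<lambda>x. front \<beta> t (f x))"
  unfolding front_def by (intro continuous_intros)

lemma continuous_on_weight [continuous_intros]:
  "0 \<le> \<epsilon> \<Longrightarrow> continuous_on A f \<Longrightarrow> continuous_on A (\<lambda>x. weight a m \<epsilon> (f x))"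
  by (rule continuous_on_compose2[of UNIV "weight a m \<epsilon>"])
     (auto intro!: DERIV_continuous_on DERIV_weight)

lemma continuous_on_weight_deriv [continuous_intros]:
  assumes "0 \<le> \<epsilon>" "continuous_on A f"
  shows "continuous_on A (\<lambda>x. weight_deriv a m \<epsilon> (f x))"
proof -
  have s: "continuous_on UNIV softplus" and l: "continuous_on UNIV logistic"
    by (auto intro!: DERIV_continuous_on DERIV_softplus DERIV_logistic)
  have "continuous_on A (\<lambda>x. softplus (f x))" "continuous_on A (\<lambda>x. logistic (f x))"
    by (auto intro!: continuous_on_compose2[OF s] continuous_on_compose2[OF l] assms)
  moreover have "1 + softplus r \<noteq> 0" "1 + \<epsilon> * softplus r \<noteq> 0" "1 + exp r \<noteq> 0" for r
    using softplus_nonneg[of r] assms exp_plus_1_pos[of r] mult_nonneg_nonneg[of \<epsilon> "softplus r"] by linarith+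
  ultimately show ?thesis
    unfolding weight_deriv_def using assms by (intro continuous_intros) auto
qed

section \<open>Integrability on \<open>\<real>\<^sup>d\<close>\<close>

text \<open>The exponent \<open>2d\<close> lets the function be dominated by the product of \<open>1 / (1 + x\<^sub>i\<^sup>2)\<close> over the
  coordinates.\<close>

lemma integrable_inverse_power:
  "integrable lborel (\<lambda>x :: real ^ 'n::finite. 1 / (1 + norm x) ^ (2 * CARD('n)))"
proof (rule integrableI_bounded)
  have one: "(\<integral>\<^sup>+x. ennreal (1 / (1 + x\<^sup>2)) \<partial>lborel) < \<infinity>"
  proof -
    have half: "(\<integral>\<^sup>+x. ennreal (1 / (1 + x\<^sup>2)) * indicator {0..} x \<partial>lborel) = ennreal (pi / 2 - arctan 0)"
      by (rule nn_integral_FTC_atLeast)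
         (auto intro!: derivative_eq_intros tendsto_arctan_at_top simp: field_simps)
    have "(\<integral>\<^sup>+x. ennreal (1 / (1 + x\<^sup>2)) \<partial>lborel) \<le>
        (\<integral>\<^sup>+x. ennreal (1 / (1 + x\<^sup>2)) * indicator {0..} x + ennreal (1 / (1 + (- x)\<^sup>2)) * indicator {0..} (- x) \<partial>lborel)"
      by (rule nn_integral_mono) (auto simp: indicator_def)
    also have "\<dots> = (\<integral>\<^sup>+x. ennreal (1 / (1 + x\<^sup>2)) * indicator {0..} x \<partial>lborel) +
        (\<integral>\<^sup>+x. ennreal (1 / (1 + (- x)\<^sup>2)) * indicator {0..} (- x) \<partial>lborel)"
      by (rule nn_integral_add) auto
    also have "(\<integral>\<^sup>+x. ennreal (1 / (1 + (- x)\<^sup>2)) * indicator {0..} (- x) \<partial>lborel) =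
        (\<integral>\<^sup>+x. ennreal (1 / (1 + x\<^sup>2)) * indicator {0..} x \<partial>lborel)"
      using nn_integral_real_affine[of "\<lambda>x. ennreal (1 / (1 + x\<^sup>2)) * indicator {0..} x" "-1" 0] by simp
    finally show ?thesis unfolding half by (rule order_le_less_trans) (simp flip: ennreal_plus)
  qed
  have "(\<integral>\<^sup>+x. ennreal (norm (1 / (1 + norm (x :: real ^ 'n)) ^ (2 * CARD('n)))) \<partial>lborel) \<le>
      (\<integral>\<^sup>+x. (\<Prod>b\<in>Basis. ennreal (1 / (1 + ((x :: real ^ 'n) \<bullet> b)\<^sup>2))) \<partial>lborel)"
  proof (rule nn_integral_mono)
    fix x :: "real ^ 'n"
    have "(\<Prod>b\<in>Basis. 1 + (x \<bullet> b)\<^sup>2) \<le> (\<Prod>b\<in>(Basis :: (real ^ 'n) set). (1 + norm x)\<^sup>2)"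
    proof (rule prod_mono)
      fix b :: "real ^ 'n" assume b: "b \<in> Basis"
      have "(x \<bullet> b)\<^sup>2 \<le> (norm x)\<^sup>2" using Basis_le_norm[OF b, of x] by (simp add: abs_le_square_iff[symmetric])
      also have "1 + \<dots> \<le> (1 + norm x)\<^sup>2" by (simp add: power2_eq_square algebra_simps)
      finally show "0 \<le> 1 + (x \<bullet> b)\<^sup>2 \<and> 1 + (x \<bullet> b)\<^sup>2 \<le> (1 + norm x)\<^sup>2" by simp
    qed
    also have "\<dots> = (1 + norm x) ^ (2 * CARD('n))" by (simp add: power_mult)
    finally have "1 / (1 + norm x) ^ (2 * CARD('n)) \<le> 1 / (\<Prod>b\<in>Basis. 1 + (x \<bullet> b)\<^sup>2)"
      by (intro divide_left_mono mult_pos_pos prod_pos)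
         (auto intro!: zero_less_power add_pos_nonneg simp: prod_pos)
    also have "\<dots> = (\<Prod>b\<in>Basis. 1 / (1 + (x \<bullet> b)\<^sup>2))" by (simp add: prod_dividef)
    finally show "ennreal (norm (1 / (1 + norm x) ^ (2 * CARD('n)))) \<le> (\<Prod>b\<in>Basis. ennreal (1 / (1 + (x \<bullet> b)\<^sup>2)))"
      by (simp add: prod_ennreal ennreal_leI)
  qed
  also have "\<dots> = (\<Prod>b\<in>(Basis :: (real ^ 'n) set). \<integral>\<^sup>+x. ennreal (1 / (1 + x\<^sup>2)) \<partial>lborel)"
    using nn_integral_lborel_prod[where 'a = "real ^ 'n", of "\<lambda>_ x. ennreal (1 / (1 + x\<^sup>2))"] by simp
  also have "\<dots> < \<infinity>" using one by (simp add: power_less_top_ennreal)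
  finally show "(\<integral>\<^sup>+x. ennreal (norm (1 / (1 + norm (x :: real ^ 'n)) ^ (2 * CARD('n)))) \<partial>lborel) < \<infinity>" .
qed measurable

lemma integrable_exp_norm:
  assumes "\<kappa> > 0"
  shows "integrable lborel (\<lambda>x :: real ^ 'n::finite. exp (- \<kappa> * norm x))"
proof -
  define m where "m = 2 * CARD('n)"
  have m: "0 < real m" by (simp add: m_def)
  have "integrable lborel (\<lambda>x :: real ^ 'n. (exp \<kappa> * (real m / \<kappa>) ^ m) * (1 / (1 + norm x) ^ m))"
    using integrable_inverse_power[where 'n = 'n] unfolding m_def by (rule integrable_mult_right)
  then show ?thesis
  proof (rule Bochner_Integration.integrable_bound)
    have "exp (- \<kappa> * norm x) \<le> (exp \<kappa> * (real m / \<kappa>) ^ m) * (1 / (1 + norm x) ^ m)" for x :: "real ^ 'n"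
    proof -
      let ?y = "1 + norm x"
      have y: "0 < ?y" by (simp add: add_pos_nonneg)
      have "(\<kappa> * ?y / m) ^ m \<le> exp (\<kappa> * ?y / m) ^ m"
        using exp_ge_add_one_self[of "\<kappa> * ?y / m"] m y assms
        by (intro power_mono) (linarith, simp)
      also have "\<dots> = exp (\<kappa> * ?y)" using m by (simp add: exp_of_nat_mult[symmetric])
      finally have "(\<kappa> / m) ^ m * ?y ^ m \<le> exp (\<kappa> * ?y)" by (simp add: power_mult_distrib power_divide)
      moreover have "(\<kappa> / m) ^ m * (real m / \<kappa>) ^ m = 1"
        using assms m by (simp flip: power_mult_distrib)
      ultimately have "?y ^ m \<le> (real m / \<kappa>) ^ m * exp (\<kappa> * ?y)"
        using mult_left_mono[of "(\<kappa> / m) ^ m * ?y ^ m" "exp (\<kappa> * ?y)" "(real m / \<kappa>) ^ m"] assms m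
        by (simp add: algebra_simps)
      then have "exp (- \<kappa> * norm x) * ?y ^ m \<le> exp (- \<kappa> * norm x) * ((real m / \<kappa>) ^ m * exp (\<kappa> * ?y))"
        by (rule mult_left_mono) simp
      also have "\<dots> = exp \<kappa> * (real m / \<kappa>) ^ m" by (simp add: algebra_simps flip: exp_add)
      finally show ?thesis using y by (simp add: pos_le_divide_eq)
    qed
    then show "AE x in lborel. norm (exp (- \<kappa> * norm x)) \<le>
        norm ((exp \<kappa> * (real m / \<kappa>) ^ m) * (1 / (1 + norm (x :: real ^ 'n)) ^ m))"
      using assms by (auto intro!: AE_I2 simp: abs_mult)
  qed measurable
qed

text \<open>An integrable bound that is uniform for \<open>t \<le> T\<close>, as is needed to differentiate weighted masses
  under the integral sign: on such times \<open>1 + |x|\<close> is at most a multiple of \<open>1 + \<epsilon> softplus r\<close>.\<close>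

lemma weight_le_inverse_power:
  fixes x :: "real ^ 'n::finite" and a :: real
  assumes \<epsilon>: "0 < \<epsilon>" "\<epsilon> \<le> 1" and \<beta>: "0 \<le> \<beta>" and t: "t \<le> T" "0 \<le> T"
    and m: "2 * CARD('n) \<le> m" "a + 2 * CARD('n) \<le> m"
  shows "weight a m \<epsilon> (front \<beta> t x) \<le> ((1 + \<beta> * T) / \<epsilon>) ^ m / (1 + norm x) ^ (2 * CARD('n))"
proof -
  define s where "s = softplus (front \<beta> t x)"
  define D where "D = 1 + \<epsilon> * s"
  define k where "k = m - 2 * CARD('n)"
  have s: "0 \<le> s" unfolding s_def by (rule softplus_nonneg)
  have D: "1 \<le> D" using s \<epsilon> by (simp add: D_def)
  have P: "1 + s \<le> (1 / \<epsilon>) * D" using \<epsilon> s by (simp add: D_def field_simps)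
  have B: "1 \<le> 1 + \<beta> * T" using \<beta> t by simp
  have "front \<beta> t x \<le> s" unfolding s_def by (rule softplus_ge)
  then have "norm x \<le> s + \<beta> * t" using norm_le_sqrt(1)[of x] by (simp add: front_def)
  also have "\<dots> \<le> s + \<beta> * T" using mult_left_mono[OF t(1) \<beta>] by simp
  finally have nx: "norm x \<le> s + \<beta> * T" .
  have "(1 + \<beta> * T) * (1 + s) = 1 + s + \<beta> * T + \<beta> * T * s" "0 \<le> \<beta> * T * s"
    using s \<beta> t by (simp_all add: algebra_simps)
  with nx have "1 + norm x \<le> (1 + \<beta> * T) * (1 + s)" by linarith
  also have "\<dots> \<le> (1 + \<beta> * T) * ((1 / \<epsilon>) * D)" using P B by (intro mult_left_mono) auto
  finally have y: "1 + norm x \<le> (1 + \<beta> * T) / \<epsilon> * D" by simp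
  have "(1 + s) powr a \<le> (1 + s) powr real k" using s m by (intro powr_mono) (auto simp: k_def)
  also have "\<dots> = (1 + s) ^ k" using s by (intro powr_realpow) auto
  also have "\<dots> \<le> ((1 + \<beta> * T) / \<epsilon> * D) ^ k"
  proof (rule power_mono)
    have "(1 / \<epsilon>) * D \<le> (1 + \<beta> * T) * ((1 / \<epsilon>) * D)"
      using mult_right_mono[OF B, of "1 / \<epsilon> * D"] \<epsilon> D by simp
    then show "1 + s \<le> (1 + \<beta> * T) / \<epsilon> * D" using P by simp
  qed (use s in simp)
  finally have a: "(1 + s) powr a \<le> ((1 + \<beta> * T) / \<epsilon> * D) ^ k" .
  have "(1 + s) powr a * (1 + norm x) ^ (2 * CARD('n)) \<le>
      ((1 + \<beta> * T) / \<epsilon> * D) ^ k * ((1 + \<beta> * T) / \<epsilon> * D) ^ (2 * CARD('n))"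
    using y a by (intro mult_mono power_mono) (use D B \<epsilon> in auto)
  also have "\<dots> = ((1 + \<beta> * T) / \<epsilon>) ^ m * D ^ m"
    using m(1) by (simp add: k_def power_mult_distrib[symmetric] power_add[symmetric])
  finally have *: "(1 + s) powr a * (1 + norm x) ^ (2 * CARD('n)) \<le> ((1 + \<beta> * T) / \<epsilon>) ^ m * D ^ m" .
  have n: "0 < (1 + norm x) ^ (2 * CARD('n))" by (intro zero_less_power add_pos_nonneg) auto
  have "weight a m \<epsilon> (front \<beta> t x) \<le> (1 + s) powr a * 1 / D ^ m"
    unfolding weight_def s_def[symmetric] D_def[symmetric]
    using D logistic_le_1 by (intro divide_right_mono mult_left_mono) auto
  also have "\<dots> \<le> ((1 + \<beta> * T) / \<epsilon>) ^ m / (1 + norm x) ^ (2 * CARD('n))"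
  proof -
    have "A * 1 / E \<le> B / N" if "A * N \<le> B * E" "0 < N" "0 < E" for A B N E :: real
      using that by (simp add: field_simps)
    from this[OF * n] show ?thesis using D by simp
  qed
  finally show ?thesis .
qed

section \<open>Multi-solitons ahead of the front\<close>

definition phase :: "real ^ 'n::finite \<Rightarrow> real \<Rightarrow> real ^ 'n \<Rightarrow> complex" where
  "phase v c x = exp (\<i> * complex_of_real (1 / 2 * (v \<bullet> x) + c))"

lemma norm_phase [simp]: "cmod (phase v c x) = 1"
  unfolding phase_def by (metis mult.commute norm_exp_i_times mult.commute)

lemma
  fixes v :: "real ^ 'n::finite"
  shows partial_phase: "partial i (phase v c) = (\<lambda>x. (\<i> * complex_of_real (v $ i / 2)) * phase v c x)"
    and smooth_phase: "smooth (phase v c)"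
proof -
  show p: "partial i (phase v c) = (\<lambda>x. (\<i> * complex_of_real (v $ i / 2)) * phase v c x)" for i
  proof (rule ext, rule partial_eqI)
    fix x :: "real ^ 'n"
    have "1 / 2 * (v \<bullet> (x + h *\<^sub>R axis i 1)) + c = h * (v $ i / 2) + (1 / 2 * (v \<bullet> x) + c)" for h
      by (simp add: inner_axis inner_add_right field_simps)
    then have eq: "phase v c (x + h *\<^sub>R axis i 1) =
        exp (h *\<^sub>R (\<i> * complex_of_real (v $ i / 2))) * phase v c x" for h
      unfolding phase_def by (simp add: scaleR_conv_of_real algebra_simps flip: exp_add)
    have "((\<lambda>h. exp (h *\<^sub>R (\<i> * complex_of_real (v $ i / 2))) * phase v c x) has_vector_derivative
        exp (0 *\<^sub>R (\<i> * complex_of_real (v $ i / 2))) * (\<i> * complex_of_real (v $ i / 2)) * phase v c x) (at 0)"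
      by (rule has_vector_derivative_mult_left[OF exp_scaleR_has_vector_derivative_right])
    then show "((\<lambda>h. phase v c (x + h *\<^sub>R axis i 1)) has_vector_derivative
        (\<i> * complex_of_real (v $ i / 2)) * phase v c x) (at 0)"
      by (simp add: eq)
  qed
  have d: "phase v c differentiable_on UNIV"
    unfolding differentiable_on_def
  proof
    fix x
    have 1: "((\<lambda>x. \<i> * complex_of_real (1 / 2 * (v \<bullet> x) + c)) has_derivative
        (\<lambda>h. \<i> * complex_of_real (1 / 2 * (v \<bullet> h)))) (at x)"
      by (auto intro!: derivative_eq_intros)
    show "phase v c differentiable at x within UNIV"
      unfolding phase_def[abs_def] differentiable_def
      using has_derivative_compose[OF 1 DERIV_exp[unfolded has_field_derivative_def]] by blast
  qed
  have const: "differentiable_upto k (\<lambda>x :: real ^ 'n. a :: complex)" for k a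
    by (rule smooth_const[unfolded smooth_iff, rule_format])
  have "differentiable_upto k (phase v c)" for k
  proof (induction k)
    case (Suc k)
    then show ?case
      unfolding differentiable_upto.simps p
      by (intro conjI d allI bounded_bilinear.differentiable_upto_prod[OF bounded_bilinear_mult] const)
  qed (simp add: d)
  then show "smooth (phase v c)" by (simp add: smooth_iff)
qed

text \<open>\<open>\<partial>\<^sub>i (q E) = (twist v i q) E\<close> for the phase factor \<open>E\<close> of a soliton of velocity \<open>v\<close>.\<close>

definition twist :: "real ^ 'n::finite \<Rightarrow> 'n \<Rightarrow> (real ^ 'n \<Rightarrow> complex) \<Rightarrow> real ^ 'n \<Rightarrow> complex" where
  "twist v i q = (\<lambda>x. partial i q x + (\<i> * complex_of_real (v $ i / 2)) * q x)"

lemma smooth_twist: "smooth q \<Longrightarrow> smooth (twist v i q)"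
  unfolding twist_def by (intro smooth_add smooth_mult smooth_const smooth_partial)

lemma smooth_twists: "smooth q \<Longrightarrow> smooth (foldr (twist v) xs q)"
  by (induction xs) (auto intro: smooth_twist)

lemma partials_modulated:
  assumes "smooth q"
  shows "foldr partial xs (\<lambda>x. q (x - y) * phase v c x) = (\<lambda>x. foldr (twist v) xs q (x - y) * phase v c x)"
proof (induction xs)
  case (Cons i xs)
  let ?q = "foldr (twist v) xs q"
  have "smooth ?q" by (rule smooth_twists[OF assms])
  then have "partial i (\<lambda>x. ?q (x - y) * phase v c x) =
      (\<lambda>x. ?q (x - y) * partial i (phase v c) x + partial i (\<lambda>x. ?q (x - y)) x * phase v c x)"
    by (intro bounded_bilinear.partial_prod[OF bounded_bilinear_mult] smooth_differentiable smooth_shift smooth_phase)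
  also have "\<dots> = (\<lambda>x. twist v i ?q (x - y) * phase v c x)"
    by (simp add: partial_shift partial_phase twist_def algebra_simps)
  finally show ?case using Cons by simp
qed simp

definition exp_decaying :: "real \<Rightarrow> (real ^ 'n::finite \<Rightarrow> complex) \<Rightarrow> bool" where
  "exp_decaying \<kappa> q \<longleftrightarrow> smooth q \<and> (\<forall>xs. \<exists>C. \<forall>x. cmod (foldr partial xs q x) \<le> C * exp (- \<kappa> * norm x))"

lemma exp_decaying_twist:
  assumes "exp_decaying \<kappa> q" shows "exp_decaying \<kappa> (twist v i q)"
  unfolding exp_decaying_def
proof (intro conjI allI)
  have s: "smooth q" using assms by (simp add: exp_decaying_def)
  then show "smooth (twist v i q)" by (rule smooth_twist)
  fix xs
  let ?a = "\<i> * complex_of_real (v $ i / 2)"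
  obtain C1 C2 where C: "\<And>x. cmod (foldr partial (xs @ [i]) q x) \<le> C1 * exp (- \<kappa> * norm x)"
    "\<And>x. cmod (foldr partial xs q x) \<le> C2 * exp (- \<kappa> * norm x)"
    using assms unfolding exp_decaying_def by meson
  have eq: "foldr partial xs (twist v i q) = (\<lambda>x. foldr partial (xs @ [i]) q x + ?a * foldr partial xs q x)"
    unfolding twist_def partials_add[OF smooth_partial[OF s] smooth_mult[OF smooth_const s]]
      bounded_linear.partials_linear[OF bounded_linear_mult_right s] by simp
  show "\<exists>C. \<forall>x. cmod (foldr partial xs (twist v i q) x) \<le> C * exp (- \<kappa> * norm x)"
  proof (intro exI allI)
    fix x
    have "cmod (foldr partial xs (twist v i q) x) \<le> cmod (foldr partial (xs @ [i]) q x) + cmod ?a * cmod (foldr partial xs q x)"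
      unfolding eq norm_mult[symmetric] by (rule norm_triangle_ineq)
    also have "\<dots> \<le> C1 * exp (- \<kappa> * norm x) + cmod ?a * (C2 * exp (- \<kappa> * norm x))"
      by (intro add_mono mult_left_mono C) simp
    finally show "cmod (foldr partial xs (twist v i q) x) \<le> (C1 + cmod ?a * C2) * exp (- \<kappa> * norm x)"
      by (simp add: algebra_simps)
  qed
qed

lemma exp_decaying_twists: "exp_decaying \<kappa> q \<Longrightarrow> exp_decaying \<kappa> (foldr (twist v) xs q)"
  by (induction xs) (auto intro: exp_decaying_twist)

lemma soliton_eq:
  "soliton Q \<omega> v \<gamma> x0 t = (\<lambda>x. complex_of_real (Q (x - (x0 + t *\<^sub>R v))) * phase v ((\<omega> - (norm v)\<^sup>2 / 4) * t + \<gamma>) x)"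
  by (simp add: fun_eq_iff soliton_def phase_def algebra_simps)

lemma smooth_soliton:
  assumes "smooth Q" shows "smooth (soliton Q \<omega> v \<gamma> x0 t)"
  unfolding soliton_eq
  by (intro smooth_mult smooth_phase smooth_shift bounded_linear.smooth_linear[OF bounded_linear_of_real] assms)

lemma soliton_bound:
  fixes Q :: "real ^ 'n::finite \<Rightarrow> real"
  assumes Q: "smooth Q"
    and decay: "\<And>\<sigma>. \<exists>C>0. \<forall>x. \<bar>multi_partial \<sigma> Q x\<bar> \<le> C * exp (- \<kappa> * norm x)"
  shows "\<exists>C. \<forall>t x. cmod (foldr partial xs (soliton Q \<omega> v \<gamma> x0 t) x) \<le> C * exp (- \<kappa> * norm (x - (x0 + t *\<^sub>R v)))"
proof -
  let ?q = "\<lambda>x. complex_of_real (Q x)"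
  have q: "smooth ?q" by (rule bounded_linear.smooth_linear[OF bounded_linear_of_real Q])
  have "exp_decaying \<kappa> ?q"
    unfolding exp_decaying_def
  proof (intro conjI allI q)
    fix ys
    have "cmod (foldr partial ys ?q x) = \<bar>multi_partial (\<chi> i. count (mset ys) i) Q x\<bar>" for x
      by (simp add: bounded_linear.partials_linear[OF bounded_linear_of_real Q] partials_eq_multi_partial(1)[OF Q])
    then show "\<exists>C. \<forall>x. cmod (foldr partial ys ?q x) \<le> C * exp (- \<kappa> * norm x)"
      using decay[of "\<chi> i. count (mset ys) i"] by auto
  qed
  then have "exp_decaying \<kappa> (foldr (twist v) xs ?q)" by (rule exp_decaying_twists)
  then obtain C where "\<And>x. cmod (foldr partial [] (foldr (twist v) xs ?q) x) \<le> C * exp (- \<kappa> * norm x)"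
    unfolding exp_decaying_def by meson
  then show ?thesis
    unfolding soliton_eq partials_modulated[OF q] by (auto simp: norm_mult)
qed

abbreviation front_mass :: "real \<Rightarrow> real \<Rightarrow> (real ^ 'n::finite \<Rightarrow> complex) \<Rightarrow> ennreal" where
  "front_mass \<beta> t f \<equiv> \<integral>\<^sup>+x. ennreal ((cmod (f x))\<^sup>2 * logistic (front \<beta> t x)) \<partial>lborel"

definition decays_in_front ::
  "real \<Rightarrow> real \<Rightarrow> real \<Rightarrow> (real \<Rightarrow> real ^ 'n::finite \<Rightarrow> complex) \<Rightarrow> bool" where
  "decays_in_front \<beta> c T f \<longleftrightarrow> (\<exists>C. \<forall>t\<ge>T.
     front_mass \<beta> t (f t) \<le> ennreal (C * exp (- c * t)))"

lemma measurable_front_logistic [measurable]: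
  "(\<lambda>x :: real ^ 'n::finite. logistic (front \<beta> t x)) \<in> borel_measurable borel"
proof -
  have l: "isCont logistic r" for r using DERIV_logistic by (rule DERIV_isCont)
  have "continuous_on UNIV (front \<beta> t :: real ^ 'n \<Rightarrow> real)" by (intro continuous_intros)
  then show ?thesis
    by (intro borel_measurable_continuous_onI continuous_on_compose2[OF continuous_at_imp_continuous_on[of UNIV logistic]])
       (auto simp: l)
qed

lemma decays_in_front_add:
  assumes f: "decays_in_front \<beta> c T f" "\<And>t. t \<ge> T \<Longrightarrow> f t \<in> borel_measurable borel"
    and g: "decays_in_front \<beta> c T g" "\<And>t. t \<ge> T \<Longrightarrow> g t \<in> borel_measurable borel"
  shows "decays_in_front \<beta> c T (\<lambda>t x. f t x + g t x)"
proof -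
  obtain A B where A: "\<And>t. t \<ge> T \<Longrightarrow> front_mass \<beta> t (f t) \<le> ennreal (A * exp (- c * t))"
    and B: "\<And>t. t \<ge> T \<Longrightarrow> front_mass \<beta> t (g t) \<le> ennreal (B * exp (- c * t))"
    using f(1) g(1) unfolding decays_in_front_def by blast
  show ?thesis
    unfolding decays_in_front_def
  proof (intro exI allI impI)
    fix t assume t: "t \<ge> T"
    note [measurable] = f(2)[OF t] g(2)[OF t]
    let ?l = "\<lambda>x. logistic (front \<beta> t x)"
    have "(\<integral>\<^sup>+x. ennreal ((cmod (f t x + g t x))\<^sup>2 * ?l x) \<partial>lborel) \<le>
        (\<integral>\<^sup>+x. 2 * ennreal ((cmod (f t x))\<^sup>2 * ?l x) + 2 * ennreal ((cmod (g t x))\<^sup>2 * ?l x) \<partial>lborel)"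
    proof (rule nn_integral_mono)
      fix x
      have "(cmod (f t x + g t x))\<^sup>2 \<le> (cmod (f t x) + cmod (g t x))\<^sup>2"
        by (intro power_mono norm_triangle_ineq) simp
      also have "\<dots> \<le> 2 * (cmod (f t x))\<^sup>2 + 2 * (cmod (g t x))\<^sup>2"
        using sum_squares_bound[of "cmod (f t x)" "cmod (g t x)"] by (simp add: power2_sum)
      finally have "(cmod (f t x + g t x))\<^sup>2 * ?l x \<le> (2 * (cmod (f t x))\<^sup>2 + 2 * (cmod (g t x))\<^sup>2) * ?l x"
        by (rule mult_right_mono) (simp add: logistic_pos less_imp_le)
      then have "ennreal ((cmod (f t x + g t x))\<^sup>2 * ?l x) \<le>
          ennreal (2 * ((cmod (f t x))\<^sup>2 * ?l x) + 2 * ((cmod (g t x))\<^sup>2 * ?l x))"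
        by (intro ennreal_leI) (simp add: algebra_simps)
      then show "ennreal ((cmod (f t x + g t x))\<^sup>2 * ?l x) \<le>
          2 * ennreal ((cmod (f t x))\<^sup>2 * ?l x) + 2 * ennreal ((cmod (g t x))\<^sup>2 * ?l x)"
        using logistic_pos[of "front \<beta> t x"] by (simp add: ennreal_plus ennreal_mult)
    qed
    also have "\<dots> = 2 * (\<integral>\<^sup>+x. ennreal ((cmod (f t x))\<^sup>2 * ?l x) \<partial>lborel) + 2 * (\<integral>\<^sup>+x. ennreal ((cmod (g t x))\<^sup>2 * ?l x) \<partial>lborel)"
      by (simp add: nn_integral_add nn_integral_cmult)
    also have "\<dots> \<le> 2 * ennreal (\<bar>A\<bar> * exp (- c * t)) + 2 * ennreal (\<bar>B\<bar> * exp (- c * t))"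
      using A[OF t] B[OF t] by (intro add_mono mult_left_mono order_trans[OF A[OF t]] order_trans[OF B[OF t]] ennreal_leI) auto
    also have "\<dots> = ennreal ((2 * \<bar>A\<bar> + 2 * \<bar>B\<bar>) * exp (- c * t))"
      by (simp add: ennreal_plus ennreal_mult distrib_right mult.assoc)
    finally show "(\<integral>\<^sup>+x. ennreal ((cmod (f t x + g t x))\<^sup>2 * ?l x) \<partial>lborel) \<le> ennreal ((2 * \<bar>A\<bar> + 2 * \<bar>B\<bar>) * exp (- c * t))" .
  qed
qed

lemma decays_in_front_sum:
  assumes "finite J" "\<And>j. j \<in> J \<Longrightarrow> decays_in_front \<beta> c T (f j)"
    "\<And>j t. j \<in> J \<Longrightarrow> t \<ge> T \<Longrightarrow> f j t \<in> borel_measurable borel"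
  shows "decays_in_front \<beta> c T (\<lambda>t x. \<Sum>j\<in>J. f j t x)"
  using assms
proof (induction J rule: finite_induct)
  case empty
  show ?case by (auto simp: decays_in_front_def intro!: exI[of _ 0])
next
  case (insert j J)
  have "decays_in_front \<beta> c T (\<lambda>t x. f j t x + (\<Sum>j\<in>J. f j t x))"
    by (rule decays_in_front_add) (use insert in \<open>auto intro!: borel_measurable_sum\<close>)
  with insert show ?case by simp
qed

text \<open>The front runs ahead of the soliton at relative speed \<open>\<beta> - |v|\<close>, and the logistic factor
  decays exponentially behind the front.\<close>

lemma travelling_wave_decays_in_front:
  fixes f :: "real \<Rightarrow> real ^ 'n::finite \<Rightarrow> complex"
  assumes bound: "\<And>t x. cmod (f t x) \<le> C * exp (- \<kappa> * norm (x - (x0 + t *\<^sub>R v)))"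
    and \<kappa>: "\<kappa> > 0" and c: "c \<le> min 1 \<kappa> * (\<beta> - norm v)" and T: "T \<ge> 0"
  shows "decays_in_front \<beta> c T f"
  unfolding decays_in_front_def
proof (intro exI allI impI)
  fix t assume "t \<ge> T"
  with T have t: "t \<ge> 0" by simp
  \<comment> \<open>of the factor \<open>exp (- 2 \<kappa> |z|)\<close> of \<open>|f|\<^sup>2\<close>, one half absorbs the growth \<open>exp (l |z|)\<close> of the bound for
      the logistic factor and the other half is integrated\<close>
  define l where "l = min 1 \<kappa>"
  have l: "0 \<le> l" "l \<le> 1" "l \<le> \<kappa>" using \<kappa> by (auto simp: l_def)
  define I where "I = (LINT x|lborel. exp (- \<kappa> * norm (x :: real ^ 'n)))"
  have I: "(\<integral>\<^sup>+x. ennreal (exp (- \<kappa> * norm (x :: real ^ 'n))) \<partial>lborel) = ennreal I"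
    unfolding I_def by (rule nn_integral_eq_integral[OF integrable_exp_norm[OF \<kappa>]]) simp
  define D where "D = C\<^sup>2 * exp (l * (1 + norm x0)) * exp (- c * t)"
  have "(cmod (f t x))\<^sup>2 * logistic (front \<beta> t x) \<le> D * exp (- \<kappa> * norm (x - (x0 + t *\<^sub>R v)))" for x
  proof -
    let ?z = "norm (x - (x0 + t *\<^sub>R v))"
    have "norm x \<le> ?z + norm (x0 + t *\<^sub>R v)" by (metis diff_add_cancel norm_triangle_ineq)
    also have "\<dots> \<le> ?z + (norm x0 + t * norm v)"
      using norm_triangle_ineq[of x0 "t *\<^sub>R v"] t by simp
    finally have "front \<beta> t x \<le> 1 + ?z + norm x0 - (\<beta> - norm v) * t"
      using norm_le_sqrt(3)[of x] by (simp add: front_def algebra_simps)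
    then have "l * front \<beta> t x \<le> l * (1 + ?z + norm x0 - (\<beta> - norm v) * t)"
      by (rule mult_left_mono) (rule l)
    also have "\<dots> = l * ?z + l * (1 + norm x0) - l * (\<beta> - norm v) * t" by (simp add: algebra_simps)
    also have "\<dots> \<le> \<kappa> * ?z + l * (1 + norm x0) - c * t"
      using mult_right_mono[OF c t] mult_right_mono[OF l(3) norm_ge_zero[of "x - (x0 + t *\<^sub>R v)"]]
      by (simp add: l_def)
    finally have "logistic (front \<beta> t x) \<le> exp (\<kappa> * ?z + l * (1 + norm x0) - c * t)"
      by (intro order_trans[OF logistic_le_exp[OF l(1,2)]]) simp
    moreover have "(cmod (f t x))\<^sup>2 \<le> (C * exp (- \<kappa> * ?z))\<^sup>2"
      by (intro power_mono bound) simp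
    ultimately have "(cmod (f t x))\<^sup>2 * logistic (front \<beta> t x) \<le>
        (C * exp (- \<kappa> * ?z))\<^sup>2 * exp (\<kappa> * ?z + l * (1 + norm x0) - c * t)"
      using logistic_pos[of "front \<beta> t x"] by (intro mult_mono) auto
    also have "\<dots> = C\<^sup>2 * exp (- \<kappa> * ?z + - \<kappa> * ?z + (\<kappa> * ?z + l * (1 + norm x0) - c * t))"
      by (simp only: power_mult_distrib power2_eq_square exp_add mult_ac)
    also have "\<dots> = C\<^sup>2 * exp (l * (1 + norm x0) + - c * t + - \<kappa> * ?z)" by simp
    also have "\<dots> = D * exp (- \<kappa> * ?z)" by (simp only: D_def exp_add mult.assoc)
    finally show ?thesis .
  qed
  then have "front_mass \<beta> t (f t) \<le>
      (\<integral>\<^sup>+x. ennreal (D * exp (- \<kappa> * norm (x - (x0 + t *\<^sub>R v)))) \<partial>lborel)"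
    by (intro nn_integral_mono ennreal_leI)
  also have "\<dots> = ennreal D * (\<integral>\<^sup>+x. ennreal (exp (- \<kappa> * norm (x - (x0 + t *\<^sub>R v)))) \<partial>lborel)"
    by (simp add: ennreal_mult D_def nn_integral_cmult)
  also have "\<dots> = ennreal D * (\<integral>\<^sup>+x. ennreal (exp (- \<kappa> * norm (- (x0 + t *\<^sub>R v) + x))) \<partial>lborel)"
    by (simp only: uminus_add_conv_diff)
  also have "(\<integral>\<^sup>+x. ennreal (exp (- \<kappa> * norm (- (x0 + t *\<^sub>R v) + x))) \<partial>lborel) =
      (\<integral>\<^sup>+x. ennreal (exp (- \<kappa> * norm x)) \<partial>distr lborel borel ((+) (- (x0 + t *\<^sub>R v))))"
    by (subst nn_integral_distr) auto
  also have "\<dots> = ennreal I" by (simp only: lborel_distr_plus I)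
  also have "ennreal D * ennreal I = ennreal (C\<^sup>2 * exp (l * (1 + norm x0)) * I * exp (- c * t))"
  proof -
    have "ennreal D * ennreal I = ennreal (D * I)"
      by (rule ennreal_mult[symmetric]) (simp_all add: D_def I_def integral_nonneg)
    then show ?thesis by (simp add: D_def mult_ac)
  qed
  finally show "front_mass \<beta> t (f t) \<le>
      ennreal (C\<^sup>2 * exp (min 1 \<kappa> * (1 + norm x0)) * (LINT x|lborel. exp (- \<kappa> * norm (x :: real ^ 'n))) * exp (- c * t))"
    by (simp add: l_def I_def)
qed

text \<open>The norm is defined by a choice of weak derivatives, each of which bounds the classical
  derivative.\<close>

lemma sobolev_norm_bounds_partials:
  fixes w :: "real ^ 'n::finite \<Rightarrow> complex"
  assumes w: "smooth w" "w \<in> sobolev k" and xs: "length xs \<le> k"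
  shows "energy (foldr partial xs w) \<le> ennreal ((sobolev_norm k w)\<^sup>2)"
proof -
  define s :: "nat ^ 'n" where "s = (\<chi> i. count (mset xs) i)"
  have s: "foldr partial xs w = multi_partial s w" "order_of s = length xs"
    unfolding s_def by (rule partials_eq_multi_partial[OF w(1)])+
  have "order_of s \<le> k" using xs s(2) by simp
  then have "\<exists>g. g \<in> L2 \<and> has_weak_deriv s w g" using w(2) unfolding sobolev_def by blast
  then have g: "weak_deriv s w \<in> L2 \<and> has_weak_deriv s w (weak_deriv s w)"
    unfolding weak_deriv_def by (rule someI_ex)
  have "energy (foldr partial xs w) \<le>
      ennreal (LINT x|lborel. (cmod (weak_deriv s w x))\<^sup>2)"
    unfolding s(1) using g by (intro weak_derivative_bounds_classical w(1)) auto
  also have "\<dots> \<le> ennreal (\<Sum>s | order_of s \<le> k. LINT x|lborel. (cmod (weak_deriv s w x))\<^sup>2)"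
    by (intro ennreal_leI member_le_sum) (use s xs in \<open>auto intro: finite_order_le\<close>)
  also have "(\<Sum>s | order_of s \<le> k. LINT x|lborel. (cmod (weak_deriv s w x))\<^sup>2) = (sobolev_norm k w)\<^sup>2"
    unfolding sobolev_norm_def by (subst real_sqrt_pow2) (auto intro!: sum_nonneg)
  finally show ?thesis .
qed

lemma partials_sum:
  assumes "finite J" "\<And>j. j \<in> J \<Longrightarrow> smooth (f j)"
  shows "foldr partial xs (\<lambda>x. \<Sum>j\<in>J. f j x) = (\<lambda>x. \<Sum>j\<in>J. foldr partial xs (f j) x)"
  using assms
proof (induction J rule: finite_induct)
  case empty
  then show ?case by (induction xs) (auto simp: partial_const)
next
  case (insert j J)
  then show ?case by (simp add: partials_add smooth_sum)
qed

text \<open>The remainder \<open>w\<close> is exponentially small in every Sobolev norm, and the solitons stay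
  behind the front.\<close>

theorem multi_soliton_in_front:
  fixes Q :: "real \<Rightarrow> real ^ 'n::finite \<Rightarrow> real" and u :: "real \<Rightarrow> real ^ 'n \<Rightarrow> complex"
  assumes omega_pos: "\<And>j. j \<in> {1..N} \<Longrightarrow> \<omega> j > 0"
    and Q: "\<And>j. j \<in> {1..N} \<Longrightarrow> smooth (Q (\<omega> j))"
    and Q_decay: "\<And>j \<sigma>. j \<in> {1..N} \<Longrightarrow>
      \<exists>C>0. \<forall>x. \<bar>multi_partial \<sigma> (Q (\<omega> j)) x\<bar> \<le> C * exp (- sqrt (\<omega> j) * norm x)"
    and T0: "T\<^sub>0 \<ge> 0"
    and u: "multi_soliton p Q N \<omega> v \<gamma> x0 T\<^sub>0 u"
    and \<beta>: "\<And>j. j \<in> {1..N} \<Longrightarrow> norm (v j) < \<beta>"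
  obtains c where "c > 0" "\<And>xs. \<exists>M. \<forall>t\<ge>T\<^sub>0. \<forall>x. cmod (foldr partial xs (u t) x) \<le> M"
    "\<And>xs. decays_in_front \<beta> c T\<^sub>0 (\<lambda>t. foldr partial xs (u t))"
proof -
  define R where "R j t = soliton (Q (\<omega> j)) (\<omega> j) (v j) (\<gamma> j) (x0 j) t" for j t
  define w where "w t x = u t x - (\<Sum>j = 1..N. R j t x)" for t x
  have su: "smooth (u t)" if "t \<ge> T\<^sub>0" for t
    using u that by (simp add: multi_soliton_def nls_solution_def)
  have sR: "smooth (R j t)" if "j \<in> {1..N}" for j t
    unfolding R_def by (rule smooth_soliton[OF Q[OF that]])
  have sSR: "smooth (\<lambda>x. \<Sum>j = 1..N. R j t x)" for t
    by (rule smooth_sum) (auto intro: sR)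
  have w_eq: "w t = (\<lambda>x. u t x + (- 1) * (\<Sum>j = 1..N. R j t x))" for t
    by (simp add: w_def fun_eq_iff)
  have sw: "smooth (w t)" if "t \<ge> T\<^sub>0" for t
    unfolding w_eq by (intro smooth_add smooth_mult smooth_const su that sSR)
  obtain \<theta> \<Lambda> where \<theta>: "\<theta> > 0" and \<Lambda>: "\<And>k. \<Lambda> k > 0"
    "\<And>k t. t \<ge> T\<^sub>0 \<Longrightarrow> w t \<in> sobolev k" "\<And>k t. t \<ge> T\<^sub>0 \<Longrightarrow> sobolev_norm k (w t) \<le> \<Lambda> k * exp (- \<theta> * t)"
    using u unfolding multi_soliton_def Let_def R_def[symmetric] w_def[symmetric] by metis
  have wL2: "energy (foldr partial xs (w t)) \<le>
      ennreal ((\<Lambda> (length xs))\<^sup>2 * exp (- (2 * \<theta>) * t))" if t: "t \<ge> T\<^sub>0" for xs t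
  proof -
    have "0 \<le> sobolev_norm (length xs) (w t)" by (simp add: sobolev_norm_def sum_nonneg)
    then have "(sobolev_norm (length xs) (w t))\<^sup>2 \<le> (\<Lambda> (length xs) * exp (- \<theta> * t))\<^sup>2"
      using \<Lambda>(3)[OF t] by (intro power_mono) auto
    also have "\<dots> = (\<Lambda> (length xs))\<^sup>2 * exp (- (2 * \<theta>) * t)"
      by (simp add: power_mult_distrib exp_double[symmetric] flip: exp_of_nat_mult)
    finally show ?thesis
      by (intro order_trans[OF sobolev_norm_bounds_partials[OF sw[OF t] \<Lambda>(2)[OF t] order_refl]] ennreal_leI)
  qed
  have "\<forall>j\<in>{1..N}. \<forall>xs. \<exists>C. \<forall>t x. cmod (foldr partial xs (R j t) x) \<le>
      C * exp (- sqrt (\<omega> j) * norm (x - (x0 j + t *\<^sub>R v j)))"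
    unfolding R_def by (intro ballI allI soliton_bound Q Q_decay)
  then obtain CR where CR: "\<And>j xs t x. j \<in> {1..N} \<Longrightarrow>
      cmod (foldr partial xs (R j t) x) \<le> CR j xs * exp (- sqrt (\<omega> j) * norm (x - (x0 j + t *\<^sub>R v j)))"
    by metis
  have u_split: "foldr partial xs (u t) = (\<lambda>x. foldr partial xs (w t) x + (\<Sum>j = 1..N. foldr partial xs (R j t) x))"
    if t: "t \<ge> T\<^sub>0" for xs t
  proof -
    have "u t = (\<lambda>x. w t x + (\<Sum>j = 1..N. R j t x))" by (simp add: w_def fun_eq_iff)
    then have "foldr partial xs (u t) = foldr partial xs (\<lambda>x. w t x + (\<Sum>j = 1..N. R j t x))" by simp
    then show ?thesis
      unfolding partials_add[OF sw[OF t] sSR]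
      using partials_sum[of "{1..N}" "\<lambda>j. R j t" xs] sR by simp
  qed
  define A where "A = insert (2 * \<theta>) ((\<lambda>j. min 1 (sqrt (\<omega> j)) * (\<beta> - norm (v j))) ` {1..N})"
  define c where "c = Min A"
  have A: "finite A" "A \<noteq> {}" by (auto simp: A_def)
  have "\<forall>a\<in>A. 0 < a" using \<theta> omega_pos \<beta> by (auto simp: A_def)
  then have c: "c > 0" unfolding c_def using A by simp
  have c\<theta>: "c \<le> 2 * \<theta>" and cj: "j \<in> {1..N} \<Longrightarrow> c \<le> min 1 (sqrt (\<omega> j)) * (\<beta> - norm (v j))" for j
    unfolding c_def by (rule Min_le[OF A(1)], simp add: A_def)+
  have bounded: "\<exists>M. \<forall>t\<ge>T\<^sub>0. \<forall>x. cmod (foldr partial xs (u t) x) \<le> M" for xs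
  proof -
    have "\<exists>M. \<forall>F\<in>w ` {T\<^sub>0..}. \<forall>x. cmod (foldr partial xs F x) \<le> M"
    proof (rule sobolev_bounded)
      show "smooth F" if "F \<in> w ` {T\<^sub>0..}" for F using that sw by auto
      have "energy (foldr partial ys (w t)) \<le> ennreal ((\<Lambda> (length ys))\<^sup>2)"
        if t: "t \<ge> T\<^sub>0" for t ys
      proof (rule order_trans[OF wL2[OF t]], rule ennreal_leI)
        have "exp (- (2 * \<theta>) * t) \<le> 1" using \<theta> T0 t by simp
        then show "(\<Lambda> (length ys))\<^sup>2 * exp (- (2 * \<theta>) * t) \<le> (\<Lambda> (length ys))\<^sup>2"
          by (intro mult_left_le) auto
      qed
      then show "\<exists>C. \<forall>F\<in>w ` {T\<^sub>0..}. energy (foldr partial ys F) \<le> ennreal C" for ys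
        by auto
    qed
    then obtain M where M: "\<And>t x. t \<ge> T\<^sub>0 \<Longrightarrow> cmod (foldr partial xs (w t) x) \<le> M" by auto
    have "cmod (foldr partial xs (u t) x) \<le> M + (\<Sum>j = 1..N. \<bar>CR j xs\<bar>)" if t: "t \<ge> T\<^sub>0" for t x
      unfolding u_split[OF t]
    proof (intro norm_triangle_le add_mono M[OF t] sum_norm_le)
      fix j assume j: "j \<in> {1..N}"
      have "CR j xs * exp (- sqrt (\<omega> j) * norm (x - (x0 j + t *\<^sub>R v j))) \<le> \<bar>CR j xs\<bar> * 1"
        using omega_pos[OF j] by (intro mult_mono) auto
      with CR[OF j, of xs t x] show "cmod (foldr partial xs (R j t) x) \<le> \<bar>CR j xs\<bar>" by simp
    qed
    then show ?thesis by blast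
  qed
  have decays: "decays_in_front \<beta> c T\<^sub>0 (\<lambda>t. foldr partial xs (u t))" for xs
  proof -
    have 1: "decays_in_front \<beta> c T\<^sub>0 (\<lambda>t. foldr partial xs (w t))"
      unfolding decays_in_front_def
    proof (intro exI allI impI)
      fix t assume t: "t \<ge> T\<^sub>0"
      have "front_mass \<beta> t (foldr partial xs (w t)) \<le>
          energy (foldr partial xs (w t))"
        by (intro nn_integral_mono ennreal_leI mult_left_le logistic_le_1) simp
      also have "\<dots> \<le> ennreal ((\<Lambda> (length xs))\<^sup>2 * exp (- (2 * \<theta>) * t))" by (rule wL2[OF t])
      also have "\<dots> \<le> ennreal ((\<Lambda> (length xs))\<^sup>2 * exp (- c * t))"
        using mult_right_mono[OF c\<theta>, of t] t T0 by (intro ennreal_leI mult_left_mono) auto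
      finally show "front_mass \<beta> t (foldr partial xs (w t)) \<le>
          ennreal ((\<Lambda> (length xs))\<^sup>2 * exp (- c * t))" .
    qed
    have 2: "decays_in_front \<beta> c T\<^sub>0 (\<lambda>t x. \<Sum>j = 1..N. foldr partial xs (R j t) x)"
    proof (rule decays_in_front_sum)
      fix j assume j: "j \<in> {1..N}"
      show "decays_in_front \<beta> c T\<^sub>0 (\<lambda>t. foldr partial xs (R j t))"
        by (rule travelling_wave_decays_in_front[OF CR[OF j] _ cj[OF j] T0]) (use omega_pos[OF j] in simp)
      show "foldr partial xs (R j t) \<in> borel_measurable borel" for t
        by (rule smooth_measurable[OF smooth_partials[OF sR[OF j]]])
    qed simp
    have "decays_in_front \<beta> c T\<^sub>0 (\<lambda>t x. foldr partial xs (w t) x + (\<Sum>j = 1..N. foldr partial xs (R j t) x))"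
    proof (rule decays_in_front_add[OF 1 _ 2])
      show "foldr partial xs (w t) \<in> borel_measurable borel" if "t \<ge> T\<^sub>0" for t
        by (rule smooth_measurable[OF smooth_partials[OF sw[OF that]]])
      show "(\<lambda>x. \<Sum>j = 1..N. foldr partial xs (R j t) x) \<in> borel_measurable borel" for t
        by (intro borel_measurable_sum smooth_measurable smooth_partials sR)
    qed
    then show ?thesis by (simp add: decays_in_front_def u_split)
  qed
  show thesis by (rule that[OF c bounded decays])
qed

section \<open>Weighted masses and interpolation\<close>

definition weighted_mass ::
  "real \<Rightarrow> real \<Rightarrow> nat \<Rightarrow> real \<Rightarrow> real \<Rightarrow> (real ^ 'n::finite \<Rightarrow> complex) \<Rightarrow> real" where
  "weighted_mass \<beta> a m \<epsilon> t f = (LINT x|lborel. (cmod (f x))\<^sup>2 * weight a m \<epsilon> (front \<beta> t x))"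

text \<open>The bound is uniform in \<open>\<epsilon>\<close>. The power \<open>m\<close> of the regularisation has to exceed a threshold that
  depends on \<open>a\<close> and \<open>f\<close>. Leaving the threshold open allows several exponents and functions to be
  treated with a common \<open>m\<close>.\<close>

abbreviation mass_decays ::
  "real \<Rightarrow> real \<Rightarrow> real \<Rightarrow> real \<Rightarrow> nat \<Rightarrow> (real \<Rightarrow> real ^ 'n::finite \<Rightarrow> complex) \<Rightarrow> real \<Rightarrow> bool" where
  "mass_decays \<beta> c T a m f C \<equiv> \<forall>t\<ge>T. \<forall>\<epsilon>. 0 < \<epsilon> \<longrightarrow> \<epsilon> \<le> 1 \<longrightarrow>
     weighted_mass \<beta> a m \<epsilon> t (f t) \<le> C * exp (- c * t)"

definition decays_at_order ::
  "real \<Rightarrow> real \<Rightarrow> real \<Rightarrow> real \<Rightarrow> (real \<Rightarrow> real ^ 'n::finite \<Rightarrow> complex) \<Rightarrow> bool" where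
  "decays_at_order \<beta> c T a f \<longleftrightarrow> (\<exists>m\<^sub>0. \<forall>m\<ge>m\<^sub>0. \<exists>C\<ge>0. mass_decays \<beta> c T a m f C)"

lemma integrable_weight_bound:
  fixes g :: "real ^ 'n::finite \<Rightarrow> real" and a :: real
  assumes g: "continuous_on UNIV g" "\<And>x. \<bar>g x\<bar> \<le> B * weight a m \<epsilon> (front \<beta> t x)"
    and \<epsilon>: "0 < \<epsilon>" "\<epsilon> \<le> 1" and \<beta>: "0 \<le> \<beta>" and t: "0 \<le> t"
    and m: "\<bar>a\<bar> + 2 * CARD('n) \<le> m"
  shows "integrable lborel g"
proof -
  let ?D = "((1 + \<beta> * t) / \<epsilon>) ^ m"
  have "integrable lborel (\<lambda>x :: real ^ 'n. (\<bar>B\<bar> * ?D) * (1 / (1 + norm x) ^ (2 * CARD('n))))"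
    by (rule integrable_mult_right) (rule integrable_inverse_power)
  then show ?thesis
  proof (rule Bochner_Integration.integrable_bound)
    show "g \<in> borel_measurable lborel" using borel_measurable_continuous_onI[OF g(1)] by simp
    have "norm (g x) \<le> norm ((\<bar>B\<bar> * ?D) * (1 / (1 + norm x) ^ (2 * CARD('n))))" for x
    proof -
      have "\<bar>g x\<bar> \<le> \<bar>B\<bar> * weight a m \<epsilon> (front \<beta> t x)"
        by (rule order_trans[OF g(2)]) (use weight_nonneg[of \<epsilon> a m "front \<beta> t x"] \<epsilon> in \<open>auto intro!: mult_right_mono\<close>)
      also have "\<dots> \<le> \<bar>B\<bar> * (?D / (1 + norm x) ^ (2 * CARD('n)))"
        using m by (intro mult_left_mono weight_le_inverse_power \<epsilon> \<beta> t) auto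
      finally have "\<bar>g x\<bar> \<le> (\<bar>B\<bar> * ?D) * (1 / (1 + norm x) ^ (2 * CARD('n)))" by simp
      then show ?thesis unfolding real_norm_def by (rule order_trans) (rule abs_ge_self)
    qed
    then show "AE x in lborel. norm (g x) \<le> norm ((\<bar>B\<bar> * ?D) * (1 / (1 + norm x) ^ (2 * CARD('n))))"
      by simp
  qed
qed

lemma integrable_times_weight:
  fixes g :: "real ^ 'n::finite \<Rightarrow> real" and a :: real
  assumes g: "continuous_on UNIV g" "\<And>x. \<bar>g x\<bar> \<le> B"
    and \<epsilon>: "0 < \<epsilon>" "\<epsilon> \<le> 1" and \<beta>: "0 \<le> \<beta>" and t: "0 \<le> t"
    and m: "\<bar>a\<bar> + 2 * CARD('n) \<le> m"
  shows "integrable lborel (\<lambda>x. g x * weight a m \<epsilon> (front \<beta> t x))"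
proof (rule integrable_weight_bound[OF _ _ \<epsilon> \<beta> t m])
  show "continuous_on UNIV (\<lambda>x. g x * weight a m \<epsilon> (front \<beta> t x))"
    using \<epsilon> by (intro continuous_intros g) auto
  show "\<bar>g x * weight a m \<epsilon> (front \<beta> t x)\<bar> \<le> B * weight a m \<epsilon> (front \<beta> t x)" for x
    unfolding abs_mult using weight_nonneg[of \<epsilon> a m "front \<beta> t x"] g(2)[of x] \<epsilon> by (auto intro!: mult_right_mono)
qed

lemma weight_line_derivative:
  assumes "0 \<le> \<epsilon>"
  shows "((\<lambda>h. weight a m \<epsilon> (front \<beta> t (x + h *\<^sub>R axis i 1))) has_vector_derivative
    weight_deriv a m \<epsilon> (front \<beta> t x) * (x $ i / sqrt (1 + x \<bullet> x))) (at 0)"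
  using DERIV_chain2[OF DERIV_weight[OF assms, of a m "front \<beta> t (x + 0 *\<^sub>R axis i 1)"] front_line_derivative[of \<beta> t x i]]
  by (simp add: has_real_derivative_iff_has_vector_derivative)

lemma weight_slope_bound:
  fixes x :: "real ^ 'n::finite"
  assumes "0 \<le> \<epsilon>" "\<epsilon> \<le> 1"
  shows "\<bar>weight_deriv a m \<epsilon> (front \<beta> t x) * (x $ i / sqrt (1 + x \<bullet> x))\<bar> \<le>
    (\<bar>a\<bar> + real m + 1) * weight (a - 1) m \<epsilon> (front \<beta> t x)"
proof -
  have "\<bar>weight_deriv a m \<epsilon> (front \<beta> t x) * (x $ i / sqrt (1 + x \<bullet> x))\<bar> \<le> \<bar>weight_deriv a m \<epsilon> (front \<beta> t x)\<bar>"
    unfolding abs_mult by (rule mult_left_le[OF front_slope_le_1]) simp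
  also note weight_deriv_bound[OF assms]
  finally show ?thesis .
qed

lemma continuous_on_slope: "continuous_on UNIV (\<lambda>x :: real ^ 'n::finite. x $ i / sqrt (1 + x \<bullet> x))"
proof -
  have "sqrt (1 + x \<bullet> x) \<noteq> 0" for x :: "real ^ 'n" using norm_le_sqrt(2)[of x] by linarith
  then show ?thesis by (intro continuous_intros) auto
qed

lemma integral_line_derivative_times_weight:
  fixes g :: "real ^ 'n::finite \<Rightarrow> real" and a :: real
  assumes g: "\<And>x. ((\<lambda>h. g (x + h *\<^sub>R axis i 1)) has_vector_derivative g' x) (at 0)"
    and c: "continuous_on UNIV g" "continuous_on UNIV g'"
    and B: "\<And>x. \<bar>g x\<bar> \<le> B" "\<And>x. \<bar>g' x\<bar> \<le> B'"
    and \<epsilon>: "0 < \<epsilon>" "\<epsilon> \<le> 1" and \<beta>: "0 \<le> \<beta>" and t: "0 \<le> t"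
    and m: "\<bar>a\<bar> + 1 + 2 * CARD('n) \<le> m"
  defines "V \<equiv> \<lambda>x :: real ^ 'n. weight_deriv a m \<epsilon> (front \<beta> t x) * (x $ i / sqrt (1 + x \<bullet> x))"
  shows "integrable lborel (\<lambda>x. g x * V x)"
    and "(LINT x|lborel. g' x * weight a m \<epsilon> (front \<beta> t x)) = - (LINT x|lborel. g x * V x)"
proof -
  let ?W = "\<lambda>x. weight a m \<epsilon> (front \<beta> t x)"
  have cV: "continuous_on UNIV V"
    unfolding V_def using \<epsilon> by (intro continuous_on_mult continuous_on_slope continuous_intros) auto
  show iV: "integrable lborel (\<lambda>x. g x * V x)"
  proof (rule integrable_weight_bound[where a = "a - 1" and B = "B * (\<bar>a\<bar> + real m + 1)", OF _ _ \<epsilon> \<beta> t])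
    show "continuous_on UNIV (\<lambda>x. g x * V x)" by (intro continuous_intros c cV)
    show "\<bar>g x * V x\<bar> \<le> B * (\<bar>a\<bar> + real m + 1) * weight (a - 1) m \<epsilon> (front \<beta> t x)" for x
    proof -
      have "\<bar>g x\<bar> * \<bar>V x\<bar> \<le> B * ((\<bar>a\<bar> + real m + 1) * weight (a - 1) m \<epsilon> (front \<beta> t x))"
        unfolding V_def using \<epsilon> by (intro mult_mono B weight_slope_bound order_trans[OF abs_ge_zero B(1)]) auto
      then show ?thesis by (simp add: abs_mult mult.assoc)
    qed
    show "\<bar>a - 1\<bar> + real (2 * CARD('n)) \<le> real m" using m by simp
  qed
  have m': "\<bar>a\<bar> + 2 * CARD('n) \<le> m" using m by simp
  have iW: "integrable lborel (\<lambda>x. g' x * ?W x)" "integrable lborel (\<lambda>x. g x * ?W x)"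
    by (rule integrable_times_weight[OF c(2) B(2) \<epsilon> \<beta> t m'] integrable_times_weight[OF c(1) B(1) \<epsilon> \<beta> t m'])+
  have "(LINT x|lborel. g x * V x + g' x * ?W x) = 0"
  proof (rule integral_directional_derivative_eq_0)
    show "((\<lambda>h. g (x + h *\<^sub>R axis i 1) * ?W (x + h *\<^sub>R axis i 1)) has_vector_derivative g x * V x + g' x * ?W x) (at 0)" for x
      using bounded_bilinear.has_vector_derivative[OF bounded_bilinear_mult g weight_line_derivative[of \<epsilon> a m \<beta> t x i]] \<epsilon>
      by (simp add: V_def)
    show "continuous_on UNIV (\<lambda>x. g x * V x + g' x * ?W x)"
      using \<epsilon> by (intro continuous_intros c cV) auto
  qed (use iV iW in auto)
  then show "(LINT x|lborel. g' x * ?W x) = - (LINT x|lborel. g x * V x)"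
    using iV iW by simp
qed

lemma integrable_weighted_mass:
  fixes f :: "real ^ 'n::finite \<Rightarrow> complex" and a :: real
  assumes f: "continuous_on UNIV f" "\<And>x. cmod (f x) \<le> B"
    and \<epsilon>: "0 < \<epsilon>" "\<epsilon> \<le> 1" and \<beta>: "0 \<le> \<beta>" and t: "0 \<le> t"
    and m: "\<bar>a\<bar> + 2 * CARD('n) \<le> m"
  shows "integrable lborel (\<lambda>x. (cmod (f x))\<^sup>2 * weight a m \<epsilon> (front \<beta> t x))"
proof (rule integrable_times_weight[OF _ _ \<epsilon> \<beta> t m])
  show "continuous_on UNIV (\<lambda>x. (cmod (f x))\<^sup>2)" by (intro continuous_intros f)
  show "\<bar>(cmod (f x))\<^sup>2\<bar> \<le> B\<^sup>2" for x using f(2)[of x] by (auto intro!: power_mono)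
qed

lemma weighted_mass_nonneg: "0 \<le> \<epsilon> \<Longrightarrow> 0 \<le> weighted_mass \<beta> a m \<epsilon> t f"
  unfolding weighted_mass_def by (intro integral_nonneg_AE AE_I2 mult_nonneg_nonneg weight_nonneg) auto

text \<open>Integrate \<open>|\<partial>\<^sub>i g|\<^sup>2\<close> by parts against the weight. The term with \<open>g\<close> and \<open>\<partial>\<^sub>i\<^sup>2 g\<close> is split by
  \<open>weight_young\<close>. In the term with the derivative of the weight, that derivative is bounded by the
  weight itself, and half of \<open>|\<partial>\<^sub>i g|\<^sup>2\<close> is absorbed on the left.\<close>

lemma weighted_interpolation_step:
  fixes g :: "real ^ 'n::finite \<Rightarrow> complex" and b :: real
  assumes g: "smooth g"
    and B: "\<And>x. cmod (g x) \<le> B" "\<And>x. cmod (partial i g x) \<le> B1" "\<And>x. cmod (partial i (partial i g) x) \<le> B2"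
    and \<delta>: "0 < \<delta>" and \<epsilon>: "0 < \<epsilon>" "\<epsilon> \<le> 1" and \<beta>: "0 \<le> \<beta>" and t: "0 \<le> t"
    and m: "\<bar>b\<bar> + 1 + 2 * CARD('n) \<le> m"
  shows "weighted_mass \<beta> b m \<epsilon> t (partial i g) \<le>
    \<delta> * weighted_mass \<beta> (b - 1) m \<epsilon> t (partial i (partial i g)) +
    (1 / \<delta> + (\<bar>b\<bar> + real m + 1)\<^sup>2) * weighted_mass \<beta> (b + 1) m \<epsilon> t g"
proof -
  define K where "K = \<bar>b\<bar> + real m + 1"
  let ?g1 = "partial i g" and ?g2 = "partial i (partial i g)"
  let ?W = "\<lambda>a x. weight a m \<epsilon> (front \<beta> t x)"
  let ?V = "\<lambda>x :: real ^ 'n. weight_deriv b m \<epsilon> (front \<beta> t x) * (x $ i / sqrt (1 + x \<bullet> x))"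
  have s: "smooth ?g1" "smooth ?g2" by (intro smooth_partial g)+
  note c = smooth_continuous[OF g, of UNIV] smooth_continuous[OF s(1), of UNIV] smooth_continuous[OF s(2), of UNIV]
  have B0: "0 \<le> B" "0 \<le> B1" by (rule order_trans[OF norm_ge_zero B(1)], rule order_trans[OF norm_ge_zero B(2)])
  have prod_bound: "\<bar>x \<bullet> y\<bar> \<le> C * D" if "cmod x \<le> C" "cmod y \<le> D" for x y C D
    by (rule order_trans[OF Cauchy_Schwarz_ineq2 mult_mono[OF that order_trans[OF norm_ge_zero that(1)] norm_ge_zero]])
  have d: "((\<lambda>h. g (x + h *\<^sub>R axis i 1) \<bullet> ?g1 (x + h *\<^sub>R axis i 1)) has_vector_derivative
      g x \<bullet> ?g2 x + ?g1 x \<bullet> ?g1 x) (at 0)" for x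
    using bounded_bilinear.has_vector_derivative[OF bounded_bilinear_inner
        has_vector_derivative_partial_0[OF smooth_differentiable[OF g]]
        has_vector_derivative_partial_0[OF smooth_differentiable[OF s(1)]]] by simp
  have cc: "continuous_on UNIV (\<lambda>x. g x \<bullet> ?g1 x)" "continuous_on UNIV (\<lambda>x. g x \<bullet> ?g2 x + ?g1 x \<bullet> ?g1 x)"
    by (intro continuous_intros c)+
  have bb: "\<bar>g x \<bullet> ?g1 x\<bar> \<le> B * B1" "\<bar>g x \<bullet> ?g2 x + ?g1 x \<bullet> ?g1 x\<bar> \<le> B * B2 + B1 * B1" for x
    by (intro prod_bound B, intro order_trans[OF abs_triangle_ineq] add_mono prod_bound B)
  note iV = integral_line_derivative_times_weight(1)[OF d cc bb \<epsilon> \<beta> t m]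
  have "(LINT x|lborel. (g x \<bullet> ?g2 x + ?g1 x \<bullet> ?g1 x) * ?W b x) = - (LINT x|lborel. (g x \<bullet> ?g1 x) * ?V x)"
    by (rule integral_line_derivative_times_weight(2)[OF d cc bb \<epsilon> \<beta> t m])
  then have parts: "(LINT x|lborel. (g x \<bullet> ?g2 x) * ?W b x + (cmod (?g1 x))\<^sup>2 * ?W b x) =
      (LINT x|lborel. - ((g x \<bullet> ?g1 x) * ?V x))"
    using iV by (simp add: distrib_right power2_norm_eq_inner)
  have mm: "\<bar>b\<bar> + 2 * CARD('n) \<le> m" "\<bar>b + 1\<bar> + 2 * CARD('n) \<le> m" "\<bar>b - 1\<bar> + 2 * CARD('n) \<le> m"
    using m by auto
  have i0: "integrable lborel (\<lambda>x. (g x \<bullet> ?g2 x) * ?W b x)"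
    by (rule integrable_times_weight[where B = "B * B2", OF _ _ \<epsilon> \<beta> t mm(1)]) (intro continuous_intros c prod_bound B)+
  note i1 = integrable_weighted_mass[OF c(2) B(2) \<epsilon> \<beta> t mm(1)]
    and ip = integrable_weighted_mass[OF c(1) B(1) \<epsilon> \<beta> t mm(2)]
    and im = integrable_weighted_mass[OF c(3) B(3) \<epsilon> \<beta> t mm(3)]
  have "weighted_mass \<beta> b m \<epsilon> t ?g1 = (LINT x|lborel. - ((g x \<bullet> ?g1 x) * ?V x) - (g x \<bullet> ?g2 x) * ?W b x)"
    using parts i0 i1 iV by (simp add: weighted_mass_def)
  also have "\<dots> \<le> (LINT x|lborel. (\<delta> / 2) * ((cmod (?g2 x))\<^sup>2 * ?W (b - 1) x) +
      (1 / (2 * \<delta>) + K\<^sup>2 / 2) * ((cmod (g x))\<^sup>2 * ?W (b + 1) x) + (1 / 2) * ((cmod (?g1 x))\<^sup>2 * ?W b x))"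
  proof (rule integral_mono)
    fix x :: "real ^ 'n"
    have W: "0 \<le> ?W b x" "?W (b - 1) x \<le> ?W b x" "?W b x \<le> ?W (b + 1) x"
      using \<epsilon> by (auto intro: weight_nonneg weight_mono)
    have "- ((g x \<bullet> ?g2 x) * ?W b x) \<le> \<bar>g x \<bullet> ?g2 x\<bar> * ?W b x"
      using mult_right_mono[OF abs_ge_minus_self[of "g x \<bullet> ?g2 x"] W(1)] by simp
    also have "\<dots> \<le> (cmod (g x) * cmod (?g2 x)) * ?W b x"
      by (rule mult_right_mono[OF Cauchy_Schwarz_ineq2 W(1)])
    also have "\<dots> \<le> (\<delta> / 2) * ((cmod (?g2 x))\<^sup>2 * ?W (b - 1) x) + (1 / (2 * \<delta>)) * ((cmod (g x))\<^sup>2 * ?W (b + 1) x)"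
      using weight_young[of "\<delta> / 2" \<epsilon> b m "front \<beta> t x" "cmod (g x)" "cmod (?g2 x)"] \<delta> \<epsilon> by (simp add: mult_ac)
    finally have 1: "- ((g x \<bullet> ?g2 x) * ?W b x) \<le> (\<delta> / 2) * ((cmod (?g2 x))\<^sup>2 * ?W (b - 1) x) +
        (1 / (2 * \<delta>)) * ((cmod (g x))\<^sup>2 * ?W (b + 1) x)" .
    have "- ((g x \<bullet> ?g1 x) * ?V x) \<le> \<bar>g x \<bullet> ?g1 x\<bar> * \<bar>?V x\<bar>"
      unfolding abs_mult[symmetric] by (rule abs_ge_minus_self)
    also have "\<dots> \<le> (cmod (g x) * cmod (?g1 x)) * (K * ?W b x)"
    proof (rule mult_mono[OF Cauchy_Schwarz_ineq2])
      have "\<bar>?V x\<bar> \<le> K * ?W (b - 1) x" unfolding K_def using \<epsilon> by (intro weight_slope_bound) auto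
      also have "\<dots> \<le> K * ?W b x" using W(2) by (intro mult_left_mono) (auto simp: K_def)
      finally show "\<bar>?V x\<bar> \<le> K * ?W b x" .
    qed auto
    also have "\<dots> = (K * cmod (g x) * cmod (?g1 x)) * ?W b x" by (simp add: mult_ac)
    also have "\<dots> \<le> (((K * cmod (g x))\<^sup>2 + (cmod (?g1 x))\<^sup>2) / 2) * ?W b x"
      using sum_squares_bound[of "K * cmod (g x)" "cmod (?g1 x)"] by (intro mult_right_mono W(1)) simp
    also have "\<dots> = (K\<^sup>2 / 2) * ((cmod (g x))\<^sup>2 * ?W b x) + (1 / 2) * ((cmod (?g1 x))\<^sup>2 * ?W b x)"
      by (simp add: power_mult_distrib field_simps)
    also have "\<dots> \<le> (K\<^sup>2 / 2) * ((cmod (g x))\<^sup>2 * ?W (b + 1) x) + (1 / 2) * ((cmod (?g1 x))\<^sup>2 * ?W b x)"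
      using W(3) by (intro add_right_mono mult_left_mono) auto
    finally show "- ((g x \<bullet> ?g1 x) * ?V x) - (g x \<bullet> ?g2 x) * ?W b x \<le>
      (\<delta> / 2) * ((cmod (?g2 x))\<^sup>2 * ?W (b - 1) x) +
      (1 / (2 * \<delta>) + K\<^sup>2 / 2) * ((cmod (g x))\<^sup>2 * ?W (b + 1) x) + (1 / 2) * ((cmod (?g1 x))\<^sup>2 * ?W b x)"
      using 1 unfolding distrib_right[of "1 / (2 * \<delta>)"] by linarith
  qed (use i0 i1 ip im iV in \<open>auto intro!: Bochner_Integration.integrable_add Bochner_Integration.integrable_diff integrable_minus\<close>)
  also have "\<dots> = (\<delta> / 2) * weighted_mass \<beta> (b - 1) m \<epsilon> t ?g2 +
      (1 / (2 * \<delta>) + K\<^sup>2 / 2) * weighted_mass \<beta> (b + 1) m \<epsilon> t g + (1 / 2) * weighted_mass \<beta> b m \<epsilon> t ?g1"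
    using i1 ip im by (simp add: weighted_mass_def)
  finally show ?thesis using \<delta> unfolding K_def by (simp add: field_simps)
qed

text \<open>The step is an additive form of logarithmic convexity of \<open>X\<close>. Since \<open>\<delta>\<close> is arbitrary, the
  intermediate terms can be absorbed one after the other, which leaves only the two ends.\<close>

lemma interpolation_chain:
  fixes X :: "nat \<Rightarrow> 'p \<Rightarrow> real"
  assumes nonneg: "\<And>j p. p \<in> A \<Longrightarrow> 0 \<le> X j p"
    and step: "\<And>j \<delta>. j < k \<Longrightarrow> 0 < \<delta> \<Longrightarrow> \<exists>C\<ge>0. \<forall>p\<in>A. X (Suc j) p \<le> \<delta> * X (Suc (Suc j)) p + C * X j p"
  shows "\<exists>C\<ge>0. \<forall>p\<in>A. X 1 p \<le> X (Suc k) p + C * X 0 p"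
proof -
  have to_0: "\<exists>C\<ge>0. \<forall>p\<in>A. X (Suc j) p \<le> \<delta> * X (Suc (Suc j)) p + C * X 0 p" if "j < k" "0 < \<delta>" for j \<delta>
    using that
  proof (induction j arbitrary: \<delta>)
    case 0
    then show ?case by (intro step)
  next
    case (Suc j)
    obtain C where C: "C \<ge> 0" "\<forall>p\<in>A. X (Suc (Suc j)) p \<le> (\<delta> / 2) * X (Suc (Suc (Suc j))) p + C * X (Suc j) p"
      using step[of "Suc j" "\<delta> / 2"] Suc.prems by auto
    obtain D where D: "D \<ge> 0" "\<forall>p\<in>A. X (Suc j) p \<le> (1 / (2 * (C + 1))) * X (Suc (Suc j)) p + D * X 0 p"
      using Suc.IH[of "1 / (2 * (C + 1))"] Suc.prems C(1) by auto
    have "X (Suc (Suc j)) p \<le> \<delta> * X (Suc (Suc (Suc j))) p + (2 * C * D) * X 0 p" if p: "p \<in> A" for p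
    proof -
      have "C * X (Suc j) p \<le> C * ((1 / (2 * (C + 1))) * X (Suc (Suc j)) p + D * X 0 p)"
        using C(1) D(2) p by (intro mult_left_mono) auto
      moreover have "C * (1 / (2 * (C + 1))) * X (Suc (Suc j)) p \<le> (1 / 2) * X (Suc (Suc j)) p"
        using C(1) by (intro mult_right_mono nonneg[OF p]) (simp add: field_simps)
      moreover have "X (Suc (Suc j)) p \<le> (\<delta> / 2) * X (Suc (Suc (Suc j))) p + C * X (Suc j) p" using C(2) p by blast
      moreover have "C * ((1 / (2 * (C + 1))) * X (Suc (Suc j)) p + D * X 0 p) =
          C * (1 / (2 * (C + 1))) * X (Suc (Suc j)) p + C * D * X 0 p"
        by (simp only: distrib_left mult.assoc)
      ultimately show ?thesis by linarith
    qed
    then show ?case using C(1) D(1) by (intro exI[of _ "2 * C * D"]) auto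
  qed
  have "\<exists>C\<ge>0. \<forall>p\<in>A. X 1 p \<le> X (Suc l) p + C * X 0 p" if "l \<le> k" for l
    using that
  proof (induction l)
    case 0
    show ?case by (intro exI[of _ 0]) auto
  next
    case (Suc l)
    obtain C where C: "C \<ge> 0" "\<forall>p\<in>A. X 1 p \<le> X (Suc l) p + C * X 0 p" using Suc by auto
    obtain D where D: "D \<ge> 0" "\<forall>p\<in>A. X (Suc l) p \<le> 1 * X (Suc (Suc l)) p + D * X 0 p"
      using to_0[of l 1] Suc.prems by auto
    have "X 1 p \<le> X (Suc (Suc l)) p + (C + D) * X 0 p" if "p \<in> A" for p
      using C(2) D(2) that by (fastforce simp: distrib_right)
    then show ?case using C(1) D(1) by (intro exI[of _ "C + D"]) auto
  qed
  then show ?thesis by blast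
qed

text \<open>It is used with \<open>A = 1\<close> when the exponent is not positive, and with \<open>A = \<epsilon>\<^sup>-\<^sup>m\<close> in order to see that
  a regularised mass tends to \<open>0\<close> as \<open>t \<rightarrow> \<infinity>\<close>.\<close>

lemma weighted_mass_le_front:
  fixes f :: "real \<Rightarrow> real ^ 'n::finite \<Rightarrow> complex"
  assumes f: "decays_in_front \<beta> c T f" "\<And>t. t \<ge> T \<Longrightarrow> continuous_on UNIV (f t)"
      "\<And>t x. t \<ge> T \<Longrightarrow> cmod (f t x) \<le> M"
    and \<beta>: "0 \<le> \<beta>" and T: "0 \<le> T"
  obtains C where "C \<ge> 0" "\<And>(a :: real) m \<epsilon> t A. \<lbrakk>t \<ge> T; 0 < \<epsilon>; \<epsilon> \<le> 1; \<bar>a\<bar> + 2 * CARD('n) \<le> real m; 0 \<le> A;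
    \<And>r. weight a m \<epsilon> r \<le> A * logistic r\<rbrakk> \<Longrightarrow> weighted_mass \<beta> a m \<epsilon> t (f t) \<le> A * C * exp (- c * t)"
proof -
  obtain C where C: "\<And>t. t \<ge> T \<Longrightarrow>
      front_mass \<beta> t (f t) \<le> ennreal (C * exp (- c * t))"
    using f(1) unfolding decays_in_front_def by blast
  have "weighted_mass \<beta> a m \<epsilon> t (f t) \<le> A * \<bar>C\<bar> * exp (- c * t)"
    if t: "t \<ge> T" and \<epsilon>: "0 < \<epsilon>" "\<epsilon> \<le> 1" and m: "\<bar>a\<bar> + 2 * CARD('n) \<le> real m"
      and A: "0 \<le> A" "\<And>r. weight a m \<epsilon> r \<le> A * logistic r" for a :: real and m \<epsilon> t A
  proof -
    note [measurable] = borel_measurable_continuous_onI[OF f(2)[OF t]]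
    have int: "integrable lborel (\<lambda>x. (cmod (f t x))\<^sup>2 * weight a m \<epsilon> (front \<beta> t x))"
      by (rule integrable_weighted_mass[OF f(2,3)[OF t] \<epsilon> \<beta> _ m]) (use T t in simp)
    have "ennreal (weighted_mass \<beta> a m \<epsilon> t (f t)) = (\<integral>\<^sup>+x. ennreal ((cmod (f t x))\<^sup>2 * weight a m \<epsilon> (front \<beta> t x)) \<partial>lborel)"
      unfolding weighted_mass_def using \<epsilon>
      by (intro nn_integral_eq_integral[OF int, symmetric] AE_I2 mult_nonneg_nonneg weight_nonneg) auto
    also have "\<dots> \<le> (\<integral>\<^sup>+x. ennreal (A * ((cmod (f t x))\<^sup>2 * logistic (front \<beta> t x))) \<partial>lborel)"
    proof (intro nn_integral_mono ennreal_leI)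
      fix x
      show "(cmod (f t x))\<^sup>2 * weight a m \<epsilon> (front \<beta> t x) \<le> A * ((cmod (f t x))\<^sup>2 * logistic (front \<beta> t x))"
        using mult_left_mono[OF A(2)[of "front \<beta> t x"], of "(cmod (f t x))\<^sup>2"] by (simp add: mult_ac)
    qed
    also have "\<dots> = ennreal A * front_mass \<beta> t (f t)"
      using A(1) less_imp_le[OF logistic_pos] by (simp add: ennreal_mult nn_integral_cmult)
    also have "\<dots> \<le> ennreal A * ennreal (\<bar>C\<bar> * exp (- c * t))"
      by (intro mult_left_mono order_trans[OF C[OF t]] ennreal_leI mult_right_mono) auto
    also have "\<dots> = ennreal (A * \<bar>C\<bar> * exp (- c * t))"
      using A(1) by (simp add: ennreal_mult mult.assoc)
    finally show ?thesis using A(1) by (subst (asm) ennreal_le_iff) auto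
  qed
  then show thesis by (intro that[of "\<bar>C\<bar>"]) auto
qed

lemma decays_in_front_imp_order_0:
  fixes f :: "real \<Rightarrow> real ^ 'n::finite \<Rightarrow> complex"
  assumes f: "decays_in_front \<beta> c T f" "\<And>t. t \<ge> T \<Longrightarrow> continuous_on UNIV (f t)"
      "\<And>t x. t \<ge> T \<Longrightarrow> cmod (f t x) \<le> M"
    and \<beta>: "0 \<le> \<beta>" and T: "0 \<le> T" and a: "a \<le> 0"
  shows "decays_at_order \<beta> c T a f"
proof -
  obtain C where "C \<ge> 0" and C: "\<And>(a :: real) m \<epsilon> t A. \<lbrakk>t \<ge> T; 0 < \<epsilon>; \<epsilon> \<le> 1; \<bar>a\<bar> + 2 * CARD('n) \<le> real m; 0 \<le> A;
    \<And>r. weight a m \<epsilon> r \<le> A * logistic r\<rbrakk> \<Longrightarrow> weighted_mass \<beta> a m \<epsilon> t (f t) \<le> A * C * exp (- c * t)"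
    using weighted_mass_le_front[OF f \<beta> T] by blast
  show ?thesis
    unfolding decays_at_order_def
  proof (intro exI[of _ "nat \<lceil>\<bar>a\<bar> + 2 * CARD('n)\<rceil>"] exI[of _ C] conjI allI impI \<open>C \<ge> 0\<close>)
    fix m :: nat and t \<epsilon> :: real assume m: "nat \<lceil>\<bar>a\<bar> + 2 * CARD('n)\<rceil> \<le> m" and h: "T \<le> t" "0 < \<epsilon>" "\<epsilon> \<le> 1"
    have "weighted_mass \<beta> a m \<epsilon> t (f t) \<le> 1 * C * exp (- c * t)"
    proof (rule C[OF h])
      show "\<bar>a\<bar> + 2 * CARD('n) \<le> real m" using m by linarith
      show "weight a m \<epsilon> r \<le> 1 * logistic r" for r using weight_nonpos_le_logistic[of \<epsilon> a m r] a h by simp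
    qed simp
    then show "weighted_mass \<beta> a m \<epsilon> t (f t) \<le> C * exp (- c * t)" by simp
  qed
qed

text \<open>Interpolate between \<open>f\<close>, of order \<open>a\<close>, and a pure derivative \<open>\<partial>\<^sub>i\<^sup>k\<^sup>+\<^sup>1 f\<close> with \<open>k + 1 \<ge> a\<close>, for which
  the exponent \<open>a - (k + 1)\<close> of the weight is no longer positive.\<close>

theorem decays_at_order_partial:
  fixes f :: "real \<Rightarrow> real ^ 'n::finite \<Rightarrow> complex"
  assumes smooth: "\<And>t. t \<ge> T \<Longrightarrow> smooth (f t)"
    and bounded: "\<And>j. \<exists>M. \<forall>t\<ge>T. \<forall>x. cmod ((partial i ^^ j) (f t) x) \<le> M"
    and base: "\<And>j. decays_in_front \<beta> c T (\<lambda>t. (partial i ^^ j) (f t))"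
    and \<beta>: "0 \<le> \<beta>" and T: "0 \<le> T"
    and f: "decays_at_order \<beta> c T a f"
  shows "decays_at_order \<beta> c T (a - 1) (\<lambda>t. partial i (f t))"
proof -
  let ?D = "\<lambda>j t. (partial i ^^ j) (f t)"
  define k where "k = nat \<lceil>\<bar>a\<bar>\<rceil>"
  have k: "a - real (Suc k) \<le> 0" unfolding k_def by linarith
  have sm: "smooth (?D j t)" if "t \<ge> T" for j t
    by (induction j) (auto intro: smooth_partial smooth that)
  obtain M where M: "\<And>j t x. t \<ge> T \<Longrightarrow> cmod (?D j t x) \<le> M j" using bounded by metis
  have "decays_at_order \<beta> c T (a - real (Suc k)) (?D (Suc k))"
    by (rule decays_in_front_imp_order_0[OF base smooth_continuous[OF sm] M \<beta> T k])
  then obtain m1 where m1: "\<And>m. m \<ge> m1 \<Longrightarrow> \<exists>C\<ge>0. mass_decays \<beta> c T (a - real (Suc k)) m (?D (Suc k)) C"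
    unfolding decays_at_order_def by blast
  obtain m0 where m0: "\<And>m. m \<ge> m0 \<Longrightarrow> \<exists>C\<ge>0. mass_decays \<beta> c T a m f C"
    using f unfolding decays_at_order_def by blast
  show ?thesis
    unfolding decays_at_order_def
  proof (intro exI[of _ "m0 + m1 + 2 * k + 2 + 2 * CARD('n)"] allI impI)
    fix m assume m: "m0 + m1 + 2 * k + 2 + 2 * CARD('n) \<le> m"
    define A where "A = {(t, \<epsilon>). T \<le> t \<and> 0 < \<epsilon> \<and> \<epsilon> \<le> (1 :: real)}"
    \<comment> \<open>one power of the weight is spent on each derivative\<close>
    define X where "X j = (\<lambda>(t, \<epsilon>). weighted_mass \<beta> (a - real j) m \<epsilon> t (?D j t))" for j
    have "\<exists>C\<ge>0. \<forall>p\<in>A. X 1 p \<le> X (Suc k) p + C * X 0 p"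
    proof (rule interpolation_chain)
      show "0 \<le> X j p" if "p \<in> A" for j p
        using that by (auto simp: X_def A_def intro: weighted_mass_nonneg)
      fix j and \<delta> :: real assume j: "j < k" and \<delta>: "0 < \<delta>"
      define b where "b = a - real (Suc j)"
      have b: "b + 1 = a - real j" "b - 1 = a - real (Suc (Suc j))" by (auto simp: b_def)
      have "\<bar>b\<bar> \<le> \<bar>a\<bar> + real (Suc j)" "\<bar>a\<bar> \<le> real k" unfolding b_def k_def by linarith+
      then have mb: "\<bar>b\<bar> + 1 + 2 * CARD('n) \<le> real m" using m j by linarith
      have "X (Suc j) (t, \<epsilon>) \<le> \<delta> * X (Suc (Suc j)) (t, \<epsilon>) + (1 / \<delta> + (\<bar>b\<bar> + real m + 1)\<^sup>2) * X j (t, \<epsilon>)"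
        if "(t, \<epsilon>) \<in> A" for t \<epsilon>
      proof -
        have t: "T \<le> t" "0 < \<epsilon>" "\<epsilon> \<le> 1" using that by (auto simp: A_def)
        have "0 \<le> t" using t T by simp
        then show ?thesis
          unfolding X_def prod.case b[symmetric] b_def[symmetric]
          using weighted_interpolation_step[where g = "?D j t" and i = i, OF sm[OF t(1)] M[OF t(1), of j]
              M[OF t(1), of "Suc j", simplified] M[OF t(1), of "Suc (Suc j)", simplified] \<delta> t(2,3) \<beta> _ mb]
          by simp
      qed
      then show "\<exists>C\<ge>0. \<forall>p\<in>A. X (Suc j) p \<le> \<delta> * X (Suc (Suc j)) p + C * X j p"
        using \<delta> by (intro exI[of _ "1 / \<delta> + (\<bar>b\<bar> + real m + 1)\<^sup>2"]) auto
    qed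
    then obtain C where C: "C \<ge> 0" "\<And>t \<epsilon>. T \<le> t \<Longrightarrow> 0 < \<epsilon> \<Longrightarrow> \<epsilon> \<le> 1 \<Longrightarrow>
        X 1 (t, \<epsilon>) \<le> X (Suc k) (t, \<epsilon>) + C * X 0 (t, \<epsilon>)"
      by (auto simp: A_def)
    obtain C0 where C0: "C0 \<ge> 0" "\<And>t \<epsilon>. T \<le> t \<Longrightarrow> 0 < \<epsilon> \<Longrightarrow> \<epsilon> \<le> 1 \<Longrightarrow> X 0 (t, \<epsilon>) \<le> C0 * exp (- c * t)"
      using m0[of m] m by (auto simp: X_def)
    obtain C1 where C1: "C1 \<ge> 0" "\<And>t \<epsilon>. T \<le> t \<Longrightarrow> 0 < \<epsilon> \<Longrightarrow> \<epsilon> \<le> 1 \<Longrightarrow> X (Suc k) (t, \<epsilon>) \<le> C1 * exp (- c * t)"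
      using m1[of m] m by (auto simp: X_def)
    show "\<exists>C\<ge>0. mass_decays \<beta> c T (a - 1) m (\<lambda>t. partial i (f t)) C"
    proof (intro exI[of _ "C1 + C * C0"] conjI allI impI)
      fix t \<epsilon> assume h: "T \<le> t" "0 < \<epsilon>" "\<epsilon> \<le> (1 :: real)"
      have "X 1 (t, \<epsilon>) \<le> C1 * exp (- c * t) + C * (C0 * exp (- c * t))"
        using C(2)[OF h] C1(2)[OF h] mult_left_mono[OF C0(2)[OF h] C(1)] by linarith
      then show "weighted_mass \<beta> (a - 1) m \<epsilon> t (partial i (f t)) \<le> (C1 + C * C0) * exp (- c * t)"
        by (simp add: X_def algebra_simps)
    qed (use C(1) C0(1) C1(1) in auto)
  qed
qed

section \<open>The local conservation of mass\<close>

text \<open>The mean value theorem bounds the difference quotients by the same \<open>B\<close> as the derivative, so the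
  dominated convergence theorem applies.\<close>

lemma has_real_derivative_integral:
  fixes G G' :: "real \<Rightarrow> 'a::euclidean_space \<Rightarrow> real"
  assumes t: "t \<in> {a<..<b}"
    and der: "\<And>\<tau> x. \<tau> \<in> {a<..<b} \<Longrightarrow> ((\<lambda>\<tau>. G \<tau> x) has_real_derivative G' \<tau> x) (at \<tau>)"
    and int: "\<And>\<tau>. \<tau> \<in> {a<..<b} \<Longrightarrow> integrable lborel (G \<tau>)"
    and B: "integrable lborel B" "\<And>\<tau> x. \<tau> \<in> {a<..<b} \<Longrightarrow> \<bar>G' \<tau> x\<bar> \<le> B x"
    and meas: "G' t \<in> borel_measurable borel"
  shows "((\<lambda>\<tau>. LINT x|lborel. G \<tau> x) has_real_derivative (LINT x|lborel. G' t x)) (at t)"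
proof -
  have "((\<lambda>\<tau>. ((LINT x|lborel. G \<tau> x) - (LINT x|lborel. G t x)) / (\<tau> - t)) \<longlongrightarrow> (LINT x|lborel. G' t x))
      (at t within {a<..<b})"
    unfolding tendsto_at_iff_sequentially
  proof (intro allI impI)
    fix X :: "nat \<Rightarrow> real" assume X: "\<forall>n. X n \<in> {a<..<b} - {t}" and lim: "X \<longlonglongrightarrow> t"
    let ?q = "\<lambda>n x. (G (X n) x - G t x) / (X n - t)"
    have "(\<lambda>n. LINT x|lborel. ?q n x) \<longlonglongrightarrow> (LINT x|lborel. G' t x)"
    proof (rule integral_dominated_convergence[where w = B])
      show "G' t \<in> borel_measurable lborel" using meas by simp
      show "(\<lambda>x. ?q n x) \<in> borel_measurable lborel" for n
        using int[of "X n"] int[OF t] X by (auto dest: borel_measurable_integrable)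
      show "integrable lborel B" by (rule B)
      show "AE x in lborel. (\<lambda>n. ?q n x) \<longlonglongrightarrow> G' t x"
      proof (rule AE_I2)
        fix x
        have "((\<lambda>\<tau>. (G \<tau> x - G t x) / (\<tau> - t)) \<longlongrightarrow> G' t x) (at t)"
          using der[OF t, of x] by (simp add: has_field_derivative_iff)
        from this[unfolded tendsto_at_iff_sequentially] show "(\<lambda>n. ?q n x) \<longlonglongrightarrow> G' t x"
          using X lim by (auto simp: o_def)
      qed
      show "AE x in lborel. norm (?q n x) \<le> B x" for n
      proof (rule AE_I2)
        fix x
        have "norm (G (X n) x - G t x) \<le> B x * norm (X n - t)"
          by (rule field_differentiable_bound[of "{a<..<b}" "\<lambda>\<tau>. G \<tau> x" "\<lambda>\<tau>. G' \<tau> x"])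
             (use X t B(2) in \<open>auto intro!: has_field_derivative_at_within[OF der]\<close>)
        moreover have "X n \<noteq> t" using X by auto
        ultimately show "norm (?q n x) \<le> B x" by (simp add: abs_divide divide_le_eq)
      qed
    qed
    moreover have "(LINT x|lborel. ?q n x) = ((LINT x|lborel. G (X n) x) - (LINT x|lborel. G t x)) / (X n - t)" for n
      using int[of "X n"] int[OF t] X by (simp add: Bochner_Integration.integral_diff)
    ultimately show "((\<lambda>\<tau>. ((LINT x|lborel. G \<tau> x) - (LINT x|lborel. G t x)) / (\<tau> - t)) \<circ> X) \<longlonglongrightarrow> (LINT x|lborel. G' t x)"
      by (simp only: o_def)
  qed
  then show ?thesis
    using t at_within_open[of t "{a<..<b}"] by (simp add: has_field_derivative_iff)
qed

lemma inner_i_mult_self: "z \<bullet> (\<i> * z) = 0"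
  by (simp add: inner_complex_def)

lemma inner_i_mult_real: "z \<bullet> (\<i> * (complex_of_real r * z)) = 0"
  by (simp add: inner_complex_def)

text \<open>By the equation, \<open>\<partial>\<^sub>t |u|\<^sup>2 = 2 u \<bullet> i\<Delta>u\<close> is the divergence of \<open>2 u \<bullet> i\<nabla>u\<close>. After an integration by
  parts the derivative of the weighted mass of order \<open>b = a + 1/2\<close> involves only the derivative of
  the weight, which has order \<open>b - 1 = a - 1/2\<close> and is controlled by the hypotheses. Integrating from
  infinity gives the claim.\<close>

theorem mass_gains_half_order:
  fixes u :: "real \<Rightarrow> real ^ 'n::finite \<Rightarrow> complex"
  assumes eqn: "\<And>t x. t > T\<^sub>0 \<Longrightarrow> \<exists>u\<^sub>t. ((\<lambda>\<tau>. u \<tau> x) has_vector_derivative u\<^sub>t) (at t) \<and>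
        \<i> * u\<^sub>t + laplacian (u t) x + complex_of_real (cmod (u t x) ^ (p - 1)) * u t x = 0"
    and smooth: "\<And>t. t \<ge> T\<^sub>0 \<Longrightarrow> smooth (u t)"
    and bounded: "\<And>xs. \<exists>M. \<forall>t\<ge>T\<^sub>0. \<forall>x. cmod (foldr partial xs (u t) x) \<le> M"
    and base: "decays_in_front \<beta> c T u"
    and T: "0 \<le> T\<^sub>0" "T\<^sub>0 < T" and \<beta>: "0 \<le> \<beta>" and c: "0 < c"
    and u: "decays_at_order \<beta> c T a u"
    and du: "\<And>i. decays_at_order \<beta> c T (a - 1) (\<lambda>t. partial i (u t))"
  shows "decays_at_order \<beta> c T (a + 1 / 2) u"
proof -
  define b where "b = a + 1 / 2"
  obtain M where M: "\<And>xs t x. t \<ge> T\<^sub>0 \<Longrightarrow> cmod (foldr partial xs (u t) x) \<le> M xs"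
    using bounded by metis
  have M0: "cmod (u t x) \<le> M []" and M1: "cmod (partial i (u t) x) \<le> M [i]"
    and M2: "cmod (partial i (partial i (u t)) x) \<le> M [i, i]" if "t \<ge> T\<^sub>0" for t x i
    using M[OF that, of "[]"] M[OF that, of "[i]"] M[OF that, of "[i, i]"] by auto
  have M_nonneg: "0 \<le> M xs" for xs using M[OF order_refl, of xs 0] norm_ge_zero order_trans by blast
  define L where "L = (\<Sum>i\<in>UNIV. M [i, i]) + M [] ^ (p - 1) * M []"
  define u' where "u' t x = \<i> * (laplacian (u t) x + complex_of_real (cmod (u t x) ^ (p - 1)) * u t x)" for t x
  have u': "((\<lambda>\<tau>. u \<tau> x) has_vector_derivative u' t x) (at t)" if t: "t > T\<^sub>0" for t x
  proof -
    obtain w where w: "((\<lambda>\<tau>. u \<tau> x) has_vector_derivative w) (at t)"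
      "\<i> * w + laplacian (u t) x + complex_of_real (cmod (u t x) ^ (p - 1)) * u t x = 0"
      using eqn[OF t] by blast
    have "\<i> * (\<i> * w + laplacian (u t) x + complex_of_real (cmod (u t x) ^ (p - 1)) * u t x) = u' t x - w"
      by (simp add: u'_def algebra_simps)
    with w show ?thesis by simp
  qed
  have lap_bound: "cmod (u' t x) \<le> L" if t: "t \<ge> T\<^sub>0" for t x
  proof -
    have "cmod (u' t x) \<le> cmod (laplacian (u t) x) + cmod (u t x) ^ (p - 1) * cmod (u t x)"
      unfolding u'_def norm_mult norm_ii mult_1
      by (rule order_trans[OF norm_triangle_ineq]) (simp add: norm_mult norm_power)
    also have "\<dots> \<le> L"
      unfolding L_def laplacian_def
      by (intro add_mono sum_norm_le M2 mult_mono power_mono M0 t) (use M_nonneg in auto)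
    finally show ?thesis .
  qed
  \<comment> \<open>the nonlinear term only rotates the phase, so it is orthogonal to \<open>u\<close>\<close>
  have inner_u': "u t x \<bullet> u' t x = (\<Sum>i\<in>UNIV. u t x \<bullet> (\<i> * partial i (partial i (u t)) x))" for t x
    unfolding u'_def distrib_left inner_add_right inner_i_mult_real laplacian_def sum_distrib_left inner_sum_right
    by simp
  obtain m0 where m0: "\<And>m. m \<ge> m0 \<Longrightarrow> \<exists>C\<ge>0. mass_decays \<beta> c T a m u C"
    using u unfolding decays_at_order_def by blast
  obtain m1 where m1: "\<And>i m. m \<ge> m1 i \<Longrightarrow> \<exists>C\<ge>0. mass_decays \<beta> c T (a - 1) m (\<lambda>t. partial i (u t)) C"
    using du unfolding decays_at_order_def by metis
  have cu: "continuous_on UNIV (u t)" if "t \<ge> T\<^sub>0" for t by (rule smooth_continuous[OF smooth[OF that]])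
  have cdu: "continuous_on UNIV (partial i (u t))" if "t \<ge> T\<^sub>0" for t i
    by (rule smooth_continuous[OF smooth_partial[OF smooth[OF that]]])
  have cddu: "continuous_on UNIV (partial i (partial i (u t)))" if "t \<ge> T\<^sub>0" for t i
    by (rule smooth_continuous[OF smooth_partial[OF smooth_partial[OF smooth[OF that]]]])
  obtain C0 where C0: "C0 \<ge> 0" "\<And>(a :: real) m \<epsilon> t A. \<lbrakk>t \<ge> T; 0 < \<epsilon>; \<epsilon> \<le> 1; \<bar>a\<bar> + 2 * CARD('n) \<le> real m; 0 \<le> A;
    \<And>r. weight a m \<epsilon> r \<le> A * logistic r\<rbrakk> \<Longrightarrow> weighted_mass \<beta> a m \<epsilon> t (u t) \<le> A * C0 * exp (- c * t)"
    using weighted_mass_le_front[OF base cu M0 \<beta>] T by auto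
  show ?thesis
    unfolding decays_at_order_def b_def[symmetric]
  proof (intro exI[of _ "m0 + (\<Sum>i\<in>UNIV. m1 i) + nat \<lceil>\<bar>a\<bar>\<rceil> + 3 + 2 * CARD('n)"] allI impI)
    fix m assume m: "m0 + (\<Sum>i\<in>UNIV. m1 i) + nat \<lceil>\<bar>a\<bar>\<rceil> + 3 + 2 * CARD('n) \<le> m"
    have m1_le: "m1 i \<le> m" for i using member_le_sum[of i UNIV m1] m by simp
    have mb: "\<bar>b\<bar> + 1 + 2 * CARD('n) \<le> real m" using m unfolding b_def by linarith
    then have mb': "\<bar>b\<bar> + 2 * CARD('n) \<le> real m" "\<bar>b - 1\<bar> + 2 * CARD('n) \<le> real m" "b \<le> real m" by linarith+
    have ma: "\<bar>a\<bar> + 2 * CARD('n) \<le> real m" "\<bar>a - 1\<bar> + 2 * CARD('n) \<le> real m" using m by linarith+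
    define K where "K = \<bar>b\<bar> + real m + 1"
    have K: "0 \<le> K" by (simp add: K_def)
    obtain C where C: "C \<ge> 0" "\<And>t \<epsilon>. t \<ge> T \<Longrightarrow> 0 < \<epsilon> \<Longrightarrow> \<epsilon> \<le> 1 \<Longrightarrow> weighted_mass \<beta> a m \<epsilon> t (u t) \<le> C * exp (- c * t)"
      using m0[of m] m by auto
    obtain D where D: "\<And>i. D i \<ge> 0" "\<And>i t \<epsilon>. t \<ge> T \<Longrightarrow> 0 < \<epsilon> \<Longrightarrow> \<epsilon> \<le> 1 \<Longrightarrow>
        weighted_mass \<beta> (a - 1) m \<epsilon> t (partial i (u t)) \<le> D i * exp (- c * t)"
      using m1[OF m1_le] by metis
    define E where "E = (\<Sum>i\<in>(UNIV :: 'n set). 2 * K * (C + D i)) + \<beta> * K * C"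
    have E: "0 \<le> E" unfolding E_def using K C(1) D(1) \<beta> by (intro add_nonneg_nonneg sum_nonneg mult_nonneg_nonneg) auto
    have "weighted_mass \<beta> b m \<epsilon> t (u t) \<le> (E / c) * exp (- c * t)"
      if t: "T \<le> t" and \<epsilon>: "0 < \<epsilon>" "\<epsilon> \<le> 1" for t \<epsilon>
    proof -
      define I where "I t = weighted_mass \<beta> b m \<epsilon> t (u t)" for t
      define G where "G t x = (cmod (u t x))\<^sup>2 * weight b m \<epsilon> (front \<beta> t x)" for t x
      define G' where "G' t x = 2 * (u t x \<bullet> u' t x) * weight b m \<epsilon> (front \<beta> t x) -
          \<beta> * ((cmod (u t x))\<^sup>2 * weight_deriv b m \<epsilon> (front \<beta> t x))" for t x
      have I': "(I has_real_derivative (LINT x|lborel. G' t x)) (at t)" if t: "t \<ge> T" for t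
      proof -
        have "((\<lambda>\<tau>. LINT x|lborel. G \<tau> x) has_real_derivative (LINT x|lborel. G' t x)) (at t)"
        proof (rule has_real_derivative_integral[where a = T\<^sub>0 and b = "t + 1"])
          show "t \<in> {T\<^sub>0<..<t + 1}" using T t by simp
          fix \<tau> and x :: "real ^ 'n" assume \<tau>: "\<tau> \<in> {T\<^sub>0<..<t + 1}"
          then have \<tau>0: "T\<^sub>0 \<le> \<tau>" "0 \<le> \<tau>" using T by auto
          have "((\<lambda>\<tau>. u \<tau> x \<bullet> u \<tau> x) has_vector_derivative 2 * (u \<tau> x \<bullet> u' \<tau> x)) (at \<tau>)"
            using bounded_bilinear.has_vector_derivative[OF bounded_bilinear_inner u' u', of \<tau> x x] \<tau>
            by (simp add: inner_commute)
          then have d1: "((\<lambda>\<tau>. (cmod (u \<tau> x))\<^sup>2) has_real_derivative 2 * (u \<tau> x \<bullet> u' \<tau> x)) (at \<tau>)"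
            by (simp add: power2_norm_eq_inner has_real_derivative_iff_has_vector_derivative)
          have "((\<lambda>\<tau>. front \<beta> \<tau> x) has_real_derivative (- \<beta>)) (at \<tau>)"
            unfolding front_def by (auto intro!: derivative_eq_intros)
          then have d2: "((\<lambda>\<tau>. weight b m \<epsilon> (front \<beta> \<tau> x)) has_real_derivative
              weight_deriv b m \<epsilon> (front \<beta> \<tau> x) * (- \<beta>)) (at \<tau>)"
            by (rule DERIV_chain2[OF DERIV_weight, rotated]) (use \<epsilon> in simp)
          show "((\<lambda>\<tau>. G \<tau> x) has_real_derivative G' \<tau> x) (at \<tau>)"
            unfolding G_def using DERIV_mult[OF d1 d2]
            by (rule DERIV_cong) (simp add: G'_def algebra_simps)
          show "integrable lborel (G \<tau>)"
            unfolding G_def by (rule integrable_weighted_mass[OF cu M0 \<epsilon> \<beta> _ mb'(1)]) (use \<tau>0 in auto)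
          let ?H = "((1 + \<beta> * (t + 1)) / \<epsilon>) ^ m / (1 + norm x) ^ (2 * CARD('n))"
          have W: "weight b m \<epsilon> (front \<beta> \<tau> x) \<le> ?H" "weight (b - 1) m \<epsilon> (front \<beta> \<tau> x) \<le> ?H"
            using \<tau> t T mb' by (auto intro!: weight_le_inverse_power \<epsilon> \<beta>)
          have W0: "0 \<le> weight b m \<epsilon> (front \<beta> \<tau> x)" using \<epsilon> by (simp add: weight_nonneg)
          have H0: "0 \<le> ?H" using W W0 by linarith
          have "\<bar>u \<tau> x \<bullet> u' \<tau> x\<bar> \<le> M [] * L"
            using M0[OF \<tau>0(1)] lap_bound[OF \<tau>0(1)] M_nonneg by (intro order_trans[OF Cauchy_Schwarz_ineq2 mult_mono]) auto
          then have "\<bar>2 * (u \<tau> x \<bullet> u' \<tau> x) * weight b m \<epsilon> (front \<beta> \<tau> x)\<bar> \<le> 2 * (M [] * L) * ?H"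
            unfolding abs_mult using W W0 H0 by (intro mult_mono) (auto intro: order_trans[OF abs_ge_zero])
          moreover have "\<bar>\<beta> * ((cmod (u \<tau> x))\<^sup>2 * weight_deriv b m \<epsilon> (front \<beta> \<tau> x))\<bar> \<le> \<beta> * ((M [])\<^sup>2 * (K * ?H))"
          proof -
            have "\<bar>weight_deriv b m \<epsilon> (front \<beta> \<tau> x)\<bar> \<le> K * weight (b - 1) m \<epsilon> (front \<beta> \<tau> x)"
              unfolding K_def using \<epsilon> by (intro weight_deriv_bound) auto
            also have "\<dots> \<le> K * ?H" by (rule mult_left_mono[OF W(2) K])
            finally show ?thesis
              unfolding abs_mult using \<beta> M0[OF \<tau>0(1)] by (intro mult_mono) (auto intro!: power_mono)
          qed
          ultimately have "\<bar>G' \<tau> x\<bar> \<le> 2 * (M [] * L) * ?H + \<beta> * ((M [])\<^sup>2 * (K * ?H))"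
            unfolding G'_def by (intro order_trans[OF abs_triangle_ineq4] add_mono)
          then show "\<bar>G' \<tau> x\<bar> \<le> ((2 * (M [] * L) + \<beta> * (M [])\<^sup>2 * K) * ((1 + \<beta> * (t + 1)) / \<epsilon>) ^ m) * (1 / (1 + norm x) ^ (2 * CARD('n)))"
            by (simp add: algebra_simps add_divide_distrib)
        next
          show "integrable lborel (\<lambda>x :: real ^ 'n. ((2 * (M [] * L) + \<beta> * (M [])\<^sup>2 * K) * ((1 + \<beta> * (t + 1)) / \<epsilon>) ^ m) * (1 / (1 + norm x) ^ (2 * CARD('n))))"
            by (rule integrable_mult_right) (rule integrable_inverse_power)
          have t0: "t \<ge> T\<^sub>0" using t T by simp
          have "continuous_on UNIV (u' t)"
            unfolding u'_def laplacian_def by (intro continuous_intros cu cddu t0)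
          then have "continuous_on UNIV (G' t)"
            unfolding G'_def using \<epsilon> by (intro continuous_intros cu t0) auto
          then show "G' t \<in> borel_measurable borel" by (rule borel_measurable_continuous_onI)
        qed
        then show ?thesis by (simp add: I_def[abs_def] G_def weighted_mass_def)
      qed
      \<comment> \<open>\<open>E\<close> adds up the fluxes in all directions and the contribution of the moving front\<close>
      have I'_ge: "- (E * exp (- c * t)) \<le> (LINT x|lborel. G' t x)" if t: "t \<ge> T" for t
      proof -
        have t0: "t \<ge> T\<^sub>0" "0 \<le> t" using t T by auto
        let ?W = "\<lambda>x. weight b m \<epsilon> (front \<beta> t x)"
        let ?V = "\<lambda>i x. weight_deriv b m \<epsilon> (front \<beta> t x) * (x $ i / sqrt (1 + x \<bullet> x))"
        let ?A = "\<lambda>x. (cmod (u t x))\<^sup>2 * weight a m \<epsilon> (front \<beta> t x)"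
        let ?B = "\<lambda>i x. (cmod (partial i (u t) x))\<^sup>2 * weight (a - 1) m \<epsilon> (front \<beta> t x)"
        have iA: "integrable lborel ?A"
          by (rule integrable_weighted_mass[OF cu[OF t0(1)] M0[OF t0(1)] \<epsilon> \<beta> t0(2) ma(1)])
        have iB: "integrable lborel (?B i)" for i
          by (rule integrable_weighted_mass[OF cdu[OF t0(1)] M1[OF t0(1)] \<epsilon> \<beta> t0(2) ma(2)])
        have b1: "b - 1 = a - 1 / 2" by (simp add: b_def)
        have flux: "integrable lborel (\<lambda>x. (u t x \<bullet> (\<i> * partial i (partial i (u t)) x)) * ?W x)"
          "- (K * (C + D i)) * exp (- c * t) \<le> (LINT x|lborel. (u t x \<bullet> (\<i> * partial i (partial i (u t)) x)) * ?W x)" for i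
        proof -
          let ?g = "\<lambda>x. u t x \<bullet> (\<i> * partial i (u t) x)" and ?g' = "\<lambda>x. u t x \<bullet> (\<i> * partial i (partial i (u t)) x)"
          have d: "((\<lambda>h. ?g (x + h *\<^sub>R axis i 1)) has_vector_derivative ?g' x) (at 0)" for x
          proof -
            have "((\<lambda>h. \<i> * partial i (u t) (x + h *\<^sub>R axis i 1)) has_vector_derivative \<i> * partial i (partial i (u t)) x) (at 0)"
              by (rule has_vector_derivative_mult_right[OF has_vector_derivative_partial_0[OF
                    smooth_differentiable[OF smooth_partial[OF smooth[OF t0(1)]]]]])
            from bounded_bilinear.has_vector_derivative[OF bounded_bilinear_inner
              has_vector_derivative_partial_0[OF smooth_differentiable[OF smooth[OF t0(1)]], of x i] this]
            show ?thesis by (simp add: inner_i_mult_self)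
          qed
          have cg: "continuous_on UNIV ?g" "continuous_on UNIV ?g'"
            by (intro continuous_intros cu cdu cddu t0)+
          have bg: "\<bar>?g x\<bar> \<le> M [] * M [i]" "\<bar>?g' x\<bar> \<le> M [] * M [i, i]" for x
            using M0[OF t0(1)] M1[OF t0(1)] M2[OF t0(1)] M_nonneg
            by (auto intro!: order_trans[OF Cauchy_Schwarz_ineq2 mult_mono] simp: norm_mult)
          show "integrable lborel (\<lambda>x. ?g' x * ?W x)"
            by (rule integrable_times_weight[OF cg(2) bg(2) \<epsilon> \<beta> t0(2) mb'(1)])
          have iV: "integrable lborel (\<lambda>x. ?g x * ?V i x)"
            by (rule integral_line_derivative_times_weight(1)[OF d cg bg \<epsilon> \<beta> t0(2) mb])
          have "(LINT x|lborel. ?g x * ?V i x) \<le> (LINT x|lborel. K * (?A x + ?B i x))"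
          proof (rule integral_mono)
            fix x
            have "?g x * ?V i x \<le> \<bar>?g x\<bar> * \<bar>?V i x\<bar>" unfolding abs_mult[symmetric] by (rule abs_ge_self)
            also have "\<dots> \<le> (cmod (u t x) * cmod (partial i (u t) x)) * (K * weight (b - 1) m \<epsilon> (front \<beta> t x))"
              unfolding K_def using \<epsilon> Cauchy_Schwarz_ineq2[of "u t x" "\<i> * partial i (u t) x"]
              by (intro mult_mono weight_slope_bound) (auto simp: norm_mult)
            also have "\<dots> = K * (weight (a - 1 / 2) m \<epsilon> (front \<beta> t x) * (cmod (u t x) * cmod (partial i (u t) x)))"
              by (simp add: b1 mult_ac)
            also have "\<dots> \<le> K * (?A x + ?B i x)"
              by (rule mult_left_mono[OF weight_young_half K]) (use \<epsilon> in simp)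
            finally show "?g x * ?V i x \<le> K * (?A x + ?B i x)" .
          qed (use iV iA iB in auto)
          also have "\<dots> = K * (weighted_mass \<beta> a m \<epsilon> t (u t) + weighted_mass \<beta> (a - 1) m \<epsilon> t (partial i (u t)))"
            using iA iB by (simp add: weighted_mass_def)
          also have "\<dots> \<le> K * (C * exp (- c * t) + D i * exp (- c * t))"
            by (intro mult_left_mono add_mono C(2) D(2) t \<epsilon> K)
          finally show "- (K * (C + D i)) * exp (- c * t) \<le> (LINT x|lborel. ?g' x * ?W x)"
            unfolding integral_line_derivative_times_weight(2)[OF d cg bg \<epsilon> \<beta> t0(2) mb]
            by (simp add: algebra_simps)
        qed
        have iD: "integrable lborel (\<lambda>x. (cmod (u t x))\<^sup>2 * weight_deriv b m \<epsilon> (front \<beta> t x))"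
          and Dle: "(LINT x|lborel. (cmod (u t x))\<^sup>2 * weight_deriv b m \<epsilon> (front \<beta> t x)) \<le> K * C * exp (- c * t)"
        proof -
          have le: "\<bar>(cmod (u t x))\<^sup>2 * weight_deriv b m \<epsilon> (front \<beta> t x)\<bar> \<le> K * ?A x" for x
          proof -
            have "\<bar>weight_deriv b m \<epsilon> (front \<beta> t x)\<bar> \<le> K * weight (b - 1) m \<epsilon> (front \<beta> t x)"
              unfolding K_def using \<epsilon> by (intro weight_deriv_bound) auto
            also have "\<dots> \<le> K * weight a m \<epsilon> (front \<beta> t x)"
              using \<epsilon> by (intro mult_left_mono[OF weight_mono K]) (auto simp: b1)
            finally have "(cmod (u t x))\<^sup>2 * \<bar>weight_deriv b m \<epsilon> (front \<beta> t x)\<bar> \<le> (cmod (u t x))\<^sup>2 * (K * weight a m \<epsilon> (front \<beta> t x))"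
              by (rule mult_left_mono) simp
            then show ?thesis by (simp add: abs_mult mult_ac)
          qed
          show i: "integrable lborel (\<lambda>x. (cmod (u t x))\<^sup>2 * weight_deriv b m \<epsilon> (front \<beta> t x))"
          proof (rule Bochner_Integration.integrable_bound[of _ "\<lambda>x. K * ?A x"])
            show "integrable lborel (\<lambda>x. K * ?A x)" using iA by simp
            have "continuous_on UNIV (\<lambda>x. (cmod (u t x))\<^sup>2 * weight_deriv b m \<epsilon> (front \<beta> t x))"
              using \<epsilon> by (intro continuous_intros cu t0) auto
            then show "(\<lambda>x. (cmod (u t x))\<^sup>2 * weight_deriv b m \<epsilon> (front \<beta> t x)) \<in> borel_measurable lborel"
              using borel_measurable_continuous_onI by simp
            show "AE x in lborel. norm ((cmod (u t x))\<^sup>2 * weight_deriv b m \<epsilon> (front \<beta> t x)) \<le> norm (K * ?A x)"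
              unfolding real_norm_def by (intro AE_I2 order_trans[OF le abs_ge_self])
          qed
          have "(LINT x|lborel. (cmod (u t x))\<^sup>2 * weight_deriv b m \<epsilon> (front \<beta> t x)) \<le> (LINT x|lborel. K * ?A x)"
            using i iA by (intro integral_mono order_trans[OF abs_ge_self le]) auto
          also have "\<dots> = K * weighted_mass \<beta> a m \<epsilon> t (u t)" by (simp add: weighted_mass_def)
          also have "\<dots> \<le> K * (C * exp (- c * t))" by (intro mult_left_mono C(2) t \<epsilon> K)
          finally show "(LINT x|lborel. (cmod (u t x))\<^sup>2 * weight_deriv b m \<epsilon> (front \<beta> t x)) \<le> K * C * exp (- c * t)"
            by simp
        qed
        have "(LINT x|lborel. G' t x) = (LINT x|lborel. (\<Sum>i\<in>UNIV. 2 * ((u t x \<bullet> (\<i> * partial i (partial i (u t)) x)) * ?W x)) -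
            \<beta> * ((cmod (u t x))\<^sup>2 * weight_deriv b m \<epsilon> (front \<beta> t x)))"
          by (simp add: G'_def inner_u' sum_distrib_left sum_distrib_right mult.assoc)
        also have "\<dots> = (\<Sum>i\<in>UNIV. 2 * (LINT x|lborel. (u t x \<bullet> (\<i> * partial i (partial i (u t)) x)) * ?W x)) -
            \<beta> * (LINT x|lborel. (cmod (u t x))\<^sup>2 * weight_deriv b m \<epsilon> (front \<beta> t x))"
          using flux(1) iD by (subst Bochner_Integration.integral_diff) (auto simp: Bochner_Integration.integral_sum)
        also have "\<dots> \<ge> (\<Sum>i\<in>(UNIV :: 'n set). 2 * (- (K * (C + D i)) * exp (- c * t))) - \<beta> * (K * C * exp (- c * t))"
          by (intro diff_mono sum_mono mult_left_mono flux(2) Dle \<beta>) auto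
        also have "(\<Sum>i\<in>(UNIV :: 'n set). 2 * (- (K * (C + D i)) * exp (- c * t))) - \<beta> * (K * C * exp (- c * t)) = - (E * exp (- c * t))"
        proof -
          have "(\<Sum>i\<in>(UNIV :: 'n set). 2 * (- (K * (C + D i)) * exp (- c * t))) =
              - ((\<Sum>i\<in>(UNIV :: 'n set). 2 * K * (C + D i)) * exp (- c * t))"
            unfolding sum_distrib_right sum_negf[symmetric] by (intro sum.cong) (simp_all add: mult_ac)
          then show ?thesis unfolding E_def distrib_right[of _ _ "exp (- c * t)"] by simp
        qed
        finally show ?thesis .
      qed
      \<comment> \<open>\<open>I\<close> vanishes at infinity because the weight is bounded for fixed \<open>\<epsilon>\<close>\<close>
      have I_small: "I s \<le> (1 / \<epsilon>) ^ m * C0 * exp (- c * s)" if "s \<ge> T" for s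
        unfolding I_def
        by (rule C0(2)[OF that \<epsilon> mb'(1) _ weight_le_logistic[OF \<epsilon> mb'(3)]]) (use \<epsilon> in simp)
      \<comment> \<open>the derivative of the correction compensates for the lower bound \<open>- E exp (- c t)\<close>\<close>
      have mono: "I t - E / c * exp (- c * t) \<le> I s - E / c * exp (- c * s)" if s: "t \<le> s" for s
      proof (rule DERIV_nonneg_imp_nondecreasing[OF s])
        fix r assume "t \<le> r" "r \<le> s"
        with t have r: "T \<le> r" by simp
        have "((\<lambda>r. I r - E / c * exp (- c * r)) has_real_derivative (LINT x|lborel. G' r x) - E / c * (exp (- c * r) * (- c))) (at r)"
          by (intro DERIV_diff I' r DERIV_cmult) (auto intro!: derivative_eq_intros)
        moreover have "0 \<le> (LINT x|lborel. G' r x) - E / c * (exp (- c * r) * (- c))"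
          using I'_ge[OF r] c by simp
        ultimately show "\<exists>y. ((\<lambda>r. I r - E / c * exp (- c * r)) has_real_derivative y) (at r) \<and> 0 \<le> y" by blast
      qed
      have lim: "((\<lambda>s. (1 / \<epsilon>) ^ m * C0 * exp (- c * s)) \<longlongrightarrow> (1 / \<epsilon>) ^ m * C0 * 0) at_top"
      proof (intro tendsto_intros filterlim_compose[OF exp_at_bot])
        show "LIM s at_top. - c * s :> at_bot"
          using c by (intro filterlim_tendsto_neg_mult_at_bot[OF tendsto_const _ filterlim_ident]) simp
      qed
      have "I t - E / c * exp (- c * t) \<le> (1 / \<epsilon>) ^ m * C0 * 0"
      proof (rule tendsto_lowerbound[OF lim])
        show "\<forall>\<^sub>F s in at_top. I t - E / c * exp (- c * t) \<le> (1 / \<epsilon>) ^ m * C0 * exp (- c * s)"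
          using eventually_ge_at_top[of t]
        proof eventually_elim
          case (elim s)
          have "0 \<le> E / c * exp (- c * s)" using E c by simp
          with mono[OF elim] I_small[of s] elim t show ?case by linarith
        qed
      qed simp
      then show ?thesis by (simp add: I_def)
    qed
    then show "\<exists>C\<ge>0. mass_decays \<beta> c T b m u C"
      using E c by (intro exI[of _ "E / c"]) auto
  qed
qed

section \<open>Decay to every order\<close>

lemma funpow_partial_foldr: "(partial i ^^ j) (foldr partial xs f) = foldr partial (replicate j i @ xs) f"
  by (induction j) auto

text \<open>The induction on \<open>k\<close> climbs by half a power for \<open>u\<close> itself. A derivative of length \<open>l\<close> of order
  \<open>k/2\<close> is then reached from \<open>u\<close> at order \<open>k/2 + l\<close>.\<close>

theorem decays_at_every_order:
  fixes u :: "real \<Rightarrow> real ^ 'n::finite \<Rightarrow> complex"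
  assumes eqn: "\<And>t x. t > T\<^sub>0 \<Longrightarrow> \<exists>u\<^sub>t. ((\<lambda>\<tau>. u \<tau> x) has_vector_derivative u\<^sub>t) (at t) \<and>
        \<i> * u\<^sub>t + laplacian (u t) x + complex_of_real (cmod (u t x) ^ (p - 1)) * u t x = 0"
    and smooth: "\<And>t. t \<ge> T\<^sub>0 \<Longrightarrow> smooth (u t)"
    and bounded: "\<And>xs. \<exists>M. \<forall>t\<ge>T\<^sub>0. \<forall>x. cmod (foldr partial xs (u t) x) \<le> M"
    and base: "\<And>xs. decays_in_front \<beta> c T\<^sub>0 (\<lambda>t. foldr partial xs (u t))"
    and T: "0 \<le> T\<^sub>0" "T\<^sub>0 < T" and \<beta>: "0 \<le> \<beta>" and c: "0 < c"
  shows "decays_at_order \<beta> c T (real k / 2) (\<lambda>t. foldr partial xs (u t))"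
proof -
  have base': "decays_in_front \<beta> c T (\<lambda>t. foldr partial ys (u t))" for ys
    using base[of ys] T unfolding decays_in_front_def by (meson less_eq_real_def order_trans)
  have T0: "0 \<le> T" using T by simp
  have interpolate: "decays_at_order \<beta> c T (a - 1) (\<lambda>t. partial i (foldr partial ys (u t)))"
    if "decays_at_order \<beta> c T a (\<lambda>t. foldr partial ys (u t))" for a i ys
  proof (rule decays_at_order_partial[OF _ _ _ \<beta> T0 that])
    show "smooth (foldr partial ys (u t))" if "T \<le> t" for t
      using that T by (intro smooth_partials smooth) simp
    show "\<exists>M. \<forall>t\<ge>T. \<forall>x. cmod ((partial i ^^ j) (foldr partial ys (u t)) x) \<le> M" for j
      using bounded[of "replicate j i @ ys"] T unfolding funpow_partial_foldr by (meson less_eq_real_def order_trans)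
    show "decays_in_front \<beta> c T (\<lambda>t. (partial i ^^ j) (foldr partial ys (u t)))" for j
      unfolding funpow_partial_foldr by (rule base')
  qed
  have "decays_at_order \<beta> c T (real k / 2) u" for k
  proof (induction k)
    case 0
    obtain M where M: "\<And>t x. t \<ge> T\<^sub>0 \<Longrightarrow> cmod (u t x) \<le> M" using bounded[of "[]"] by auto
    show ?case
      using decays_in_front_imp_order_0[of \<beta> c T u M 0] base'[of "[]"] smooth_continuous[OF smooth] M T \<beta> by auto
  next
    case (Suc k)
    have "decays_at_order \<beta> c T (real k / 2 + 1 / 2) u"
    proof (rule mass_gains_half_order[OF eqn smooth bounded _ T \<beta> c Suc])
      show "decays_in_front \<beta> c T u" using base'[of "[]"] by simp
      show "decays_at_order \<beta> c T (real k / 2 - 1) (\<lambda>t. partial i (u t))" for i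
        using interpolate[of "real k / 2" "[]" i] Suc by simp
    qed
    then show ?case by (simp add: add_divide_distrib add.commute)
  qed
  then show ?thesis
  proof (induction xs arbitrary: k)
    case (Cons i xs)
    have "decays_at_order \<beta> c T (real (k + 2) / 2 - 1) (\<lambda>t. partial i (foldr partial xs (u t)))"
      by (rule interpolate) (rule Cons.IH[OF Cons.prems])
    then show ?case by (simp add: add_divide_distrib)
  qed simp
qed

text \<open>\<open>softplus\<close> is Lipschitz, so near \<open>x\<close> the weight is at least a multiple of its first factor at
  \<open>x\<close>. With \<open>\<epsilon> = 1 / P\<close> the regularising factor is bounded below as well.\<close>

lemma weight_lower_bound:
  fixes x y :: "real ^ 'n::finite"
  assumes xy: "norm (x - y) \<le> k" and x: "0 \<le> front \<beta> t x"
  defines "P \<equiv> 1 + softplus (front \<beta> t x)"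
  shows "P ^ n / ((1 + k) ^ n * (2 + k) ^ m * (1 + exp k)) \<le> weight (real n) m (1 / P) (front \<beta> t y)"
proof -
  define s where "s = softplus (front \<beta> t y)"
  have k: "0 \<le> k" using xy norm_ge_zero order_trans by blast
  have f: "\<bar>front \<beta> t x - front \<beta> t y\<bar> \<le> k" using front_Lipschitz xy by (rule order_trans)
  have s: "0 \<le> s" unfolding s_def by (rule softplus_nonneg)
  have P: "1 \<le> P" unfolding P_def using softplus_nonneg[of "front \<beta> t x"] by simp
  have "P \<le> 1 + s + k"
    unfolding P_def s_def using softplus_Lipschitz[of "front \<beta> t x" "front \<beta> t y"] f by linarith
  also have "\<dots> \<le> (1 + k) * (1 + s)" using k s by (simp add: algebra_simps)
  finally have 1: "(P / (1 + k)) ^ n \<le> (1 + s) ^ n"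
    using k P by (intro power_mono) (auto simp: divide_le_eq mult.commute)
  have "s \<le> (P - 1) + k"
    unfolding P_def s_def using softplus_Lipschitz[of "front \<beta> t y" "front \<beta> t x"] f by linarith
  then have "1 / P * s \<le> 1 / P * (P + k)" using P by (intro mult_left_mono) auto
  also have "\<dots> \<le> 1 + k"
    using P mult_left_mono[OF P k] by (simp add: add_divide_distrib divide_le_eq)
  finally have 2: "1 + 1 / P * s \<le> 2 + k" by simp
  have 3: "1 / (1 + exp k) \<le> logistic (front \<beta> t y)" by (rule logistic_ge) (use f x in linarith)
  have "(P / (1 + k)) ^ n * (1 / (1 + exp k)) / (2 + k) ^ m \<le>
      (1 + s) ^ n * logistic (front \<beta> t y) / (1 + 1 / P * s) ^ m"
  proof (rule frac_le)
    show "(P / (1 + k)) ^ n * (1 / (1 + exp k)) \<le> (1 + s) ^ n * logistic (front \<beta> t y)"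
      using s by (intro mult_mono 1 3) (simp_all add: exp_plus_1_pos less_imp_le)
    show "(1 + 1 / P * s) ^ m \<le> (2 + k) ^ m" using 2 P s by (intro power_mono) auto
    have "0 < 1 + 1 / P * s" using P s by (intro add_pos_nonneg) auto
    then show "0 < (1 + 1 / P * s) ^ m" by (rule zero_less_power)
    show "0 \<le> (1 + s) ^ n * logistic (front \<beta> t y)"
      using s logistic_pos[of "front \<beta> t y"] by (intro mult_nonneg_nonneg) auto
  qed
  also have "\<dots> = weight (real n) m (1 / P) (front \<beta> t y)"
    using s by (simp add: weight_def s_def[symmetric] powr_realpow)
  finally show ?thesis by (simp add: power_divide mult_ac)
qed

text \<open>With the weight of order \<open>2n\<close> in the square of the Sobolev embedding, the weighted masses of
  finitely many derivatives yield \<open>n\<close> powers of \<open>1 + softplus r \<ge> |x| - \<beta> t\<close>.\<close>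

lemma pointwise_decay:
  fixes f :: "real \<Rightarrow> real ^ 'n::finite \<Rightarrow> complex"
  assumes smooth: "\<And>t. t \<ge> T \<Longrightarrow> smooth (f t)"
    and bounded: "\<And>xs. \<exists>M. \<forall>t\<ge>T. \<forall>x. cmod (foldr partial xs (f t) x) \<le> M"
    and decay: "\<And>xs. decays_at_order \<beta> c T (real (2 * n)) (\<lambda>t. foldr partial xs (f t))"
    and \<beta>: "0 \<le> \<beta>" and T: "0 \<le> T" and c: "0 \<le> c"
  shows "\<exists>C>0. \<forall>t\<ge>T. \<forall>x. norm x > \<beta> * t \<longrightarrow> cmod (f t x) \<le> C / (norm x - \<beta> * t) ^ n"
proof -
  obtain L :: "'n list list" where L: "\<And>(F :: real ^ 'n \<Rightarrow> complex) x. smooth F \<Longrightarrow> ennreal ((cmod (F x))\<^sup>2) \<le>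
      2 ^ CARD('n) * local_energy L F x"
    by (rule sobolev_embedding[where 'n = 'n]) blast
  obtain m0 where m0: "\<And>xs m. m \<ge> m0 xs \<Longrightarrow> \<exists>C\<ge>0. mass_decays \<beta> c T (real (2 * n)) m (\<lambda>t. foldr partial xs (f t)) C"
    using decay unfolding decays_at_order_def by metis
  define m where "m = (\<Sum>ys\<leftarrow>L. m0 ys) + 2 * n + 2 * CARD('n)"
  have "m0 ys \<le> m" if "ys \<in> set L" for ys
    using member_le_sum_list[of "m0 ys" "map m0 L"] that by (simp add: m_def)
  then have "\<forall>ys\<in>set L. \<exists>C\<ge>0. mass_decays \<beta> c T (real (2 * n)) m (\<lambda>t. foldr partial ys (f t)) C"
    using m0 by blast
  then obtain C where C: "\<And>ys. ys \<in> set L \<Longrightarrow> C ys \<ge> 0" "\<And>ys t \<epsilon>. ys \<in> set L \<Longrightarrow> t \<ge> T \<Longrightarrow> 0 < \<epsilon> \<Longrightarrow> \<epsilon> \<le> 1 \<Longrightarrow>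
      weighted_mass \<beta> (real (2 * n)) m \<epsilon> t (foldr partial ys (f t)) \<le> C ys * exp (- c * t)"
    by metis
  obtain M where M: "\<And>xs t x. t \<ge> T \<Longrightarrow> cmod (foldr partial xs (f t) x) \<le> M xs"
    using bounded by metis
  have mn: "\<bar>real (2 * n)\<bar> + 2 * CARD('n) \<le> real m" by (simp add: m_def)
  define d where "d = real CARD('n)"
  define E where "E = (1 + d) ^ (2 * n) * (2 + d) ^ m * (1 + exp d)"
  have d: "0 \<le> d" by (simp add: d_def)
  have E: "0 < E" unfolding E_def using d by (intro mult_pos_pos zero_less_power add_pos_nonneg) auto
  define S where "S = (\<Sum>ys\<leftarrow>L. C ys)"
  have S: "0 \<le> S" unfolding S_def using C(1) by (intro sum_list_nonneg) auto
  have main: "cmod (f t x) \<le> (sqrt (2 ^ CARD('n) * E * S) + 1) / (norm x - \<beta> * t) ^ n"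
    if t: "t \<ge> T" and x: "norm x > \<beta> * t" for t x
  proof -
    define r where "r = front \<beta> t x"
    define P where "P = 1 + softplus r"
    have r: "norm x - \<beta> * t \<le> r" using norm_le_sqrt(1)[of x] by (simp add: r_def front_def)
    have P: "1 \<le> P" using softplus_nonneg[of r] by (simp add: P_def)
    \<comment> \<open>the regularisation parameter is taken to be \<open>1 / P\<close>, for which it costs no more than a constant
      on the ball around \<open>x\<close>\<close>
    have \<epsilon>: "0 < 1 / P" "1 / P \<le> 1" using P by auto
    have t0: "0 \<le> t" using t T by simp
    have sm: "smooth (foldr partial ys (f t))" for ys by (rule smooth_partials[OF smooth[OF t]])
    let ?w = "\<lambda>y. weight (real (2 * n)) m (1 / P) (front \<beta> t y)"
    let ?e = "\<lambda>ys y. (cmod (foldr partial ys (f t) y))\<^sup>2"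
    have int: "integrable lborel (\<lambda>y. ?e ys y * ?w y)" for ys
      by (rule integrable_weighted_mass[OF smooth_continuous[OF sm] M[OF t] \<epsilon> \<beta> t0 mn])
    have lower: "1 \<le> E / P ^ (2 * n) * ?w y" if "y \<in> cball x d" for y
    proof -
      have "norm (x - y) \<le> d" using that by (simp add: dist_norm)
      moreover have "0 \<le> front \<beta> t x" using r x by (simp add: r_def)
      ultimately have "P ^ (2 * n) / E \<le> ?w y"
        unfolding P_def r_def E_def by (rule weight_lower_bound)
      then have "E / P ^ (2 * n) * (P ^ (2 * n) / E) \<le> E / P ^ (2 * n) * ?w y"
        using E P by (intro mult_left_mono) auto
      moreover have "E / P ^ (2 * n) * (P ^ (2 * n) / E) = 1" using E P by simp
      ultimately show ?thesis by simp
    qed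
    have sum_le: "(\<integral>\<^sup>+y. indicator (cball x d) y * (\<Sum>ys\<leftarrow>K. ennreal (?e ys y)) \<partial>lborel) \<le>
        ennreal (E / P ^ (2 * n) * (\<Sum>ys\<leftarrow>K. C ys))" if "set K \<subseteq> set L" for K
      using that
    proof (induction K)
      case (Cons ys K)
      have [measurable]: "foldr partial zs (f t) \<in> borel_measurable borel" for zs
        by (rule smooth_measurable[OF sm])
      have mK: "(\<lambda>y. \<Sum>ys\<leftarrow>K. ennreal (?e ys y)) \<in> borel_measurable lborel"
        by (induction K) (simp, simp only: list.map sum_list.Cons, rule borel_measurable_add[rotated], assumption, measurable)
      have ys: "ys \<in> set L" using Cons.prems by simp
      have "(\<integral>\<^sup>+y. indicator (cball x d) y * ennreal (?e ys y) \<partial>lborel) \<le>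
          (\<integral>\<^sup>+y. ennreal (E / P ^ (2 * n) * (?e ys y * ?w y)) \<partial>lborel)"
      proof (rule nn_integral_mono)
        fix y
        show "indicator (cball x d) y * ennreal (?e ys y) \<le> ennreal (E / P ^ (2 * n) * (?e ys y * ?w y))"
        proof (cases "y \<in> cball x d")
          case True
          from mult_left_mono[OF lower[OF True], of "?e ys y"] True show ?thesis
            by (auto intro!: ennreal_leI simp: mult_ac)
        qed simp
      qed
      also have "\<dots> = ennreal (E / P ^ (2 * n) * weighted_mass \<beta> (real (2 * n)) m (1 / P) t (foldr partial ys (f t)))"
        unfolding weighted_mass_def using int[of ys] E P weight_nonneg[OF less_imp_le[OF \<epsilon>(1)]]
        by (subst nn_integral_eq_integral) auto
      also have "\<dots> \<le> ennreal (E / P ^ (2 * n) * C ys)"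
      proof (intro ennreal_leI mult_left_mono)
        have "C ys * exp (- c * t) \<le> C ys" using C(1)[OF ys] c t0 by (intro mult_left_le) auto
        with C(2)[OF ys t \<epsilon>]
        show "weighted_mass \<beta> (real (2 * n)) m (1 / P) t (foldr partial ys (f t)) \<le> C ys" by linarith
      qed (use E P in auto)
      finally have 1: "(\<integral>\<^sup>+y. indicator (cball x d) y * ennreal (?e ys y) \<partial>lborel) \<le> ennreal (E / P ^ (2 * n) * C ys)" .
      have "(\<integral>\<^sup>+y. indicator (cball x d) y * (\<Sum>ys\<leftarrow>ys # K. ennreal (?e ys y)) \<partial>lborel) =
          (\<integral>\<^sup>+y. indicator (cball x d) y * ennreal (?e ys y) + indicator (cball x d) y * (\<Sum>ys\<leftarrow>K. ennreal (?e ys y)) \<partial>lborel)"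
        by (simp only: list.map sum_list.Cons distrib_left)
      also have "\<dots> = (\<integral>\<^sup>+y. indicator (cball x d) y * ennreal (?e ys y) \<partial>lborel) +
          (\<integral>\<^sup>+y. indicator (cball x d) y * (\<Sum>ys\<leftarrow>K. ennreal (?e ys y)) \<partial>lborel)"
        by (rule nn_integral_add; intro borel_measurable_times_ennreal mK borel_measurable_indicator; simp)
      also have "\<dots> \<le> ennreal (E / P ^ (2 * n) * C ys) + ennreal (E / P ^ (2 * n) * (\<Sum>ys\<leftarrow>K. C ys))"
        using 1 Cons by (intro add_mono) auto
      also have "\<dots> = ennreal (E / P ^ (2 * n) * (\<Sum>ys\<leftarrow>ys # K. C ys))"
        using E P C(1) Cons.prems
        by (subst ennreal_plus[symmetric]) (auto intro!: mult_nonneg_nonneg divide_nonneg_nonneg sum_list_nonneg simp: distrib_left add_divide_distrib subset_iff)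
      finally show ?case .
    qed simp
    have "ennreal ((cmod (f t x))\<^sup>2) \<le> 2 ^ CARD('n) * ennreal (E / P ^ (2 * n) * S)"
      unfolding S_def
      by (rule order_trans[OF L[OF smooth[OF t]] mult_left_mono[OF sum_le[OF order_refl, unfolded d_def]]]) simp
    also have "\<dots> = ennreal (2 ^ CARD('n)) * ennreal (E / P ^ (2 * n) * S)" by (simp flip: ennreal_power)
    also have "\<dots> = ennreal (2 ^ CARD('n) * E * S / P ^ (2 * n))"
      using E S P by (simp add: mult_ac flip: ennreal_mult)
    finally have "(cmod (f t x))\<^sup>2 \<le> 2 ^ CARD('n) * E * S / P ^ (2 * n)"
      using E S P by (subst (asm) ennreal_le_iff) auto
    then have "cmod (f t x) \<le> sqrt (2 ^ CARD('n) * E * S / P ^ (2 * n))" by (rule real_le_rsqrt)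
    also have "\<dots> = sqrt (2 ^ CARD('n) * E * S) / P ^ n"
      unfolding power_even_eq using P by (simp add: real_sqrt_divide)
    also have "\<dots> \<le> (sqrt (2 ^ CARD('n) * E * S) + 1) / (norm x - \<beta> * t) ^ n"
    proof (rule frac_le)
      have "norm x - \<beta> * t \<le> P" using r softplus_ge[of r] by (simp add: P_def)
      then show "(norm x - \<beta> * t) ^ n \<le> P ^ n" using x by (intro power_mono) auto
    qed (use E S x in auto)
    finally show ?thesis .
  qed
  have "0 < sqrt (2 ^ CARD('n) * E * S) + 1" using E S by (intro add_nonneg_pos) auto
  with main show ?thesis by blast
qed

theorem theorem1p8:
  fixes p N :: nat
    and Q :: "real \<Rightarrow> real ^ 'n::finite \<Rightarrow> real"
    and \<omega> \<gamma> :: "nat \<Rightarrow> real"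
    and v x0 :: "nat \<Rightarrow> real ^ 'n"
    and T\<^sub>0 \<beta> :: real
    and u :: "real \<Rightarrow> real ^ 'n \<Rightarrow> complex"
  assumes p_odd: "odd p" and p_gt: "1 < p"
    and p_subcritical: "CARD('n) > 2 \<Longrightarrow> real p < 1 + 4 / (real CARD('n) - 2)"
    and N: "N \<ge> 1"
    and omega_pos: "\<And>j. j \<in> {1..N} \<Longrightarrow> \<omega> j > 0"
    and v_distinct: "inj_on v {1..N}"
    and Q_ground_state: "\<And>j. j \<in> {1..N} \<Longrightarrow> ground_state p (\<omega> j) (Q (\<omega> j))"
    and Q_decay: "\<And>j \<sigma>. j \<in> {1..N} \<Longrightarrow>
      \<exists>C>0. \<forall>x. \<bar>multi_partial \<sigma> (Q (\<omega> j)) x\<bar> \<le> C * exp (- sqrt (\<omega> j) * norm x)"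
    and T0: "T\<^sub>0 \<ge> 0"
    and u: "multi_soliton p Q N \<omega> v \<gamma> x0 T\<^sub>0 u"
    and beta: "\<beta> > Max ((\<lambda>j. norm (v j)) ` {1..N})"
  shows "\<exists>T\<^sub>1>0. T\<^sub>1 \<ge> T\<^sub>0 \<and>
    (\<forall>(s :: nat ^ 'n) (n :: nat). \<exists>C>0. \<forall>t\<ge>T\<^sub>1. \<forall>x. norm x > \<beta> * t \<longrightarrow>
      cmod (multi_partial s (u t) x) \<le> C / (norm x - \<beta> * t) ^ n)"
proof -
  have speed: "norm (v j) < \<beta>" if "j \<in> {1..N}" for j
    using that by (intro le_less_trans[OF Max_ge beta]) auto
  have "1 \<in> {1..N}" using N by simp
  then have \<beta>: "0 \<le> \<beta>" using speed[of 1] norm_ge_zero[of "v 1"] by linarith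
  have Q: "smooth (Q (\<omega> j))" if "j \<in> {1..N}" for j
    using Q_ground_state[OF that] by (simp add: ground_state_def)
  obtain c where c: "c > 0" and bounded: "\<And>xs. \<exists>M. \<forall>t\<ge>T\<^sub>0. \<forall>x. cmod (foldr partial xs (u t) x) \<le> M"
    and front: "\<And>xs. decays_in_front \<beta> c T\<^sub>0 (\<lambda>t. foldr partial xs (u t))"
    using multi_soliton_in_front[OF omega_pos Q Q_decay T0 u speed] by blast
  have nls: "nls_solution p T\<^sub>0 u" using u by (simp add: multi_soliton_def)
  have smooth: "smooth (u t)" if "t \<ge> T\<^sub>0" for t
    using nls that by (simp add: nls_solution_def)
  have eqn: "\<exists>u\<^sub>t. ((\<lambda>\<tau>. u \<tau> x) has_vector_derivative u\<^sub>t) (at t) \<and>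
      \<i> * u\<^sub>t + laplacian (u t) x + complex_of_real (cmod (u t x) ^ (p - 1)) * u t x = 0" if t: "t > T\<^sub>0" for t x
  proof -
    have "at t within {T\<^sub>0..} = at t"
      using t by (intro at_within_interior) simp
    moreover have "\<exists>u\<^sub>t. ((\<lambda>\<tau>. u \<tau> x) has_vector_derivative u\<^sub>t) (at t within {T\<^sub>0..}) \<and>
        \<i> * u\<^sub>t + laplacian (u t) x + complex_of_real (cmod (u t x) ^ (p - 1)) * u t x = 0"
      using nls less_imp_le[OF t] unfolding nls_solution_def by blast
    ultimately show ?thesis by (simp only:)
  qed
  \<comment> \<open>at \<open>T\<^sub>0\<close> itself the time derivative is one-sided\<close>
  define T\<^sub>1 where "T\<^sub>1 = T\<^sub>0 + 1"
  have T1: "T\<^sub>0 < T\<^sub>1" "0 \<le> T\<^sub>1" using T0 by (auto simp: T\<^sub>1_def)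
  have "\<exists>C>0. \<forall>t\<ge>T\<^sub>1. \<forall>x. norm x > \<beta> * t \<longrightarrow> cmod (multi_partial s (u t) x) \<le> C / (norm x - \<beta> * t) ^ n"
    for s :: "nat ^ 'n" and n
  proof -
    obtain xs :: "'n list" where xs: "\<And>f :: real ^ 'n \<Rightarrow> complex. multi_partial s f = foldr partial xs f"
      by (rule multi_partial_list[where 'b = complex and 'c = complex, of s]) blast
    show ?thesis
      unfolding xs
    proof (rule pointwise_decay[OF _ _ _ \<beta> T1(2) less_imp_le[OF c]])
      show "smooth (foldr partial xs (u t))" if "t \<ge> T\<^sub>1" for t
        using that T1 by (intro smooth_partials smooth) simp
      fix ys
      show "\<exists>M. \<forall>t\<ge>T\<^sub>1. \<forall>x. cmod (foldr partial ys (foldr partial xs (u t)) x) \<le> M"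
        using bounded[of "ys @ xs"] T1(1) unfolding foldr_append o_apply by (meson less_imp_le order_trans)
      show "decays_at_order \<beta> c T\<^sub>1 (real (2 * n)) (\<lambda>t. foldr partial ys (foldr partial xs (u t)))"
        using decays_at_every_order[OF eqn smooth bounded front T0 T1(1) \<beta> c, of "4 * n" "ys @ xs"] by simp
    qed
  qed
  then show ?thesis using T0 by (intro exI[of _ T\<^sub>1]) (auto simp: T\<^sub>1_def)
qed

end
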